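(* Let $s$ be an odd positive integer, $k$ a positive integer and $\mu$ a strict partition. Then $$(p_s\circ q_k)\,Q_{\mu}=\sum_{\lambda}\operatorname{sgn}(\sigma)\,2^{A(\lambda/\mu)}\,2^{l(\mu)-l(\lambda)}\,Q_{\lambda},$$ where the sum runs over all strict partitions $\lambda\supset\mu$ such that $\lambda/\mu$ is a symmetric horizontal $(s,k)$-strip, $\sigma=\sigma_{\lambda,\mu}$ is the permutation of the reordering of $\lambda$ with respect to $\mu$, and $A(\lambda/\mu)$ is the normalized $a$-number of $\lambda/\mu$.
   Context: A strict partition is a partition with distinct positive parts; $l(\cdot)$ is the number of positive parts; $\mu\subset\lambda$ means $\mu_i\le\lambda_i$ for all $i$. Schur $Q$-functions: let $\Gamma_{\mathbb Q}=\mathbb Q[p_1,p_3,p_5,\dots]$ ($p_m$ the power sums). Define operators $Q_m$ ($m\in\mathbb Z$) on $\Gamma_{\mathbb Q}$ by $$Q(z)=\exp\Big(\sum_{m\ge1\text{ odd}}\tfrac2m p_mz^m\Big)\exp\Big(-\sum_{m\ge1\text{ odd}}\tfrac{\partial}{\partial p_m}z^{-m}\Big)=\sum_{m\in\mathbb Z}Q_mz^m .$$ For a strict partition $\lambda=(\lambda_1,\dots,\lambda_l)$ the Schur $Q$-function is $Q_\lambda=Q_{\lambda_1}\cdots Q_{\lambda_l}.1$ (with $Q_\emptyset=1$). The elements $q_m$ are defined by $\sum_{m\ge0}q_mz^m=\exp(\sum_{m\ge1\text{ odd}}\frac2mp_mz^m)$, so $q_k=Q_{(k)}$. The plethysm $p_s\circ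 q_k$ is $q_k(x_1^s,x_2^s,\dots)$, i.e. the image of $q_k$ under $p_m\mapsto p_{sm}$. Padding: write $\lambda=(\lambda_1,\dots,\lambda_b)$ with $b=l(\lambda)$, and $\mu=(\mu_1,\dots,\mu_a)$ with $a=l(\mu)$ if $l(\mu)+l(\lambda)$ is even, and $a=l(\mu)+1$, $\mu_a=0$ if $l(\mu)+l(\lambda)$ is odd. For $0\le r\le s-1$, $N_r(\lambda)$ (resp. $N_r(\mu)$) is the set of entries of $(\lambda_1,\dots,\lambda_b)$ (resp. $(\mu_1,\dots,\mu_a)$) congruent to $r$ mod $s$ (an appended $0$ counts as an element of $N_0(\mu)$); $n_r(\lambda),n_r(\mu)$ are the cardinalities; the elements in decreasing order are $\lambda_{r,1}>\lambda_{r,2}>\cdots$ and $\mu_{r,1}>\mu_{r,2}>\cdots$; these decreasing sequences are denoted $N_r(\lambda)_>$, $N_r(\mu)_>$. Symmetric horizontal $(s,k)$-strip: $\lambda/\mu$ is one, equivalently $(\lambda,\mu)\in\mathcal{SP}_{s,k}$, if $\mu\subset\lambda$ are strict partitions with $|\lambda|=|\mu|+sk$ (where a part $\mu_a=0$ is appended to $\mu$ exactly when $l(\mu)+l(\lambda)$ is odd, so that the number of entries $a+b$ is even, and this appended $0$ is counted in $N_0(\mu)$ and $n_0(\mu)$) and (i) $n_0(\lambda)=n_0(\mu)$ and $0\le n_r(\lambda)-n_r(\mu)=n_{s-r}(\lambda)-n_{s-r}(\mu)\le1$ for all $0<r\le s-1$; (ii) whenever $N_r(\mu)\ne\emptyset$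 and $1\le j\le n_r(\mu)$, one has $\lambda_{r,j}\ge\mu_{r,j}\ge\lambda_{r,j+1}$ (the last inequality being void if $j+1>n_r(\lambda)$). Then each $N_r(\lambda)_>/N_r(\mu)_>$ is a horizontal strip (at most one box in each column). Normalized $a$-number: for a horizontal strip $\theta$, $a(\theta)$ is the number of integers $i\ge1$ such that $\theta$ has a box in column $i$ but not in column $i+1$; $A(\lambda/\mu)=\sum_{r=0}^{s-1}a(N_r(\lambda)_>/N_r(\mu)_>)$. The permutation $\sigma=\sigma_{\lambda,\mu}\in\mathfrak S_b$: define a rearrangement $\tilde\lambda=(\tilde\lambda_1,\dots,\tilde\lambda_b)$ of $\lambda$ as follows. (1) For $1\le i\le a$, if $\mu_i=\mu_{r_i,j_i}$ then $\tilde\lambda_i=\lambda_{r_i,j_i}$. (2) Let $R(\lambda)$ be the set of remaining parts of $\lambda$. For each odd $j\in\{1,3,\dots,s-2\}$, the sets $N_j(R(\lambda))$ and $N_{s-j}(R(\lambda))$ of elements of $R(\lambda)$ congruent to $j$, resp. $s-j$, mod $s$ are either both empty or both singletons. Let $j_1<j_2<\cdots$ be those odd $j$ for which they are nonempty; for $i=a+1,a+3,\dots,b-1$ let $\tilde\lambda_i$ be the element of $N_{j_{(i-a+1)/2}}(R(\lambda))$ and $\tilde\lambda_{i+1}$ the element of $N_{s-j_{(i-a+1)/2}}(R(\lambda))$. Then $\sigma$ is the permutation with $\tilde\lambda_i=\lambda_{\sigma(i)}$. *)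

theory Defs
  imports
    "HOL-Library.Poly_Mapping"
    "HOL-Computational_Algebra.Formal_Power_Series"
    "HOL-Combinatorics.Permutations"
begin

section \<open>The ring of odd power sums\<close>

text \<open>
  Polynomials over the rationals in countably many indeterminates \<open>x 0, x 1, x 2, \<dots>\<close>,
  the outer finitely supported map assigning coefficients to exponent vectors.
  The indeterminate \<open>x i\<close> is read as the power sum of odd degree \<open>2 * i + 1\<close>, so that the type
  is \<open>\<rat>[p 1, p 3, p 5, \<dots>]\<close>. Accordingly \<open>p m\<close>, \<open>dp m\<close> are meaningful only for odd \<open>m\<close>.
\<close>

type_synonym gamma = "(nat \<Rightarrow>\<^sub>0 nat) \<Rightarrow>\<^sub>0 rat"

definition const :: "rat \<Rightarrow> gamma"
  where "const c = Poly_Mapping.single 0 c"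

definition p :: "nat \<Rightarrow> gamma"
  where "p m = Poly_Mapping.single (Poly_Mapping.single (m div 2) 1) 1"

text \<open>The partial derivative with respect to \<open>p m\<close>.\<close>

definition dp :: "nat \<Rightarrow> gamma \<Rightarrow> gamma"
  where "dp m f =
    (\<Sum>e \<in> Poly_Mapping.keys f.
       Poly_Mapping.single (e - Poly_Mapping.single (m div 2) 1)
         (of_nat (Poly_Mapping.lookup e (m div 2)) * Poly_Mapping.lookup f e))"

text \<open>
  The plethysm \<open>f \<mapsto> p_s \<circ> f\<close> for odd \<open>s\<close>: the ring endomorphism with \<open>p m \<mapsto> p (s * m)\<close>.
\<close>

definition plethysm_p :: "nat \<Rightarrow> gamma \<Rightarrow> gamma"
  where "plethysm_p s f =
    (\<Sum>e \<in> Poly_Mapping.keys f.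
       const (Poly_Mapping.lookup f e) *
       (\<Prod>i \<in> Poly_Mapping.keys e. p (s * (2 * i + 1)) ^ Poly_Mapping.lookup e i))"


section \<open>Schur Q-functions\<close>

text \<open>
  The exponential of a power series without constant term; the library's \<^const>\<open>fps_exp\<close>
  requires the coefficients to form a field.
\<close>

definition exp_fps :: "gamma fps \<Rightarrow> gamma fps"
  where "exp_fps F = Abs_fps (\<lambda>n. const (1 / fact n)) oo F"

definition q :: "nat \<Rightarrow> gamma"
  where "q m =
    fps_nth (exp_fps (Abs_fps (\<lambda>j. if odd j then const (2 / of_nat j) * p j else 0))) m"

text \<open>
  With \<open>w = z\<inverse>\<close>, the operator \<open>- (\<Sum>m odd. dp m * w ^ m)\<close> acting on power series in \<open>w\<close>
  with coefficients in \<^typ>\<open>gamma\<close>. Each application multiplies by \<open>w\<close> at least once, so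
  only its iterates up to the \<open>n\<close>-th contribute to the coefficient of \<open>w ^ n\<close> in its exponential.
\<close>

definition neg_deriv_op :: "gamma fps \<Rightarrow> gamma fps"
  where "neg_deriv_op F =
    Abs_fps (\<lambda>n. - (\<Sum>m \<in> {m. m \<le> n \<and> odd m}. dp m (fps_nth F (n - m))))"

definition exp_neg_deriv :: "nat \<Rightarrow> gamma \<Rightarrow> gamma"
  where "exp_neg_deriv n f =
    (\<Sum>j \<le> n. const (1 / fact j) * fps_nth ((neg_deriv_op ^^ j) (fps_const f)) n)"

text \<open>
  The coefficient \<open>Q_m\<close> of \<open>z ^ m\<close> in \<open>Q(z)\<close>. For every \<open>f\<close> the sum has only finitely many nonzero
  terms, since \<open>exp_neg_deriv n\<close> lowers the degree by \<open>n\<close> when \<open>p m\<close> has degree \<open>m\<close>.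
\<close>

definition Q_op :: "int \<Rightarrow> gamma \<Rightarrow> gamma"
  where "Q_op m f =
    Sum_any (\<lambda>n. if 0 \<le> m + int n then q (nat (m + int n)) * exp_neg_deriv n f else 0)"

definition schur_Q :: "nat list \<Rightarrow> gamma"
  where "schur_Q lam = foldr (\<lambda>m. Q_op (int m)) lam 1"


section \<open>Strict partitions and symmetric horizontal strips\<close>

text \<open>
  A strict partition is the list of its positive parts in decreasing order, so that
  \<^const>\<open>length\<close> is the number of its positive parts. All list positions are counted from 0.
\<close>

definition strict_partition :: "nat list \<Rightarrow> bool"
  where "strict_partition lam \<longleftrightarrow> sorted_wrt (>) lam \<and> (\<forall>x \<in> set lam. 0 < x)"

definition part :: "nat list \<Rightarrow> nat \<Rightarrow> nat"
  where "part lam i = (if i < length lam then lam ! i else 0)"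

definition part_subset :: "nat list \<Rightarrow> nat list \<Rightarrow> bool"
  where "part_subset mu lam \<longleftrightarrow> (\<forall>i. part mu i \<le> part lam i)"

definition pad :: "nat list \<Rightarrow> nat list \<Rightarrow> nat list"
  where "pad mu lam = (if even (length mu + length lam) then mu else mu @ [0])"

text \<open>The decreasing sequence of the entries congruent to \<open>r\<close>, for a decreasing list.\<close>

definition residue_parts :: "nat \<Rightarrow> nat \<Rightarrow> nat list \<Rightarrow> nat list"
  where "residue_parts s r xs = filter (\<lambda>x. x mod s = r) xs"

definition sym_hor_strip :: "nat \<Rightarrow> nat \<Rightarrow> nat list \<Rightarrow> nat list \<Rightarrow> bool"
  where "sym_hor_strip s k lam mu \<longleftrightarrow>
    part_subset mu lam \<and>
    sum_list lam = sum_list mu + s * k \<and>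
    (let N_lam = (\<lambda>r. residue_parts s r lam);
         N_mu = (\<lambda>r. residue_parts s r (pad mu lam));
         diff = (\<lambda>r. int (length (N_lam r)) - int (length (N_mu r)))
     in length (N_lam 0) = length (N_mu 0) \<and>
        (\<forall>r. 0 < r \<and> r \<le> s - 1 \<longrightarrow> 0 \<le> diff r \<and> diff r = diff (s - r) \<and> diff (s - r) \<le> 1) \<and>
        (\<forall>r < s. \<forall>j < length (N_mu r).
           N_lam r ! j \<ge> N_mu r ! j \<and>
           (j + 1 < length (N_lam r) \<longrightarrow> N_mu r ! j \<ge> N_lam r ! (j + 1))))"

text \<open>
  The skew diagram of \<open>al / be\<close> consists of the boxes \<open>(i, c)\<close> with
  \<open>part be i < c \<le> part al i\<close>, columns being counted from 1.
\<close>

definition has_box_in_column :: "nat list \<Rightarrow> nat list \<Rightarrow> nat \<Rightarrow> bool"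
  where "has_box_in_column al be c \<longleftrightarrow> (\<exists>i. part be i < c \<and> c \<le> part al i)"

definition a_number :: "nat list \<Rightarrow> nat list \<Rightarrow> nat"
  where "a_number al be =
    card {c. 1 \<le> c \<and> has_box_in_column al be c \<and> \<not> has_box_in_column al be (c + 1)}"

definition normalized_a_number :: "nat \<Rightarrow> nat list \<Rightarrow> nat list \<Rightarrow> nat"
  where "normalized_a_number s lam mu =
    (\<Sum>r < s. a_number (residue_parts s r lam) (residue_parts s r (pad mu lam)))"


section \<open>The reordering permutation\<close>

text \<open>
  The part of \<open>lam\<close> matched with the entry \<open>m\<close> of the padded \<open>mu\<close>: if \<open>m\<close> is the \<open>j\<close>-th
  largest entry of \<open>mu\<close> in its residue class, it is the \<open>j\<close>-th largest part of \<open>lam\<close> in that class.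
\<close>

definition matched_part :: "nat \<Rightarrow> nat list \<Rightarrow> nat list \<Rightarrow> nat \<Rightarrow> nat"
  where "matched_part s lam mu m =
    the (map_of (zip (residue_parts s (m mod s) (pad mu lam)) (residue_parts s (m mod s) lam)) m)"

definition matched_parts :: "nat \<Rightarrow> nat list \<Rightarrow> nat list \<Rightarrow> nat list"
  where "matched_parts s lam mu = map (matched_part s lam mu) (pad mu lam)"

definition remaining_parts :: "nat \<Rightarrow> nat list \<Rightarrow> nat list \<Rightarrow> nat list"
  where "remaining_parts s lam mu = filter (\<lambda>x. x \<notin> set (matched_parts s lam mu)) lam"

text \<open>
  For a symmetric horizontal strip the two lists appended for each odd \<open>j \<le> s - 2\<close> are both
  empty or both singletons.
\<close>

definition reordering :: "nat \<Rightarrow> nat list \<Rightarrow> nat list \<Rightarrow> nat list"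
  where "reordering s lam mu =
    matched_parts s lam mu @
    concat (map (\<lambda>j. residue_parts s j (remaining_parts s lam mu) @
                      residue_parts s (s - j) (remaining_parts s lam mu))
              (filter odd [1..<s - 1]))"

definition reordering_perm :: "nat \<Rightarrow> nat list \<Rightarrow> nat list \<Rightarrow> nat \<Rightarrow> nat"
  where "reordering_perm s lam mu =
    (THE \<sigma>. \<sigma> permutes {..<length lam} \<and>
            (\<forall>i < length lam. reordering s lam mu ! i = lam ! \<sigma> i))"


text \<open>The strips over a given partition form a finite set, so sums over them are genuine.\<close>

lemma finite_sym_hor_strips:
  "finite {lam. strict_partition lam \<and> sym_hor_strip s k lam mu}"
proof (rule finite_subset)
  let ?n = "sum_list mu + s * k"
  show "finite {lam. set lam \<subseteq> {..?n} \<and> length lam \<le> ?n}"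
    by (rule finite_lists_length_le) simp
  have "length lam \<le> sum_list lam" if "\<forall>x \<in> set lam. 0 < x" for lam :: "nat list"
    using that by (induction lam) auto
  moreover have "set lam \<subseteq> {..sum_list lam}" for lam :: "nat list"
    by (auto intro: member_le_sum_list)
  ultimately show "{lam. strict_partition lam \<and> sym_hor_strip s k lam mu}
      \<subseteq> {lam. set lam \<subseteq> {..?n} \<and> length lam \<le> ?n}"
    unfolding strict_partition_def sym_hor_strip_def by (smt (verit) mem_Collect_eq subsetI)
qed

end

theory Submission
  imports Defs
begin

text \<open>
  The generating operators \<open>\<Sum>a. w a * x ^ a * Q_op a\<close> over indices \<open>a \<ge> 0\<close> anticommute up to the
  contribution of \<open>Q_op 0\<close> (\<open>Q_gen_anticommute\<close>, a consequence of the Clifford relation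
  \<open>Q_op_anticommute\<close>). The proof computes with such operators, which are determined by their weights
  \<open>w\<close>, and reads off the sum over strips at the end.

  Let \<open>G\<close> be the series \<open>\<Sum>k. (p_s \<circ> q k) * x ^ (s * k)\<close>. Conjugation by \<open>G\<close> multiplies \<open>Q(w)\<close> by
  \<open>(1 + (x / w) ^ s) / (1 - (x / w) ^ s)\<close>. Hence moving \<open>G\<close> to the right through the operators that build
  \<open>schur_Q mu\<close> replaces each \<open>Q_op m\<close> by the ladder \<open>Q_op m + 2 * Q_op (m + s) + 2 * Q_op (m + 2 * s) + \<dots>\<close>,
  with powers of \<open>x\<close> (\<open>plethysm_series_mult_word\<close>).

  It remains to write \<open>G\<close> itself by such operators applied to \<open>1\<close>. Let \<open>T r\<close> be the sum of
  \<open>x ^ a * Q_op a\<close> over the residue class \<open>r\<close> modulo \<open>s\<close>. Then \<open>G\<close> is \<open>T 0\<close> times the product of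
  \<open>1 + T j * T (s - j)\<close> over the odd \<open>j < s - 1\<close> (\<open>plethysm_series_factorization\<close>). Indeed,
  \<open>Q_op (- n)\<close> kills \<open>1\<close> for \<open>n > 0\<close>, so its conjugate by \<open>G\<close> kills \<open>G\<close>; by the Clifford relation it
  kills the product as well, and a series killed by all these conjugates is determined by its constant
  terms (\<open>conj_annihilator_kernel_unique\<close>). Choosing one of the two summands in every factor explains
  why the classes \<open>j\<close> and \<open>s - j\<close> of a strip gain a part together, and why the reordering lists
  them in this order.

  An operator whose weight vanishes at \<open>0\<close> has square zero, so a multiple of the ladder of a previous
  part of \<open>mu\<close> may be subtracted from any later operator. With the previous part of the same residue
  class this cuts each ladder down to the interval between two consecutive parts of the class: the weights
  become \<open>1, 2, \<dots>, 2, 1\<close>, and half of this for the additional parts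
  (\<open>plethysm_mult_schur_Q_expansion\<close>, \<open>cell_weight_value\<close>). So the product is a sum over words whose
  residue classes interlace with those of \<open>mu\<close>, which is the condition on a strip. In each class the
  product of the weights is two to the \<open>a\<close>-number (\<open>two_power_a_number\<close>), and each additional
  part gives a factor \<open>1 / 2\<close>. Words with a repeated positive entry vanish, a zero entry may be dropped,
  and sorting the other words into decreasing order gives the sign of the reordering
  (\<open>reordering_perm_schur_Q\<close>). Finally the words correspond bijectively to the strips
  (\<open>strip_word.sym_hor_strip_lam\<close>, \<open>strip_to_word\<close>).
\<close>

unbundle fps_syntax

section \<open>The coefficient ring\<close>

lemma const_0 [simp]: "const 0 = 0"
  by (simp add: const_def)

lemma const_1 [simp]: "const 1 = 1"
  by (simp add: const_def)

lemma const_add: "const (a + b) = const a + const b"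
  by (simp add: const_def single_add)

lemma const_mult: "const (a * b) = const a * const b"
  by (simp add: const_def mult_single)

lemma const_uminus: "const (- a) = - const a"
  by (simp add: const_def single_uminus)

lemma const_of_nat: "const (of_nat n) = of_nat n"
  by (simp add: const_def)

lemma const_numeral [simp]: "const (numeral n) = numeral n"
  by (simp add: const_def)

lemma const_sum: "const (\<Sum>i\<in>A. f i) = (\<Sum>i\<in>A. const (f i))"
  by (induction A rule: infinite_finite_induct) (auto simp: const_add)

lemma sum_single_lookup:
  fixes f :: "'a \<Rightarrow>\<^sub>0 'b::comm_monoid_add"
  shows "f = (\<Sum>e\<in>Poly_Mapping.keys f. Poly_Mapping.single e (Poly_Mapping.lookup f e))"
proof (rule poly_mapping_eqI)
  fix k
  show "Poly_Mapping.lookup f k =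
    Poly_Mapping.lookup (\<Sum>e\<in>Poly_Mapping.keys f. Poly_Mapping.single e (Poly_Mapping.lookup f e)) k"
    by (simp add: lookup_sum lookup_single when_def in_keys_iff)
qed

lemma poly_mapping_add_induct [case_names zero single add]:
  fixes f :: "'a \<Rightarrow>\<^sub>0 'b::comm_monoid_add"
  assumes "P 0" and single: "\<And>e c. P (Poly_Mapping.single e c)"
    and add: "\<And>f g. P f \<Longrightarrow> P g \<Longrightarrow> P (f + g)"
  shows "P f"
proof -
  have "P (\<Sum>e\<in>A. Poly_Mapping.single e (Poly_Mapping.lookup f e))" if "finite A" for A
    using that by (induction A) (auto intro: assms)
  then show ?thesis
    by (subst sum_single_lookup) simp
qed

lemma odd_div_2_eq: "odd m \<Longrightarrow> 2 * (m div 2) + 1 = (m::nat)"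
  by simp

lemma monomial_as_power:
  "Poly_Mapping.single (Poly_Mapping.single i n) (1::rat) = p (2 * i + 1) ^ n"
proof (induction n)
  case (Suc n)
  have "Poly_Mapping.single i (Suc n) = Poly_Mapping.single i 1 + Poly_Mapping.single i n"
    by (simp add: single_add [symmetric])
  moreover have "p (2 * i + 1) ^ Suc n = p (2 * i + 1) * Poly_Mapping.single (Poly_Mapping.single i n) 1"
    by (simp only: power_Suc Suc)
  ultimately show ?case
    by (simp add: p_def mult_single)
qed simp

lemma gamma_induct [case_names const p add mult]:
  assumes const: "\<And>c. P (const c)" and p: "\<And>m. odd m \<Longrightarrow> P (p m)"
    and add: "\<And>f g. P f \<Longrightarrow> P g \<Longrightarrow> P (f + g)"
    and mult: "\<And>f g. P f \<Longrightarrow> P g \<Longrightarrow> P (f * g)"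
  shows "P f"
proof (induction f rule: poly_mapping_add_induct)
  case zero
  show ?case using const [of 0] by simp
next
  case (single e c)
  have "P (p (2 * i + 1) ^ n)" for i n
    using const [of 1] by (induction n) (auto intro!: p mult)
  then have "P (Poly_Mapping.single e 1)"
  proof (induction e rule: poly_mapping_add_induct)
    case zero
    then show ?case using const [of 1] by simp
  next
    case (single i n)
    then show ?case by (metis monomial_as_power)
  next
    case (add e e')
    then show ?case using mult by (metis mult.right_neutral mult_single)
  qed
  moreover have "Poly_Mapping.single e c = const c * Poly_Mapping.single e 1"
    by (simp add: const_def mult_single)
  ultimately show ?case by (simp add: const mult)
next
  case (add f g)
  then show ?case by (rule assms)
qed

definition const_term :: "gamma \<Rightarrow> rat"
  where "const_term f = Poly_Mapping.lookup f 0"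

lemma const_term_add: "const_term (f + g) = const_term f + const_term g"
  by (simp add: const_term_def lookup_add)

lemma const_term_diff: "const_term (f - g) = const_term f - const_term g"
  by (simp add: const_term_def lookup_minus)

lemma const_term_sum: "const_term (\<Sum>i\<in>A. f i) = (\<Sum>i\<in>A. const_term (f i))"
  by (simp add: const_term_def lookup_sum)

lemma const_term_const [simp]: "const_term (const c) = c"
  by (simp add: const_term_def const_def)

lemma const_term_1 [simp]: "const_term 1 = 1"
  by (simp add: const_term_def)

lemma exponent_add_eq_0: "(a::nat \<Rightarrow>\<^sub>0 nat) + b = 0 \<longleftrightarrow> a = 0 \<and> b = 0"
  by (metis add_is_0 lookup_add lookup_zero poly_mapping_eqI)

lemma const_term_mult: "const_term (f * g) = const_term f * const_term g"
proof (induction f rule: poly_mapping_add_induct)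
  case zero
  then show ?case by (simp add: const_term_def)
next
  case (single e c)
  show ?case
  proof (induction g rule: poly_mapping_add_induct)
    case zero
    then show ?case by (simp add: const_term_def)
  next
    case (single e' c')
    then show ?case
      by (auto simp: const_term_def mult_single lookup_single when_def exponent_add_eq_0)
  qed (simp add: distrib_left const_term_add)
qed (simp add: distrib_right const_term_add)

lemma const_term_p [simp]: "const_term (p m) = 0"
proof -
  have "Poly_Mapping.single (m div 2) (1::nat) \<noteq> 0"
    by (metis lookup_single_eq lookup_zero zero_neq_one)
  then show ?thesis
    by (auto simp: const_term_def p_def lookup_single when_def)
qed


section \<open>Partial derivatives\<close>

lemma lookup_dp:
  "Poly_Mapping.lookup (dp m f) e =
    of_nat (Poly_Mapping.lookup e (m div 2) + 1) *
    Poly_Mapping.lookup f (e + Poly_Mapping.single (m div 2) 1)"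
proof -
  let ?s = "Poly_Mapping.single (m div 2) (1::nat)"
  have shift: "e' = e + ?s" if "e' - ?s = e" "Poly_Mapping.lookup e' (m div 2) \<noteq> 0" for e'
  proof (rule poly_mapping_eqI)
    fix k
    show "Poly_Mapping.lookup e' k = Poly_Mapping.lookup (e + ?s) k"
      using that by (auto simp: lookup_add lookup_minus lookup_single when_def)
  qed
  have "Poly_Mapping.lookup (dp m f) e =
    (\<Sum>e'\<in>Poly_Mapping.keys f.
      of_nat (Poly_Mapping.lookup e' (m div 2)) * Poly_Mapping.lookup f e' when e' - ?s = e)"
    by (simp add: dp_def lookup_sum lookup_single)
  also have "\<dots> = (\<Sum>e'\<in>Poly_Mapping.keys f. if e' = e + ?s then
      of_nat (Poly_Mapping.lookup e' (m div 2)) * Poly_Mapping.lookup f e' else 0)"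
    by (intro sum.cong) (use shift in \<open>fastforce simp: when_def\<close>)+
  also have "\<dots> = of_nat (Poly_Mapping.lookup e (m div 2) + 1) * Poly_Mapping.lookup f (e + ?s)"
    by (simp add: in_keys_iff lookup_add)
  finally show ?thesis .
qed

lemma dp_add: "dp m (f + g) = dp m f + dp m g"
  by (rule poly_mapping_eqI) (simp only: lookup_dp lookup_add distrib_left)

lemma dp_0 [simp]: "dp m 0 = 0"
  by (rule poly_mapping_eqI) (simp add: lookup_dp)

lemma dp_const [simp]: "dp m (const c) = 0"
  by (simp add: dp_def const_def)

lemma dp_1 [simp]: "dp m 1 = 0"
  using dp_const [of m 1] by simp

lemma dp_single:
  "dp m (Poly_Mapping.single e c) =
    Poly_Mapping.single (e - Poly_Mapping.single (m div 2) 1)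
      (of_nat (Poly_Mapping.lookup e (m div 2)) * c)"
  by (cases "c = 0") (simp_all add: dp_def)

lemma dp_p:
  assumes "odd m" and "odd n"
  shows "dp m (p n) = (if m = n then 1 else 0)"
proof -
  have "m div 2 = n div 2 \<longleftrightarrow> m = n"
    using assms by (metis odd_div_2_eq)
  then show ?thesis
    by (cases "m = n") (simp_all add: p_def dp_single lookup_single when_def eq_commute)
qed

lemma dp_mult: "dp m (f * g) = dp m f * g + f * dp m g"
proof (induction f rule: poly_mapping_add_induct)
  case zero
  then show ?case by simp
next
  case (single a c)
  show ?case
  proof (induction g rule: poly_mapping_add_induct)
    case zero
    then show ?case by simp
  next
    case (single b d)
    let ?s = "Poly_Mapping.single (m div 2) (1::nat)"
    have "a - ?s + b = a + b - ?s" if "Poly_Mapping.lookup a (m div 2) \<noteq> 0"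
      by (rule poly_mapping_eqI)
        (use that in \<open>auto simp: lookup_add lookup_minus lookup_single when_def\<close>)
    moreover have "a + (b - ?s) = a + b - ?s" if "Poly_Mapping.lookup b (m div 2) \<noteq> 0"
      by (rule poly_mapping_eqI)
        (use that in \<open>auto simp: lookup_add lookup_minus lookup_single when_def\<close>)
    ultimately show ?case
      by (cases "Poly_Mapping.lookup a (m div 2) = 0"; cases "Poly_Mapping.lookup b (m div 2) = 0")
        (simp_all add: dp_single mult_single lookup_add single_add [symmetric] algebra_simps)
  next
    case (add g h)
    then show ?case by (simp add: distrib_left dp_add)
  qed
next
  case (add f h)
  then show ?case by (simp add: distrib_right dp_add)
qed

lemma dp_sum: "dp m (\<Sum>i\<in>A. f i) = (\<Sum>i\<in>A. dp m (f i))"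
  by (induction A rule: infinite_finite_induct) (auto simp: dp_add)

lemma dp_const_mult: "dp m (const c * f) = const c * dp m f"
  by (simp add: dp_mult)

lemma dp_uminus: "dp m (- f) = - dp m f"
  using dp_const_mult [of m "- 1" f] by (simp add: const_uminus)

text \<open>
  In characteristic zero every monomial with an exponent \<open>e \<noteq> 0\<close> survives some partial derivative.
\<close>

lemma constant_if_dp_zero:
  assumes "\<And>m. odd m \<Longrightarrow> dp m f = 0"
  shows "f = const (const_term f)"
proof (rule poly_mapping_eqI)
  fix e
  show "Poly_Mapping.lookup f e = Poly_Mapping.lookup (const (const_term f)) e"
  proof (cases "e = 0")
    case True
    then show ?thesis by (simp add: const_def const_term_def)
  next
    case False
    then obtain i where i: "Poly_Mapping.lookup e i \<noteq> 0"
      by (metis lookup_zero poly_mapping_eqI)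
    define e' where "e' = e - Poly_Mapping.single i 1"
    have "e = e' + Poly_Mapping.single i 1"
      unfolding e'_def by (rule poly_mapping_eqI)
        (use i in \<open>auto simp: lookup_add lookup_minus lookup_single when_def\<close>)
    moreover have "Poly_Mapping.lookup (dp (2 * i + 1) f) e' = 0"
      using assms [of "2 * i + 1"] by simp
    ultimately have "Poly_Mapping.lookup f e = 0"
      by (simp add: lookup_dp del: of_nat_add of_nat_Suc)
    then show ?thesis using False
      by (simp add: const_def lookup_single when_def)
  qed
qed


section \<open>Exponentials of the derivation\<close>

lemma neg_deriv_op_nth:
  "neg_deriv_op F $ n = - (\<Sum>m \<in> {m. m \<le> n \<and> odd m}. dp m (F $ (n - m)))"
  by (simp add: neg_deriv_op_def)

lemma neg_deriv_op_add: "neg_deriv_op (F + G) = neg_deriv_op F + neg_deriv_op G"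
  by (simp add: fps_eq_iff neg_deriv_op_nth dp_add sum.distrib)

lemma neg_deriv_op_0 [simp]: "neg_deriv_op 0 = 0"
  by (simp add: fps_eq_iff neg_deriv_op_nth)

lemma neg_deriv_op_const_mult:
  "neg_deriv_op (fps_const (const c) * F) = fps_const (const c) * neg_deriv_op F"
  by (simp add: fps_eq_iff neg_deriv_op_nth dp_const_mult sum_distrib_left)

lemma neg_deriv_op_sum: "neg_deriv_op (\<Sum>i\<in>A. F i) = (\<Sum>i\<in>A. neg_deriv_op (F i))"
  by (induction A rule: infinite_finite_induct) (auto simp: neg_deriv_op_add)

definition fps_dp :: "nat \<Rightarrow> gamma fps \<Rightarrow> gamma fps"
  where "fps_dp m F = Abs_fps (\<lambda>n. dp m (F $ n))"

lemma fps_dp_mult: "fps_dp m (F * G) = fps_dp m F * G + F * fps_dp m G"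
  by (simp add: fps_dp_def fps_eq_iff fps_mult_nth dp_sum dp_mult sum.distrib)

lemma neg_deriv_op_mult: "neg_deriv_op (F * G) = neg_deriv_op F * G + F * neg_deriv_op G"
proof (rule fps_ext)
  fix n
  \<comment> \<open>Truncating the sum over the derivatives at \<open>n\<close> changes no coefficient up to \<open>n\<close>.\<close>
  define D where "D F = - (\<Sum>m \<in> {m. m \<le> n \<and> odd m}. fps_X ^ m * fps_dp m F)" for F
  have D: "neg_deriv_op F $ i = D F $ i" if "i \<le> n" for i F
  proof -
    have "(\<Sum>m \<in> {m. m \<le> i \<and> odd m}. dp m (F $ (i - m))) =
        (\<Sum>m \<in> {m. m \<le> n \<and> odd m}. (fps_X ^ m * fps_dp m F) $ i)"
      by (rule sum.mono_neutral_cong_left)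
        (use that in \<open>auto simp: fps_X_power_mult_nth fps_dp_def\<close>)
    then show ?thesis
      by (simp add: neg_deriv_op_nth D_def fps_sum_nth)
  qed
  have "D (F * G) = D F * G + F * D G"
    by (simp add: D_def fps_dp_mult sum.distrib sum_distrib_left sum_distrib_right algebra_simps)
  then have "neg_deriv_op (F * G) $ n = (D F * G + F * D G) $ n"
    by (simp add: D)
  also have "\<dots> = (neg_deriv_op F * G + F * neg_deriv_op G) $ n"
    by (simp add: fps_mult_nth D)
  finally show "neg_deriv_op (F * G) $ n = (neg_deriv_op F * G + F * neg_deriv_op G) $ n" .
qed

text \<open>
  The Leibniz rule for divided powers has no binomial coefficients, so that summing it over all
  powers gives at once that the exponential of the derivation is multiplicative.
\<close>

definition deriv_divpow :: "nat \<Rightarrow> gamma fps \<Rightarrow> gamma fps"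
  where "deriv_divpow j F = fps_const (const (1 / fact j)) * (neg_deriv_op ^^ j) F"

lemma neg_deriv_op_power_nth: "n < j \<Longrightarrow> (neg_deriv_op ^^ j) F $ n = 0"
proof (induction j arbitrary: n)
  case (Suc j)
  then have "(neg_deriv_op ^^ j) F $ (n - m) = 0" if "m \<le> n" "odd m" for m
    using that Suc.prems by (intro Suc.IH) (use odd_pos [of m] in linarith)
  then show ?case by (simp add: neg_deriv_op_nth)
qed simp

lemma deriv_divpow_nth: "n < j \<Longrightarrow> deriv_divpow j F $ n = 0"
  by (simp add: deriv_divpow_def neg_deriv_op_power_nth)

lemma neg_deriv_op_power_add:
  "(neg_deriv_op ^^ j) (F + G) = (neg_deriv_op ^^ j) F + (neg_deriv_op ^^ j) G"
  by (induction j) (simp_all add: neg_deriv_op_add)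

lemma of_nat_mult_deriv_divpow:
  "of_nat (Suc j) * deriv_divpow (Suc j) F = neg_deriv_op (deriv_divpow j F)"
proof -
  have "of_nat (Suc j) * deriv_divpow (Suc j) F =
      fps_const (const (of_nat (Suc j)) * const (1 / fact (Suc j))) * neg_deriv_op ((neg_deriv_op ^^ j) F)"
    unfolding deriv_divpow_def const_of_nat
    by (simp add: mult.assoc del: of_nat_Suc fps_const_mult flip: fps_of_nat fps_const_mult)
  also have "const (of_nat (Suc j)) * const (1 / fact (Suc j)) = const (1 / fact j)"
    by (simp flip: const_mult)
  finally show ?thesis
    by (simp add: deriv_divpow_def neg_deriv_op_const_mult)
qed

lemma of_nat_gamma_fps_neq_0: "of_nat (Suc j) \<noteq> (0 :: gamma fps)"
proof
  assume "of_nat (Suc j) = (0 :: gamma fps)"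
  then have "(of_nat (Suc j) :: gamma fps) $ 0 = 0" by simp
  then show False by (simp add: fps_of_nat [symmetric] del: of_nat_Suc)
qed

lemma deriv_divpow_mult:
  "deriv_divpow j (F * G) = (\<Sum>i\<le>j. deriv_divpow i F * deriv_divpow (j - i) G)"
proof (induction j)
  case 0
  then show ?case by (simp add: deriv_divpow_def)
next
  case (Suc j)
  let ?A = "\<lambda>i. deriv_divpow i F" and ?B = "\<lambda>i. deriv_divpow i G"
  have "of_nat (Suc j) * deriv_divpow (Suc j) (F * G) =
      (\<Sum>i\<le>j. neg_deriv_op (?A i) * ?B (j - i)) + (\<Sum>i\<le>j. ?A i * neg_deriv_op (?B (j - i)))"
    by (simp only: of_nat_mult_deriv_divpow Suc neg_deriv_op_sum neg_deriv_op_mult sum.distrib)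
  also have "(\<Sum>i\<le>j. neg_deriv_op (?A i) * ?B (j - i)) =
      (\<Sum>i\<le>j. of_nat (Suc i) * (?A (Suc i) * ?B (Suc j - Suc i)))"
    by (simp only: of_nat_mult_deriv_divpow [symmetric] diff_Suc_Suc mult.assoc)
  also have "\<dots> = (\<Sum>i\<le>Suc j. of_nat i * (?A i * ?B (Suc j - i)))"
    by (subst sum.atMost_Suc_shift) simp
  also have "(\<Sum>i\<le>j. ?A i * neg_deriv_op (?B (j - i))) =
      (\<Sum>i\<le>j. of_nat (Suc j - i) * (?A i * ?B (Suc j - i)))"
    by (intro sum.cong refl)
      (simp only: of_nat_mult_deriv_divpow [symmetric] Suc_diff_le atMost_iff mult.left_commute)
  also have "\<dots> = (\<Sum>i\<le>Suc j. of_nat (Suc j - i) * (?A i * ?B (Suc j - i)))"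
    by simp
  also have "(\<Sum>i\<le>Suc j. of_nat i * (?A i * ?B (Suc j - i))) + \<dots> =
      (\<Sum>i\<le>Suc j. of_nat (Suc j) * (?A i * ?B (Suc j - i)))"
    unfolding sum.distrib [symmetric] distrib_right [symmetric] of_nat_add [symmetric]
    by (intro sum.cong) auto
  finally have "of_nat (Suc j) * deriv_divpow (Suc j) (F * G) =
      of_nat (Suc j) * (\<Sum>i\<le>Suc j. ?A i * ?B (Suc j - i))"
    by (simp only: sum_distrib_left)
  then show ?case
    using of_nat_gamma_fps_neq_0 [of j] by (simp only: mult_cancel_left) simp
qed

definition exp_deriv_fps :: "gamma \<Rightarrow> gamma fps"
  where "exp_deriv_fps f = Abs_fps (\<lambda>n. exp_neg_deriv n f)"

lemma exp_deriv_fps_nth: "exp_deriv_fps f $ n = exp_neg_deriv n f"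
  by (simp add: exp_deriv_fps_def)

lemma exp_neg_deriv_divpow:
  assumes "n \<le> N"
  shows "exp_neg_deriv n f = (\<Sum>j\<le>N. deriv_divpow j (fps_const f)) $ n"
proof -
  have "exp_neg_deriv n f = (\<Sum>j\<le>n. deriv_divpow j (fps_const f) $ n)"
    by (simp add: exp_neg_deriv_def deriv_divpow_def)
  also have "\<dots> = (\<Sum>j\<le>N. deriv_divpow j (fps_const f) $ n)"
    by (rule sum.mono_neutral_left) (use assms in \<open>auto simp: deriv_divpow_nth\<close>)
  finally show ?thesis by (simp add: fps_sum_nth)
qed

lemma fps_mult_nth_eq_0:
  fixes F G :: "'a::comm_semiring_1 fps"
  assumes "\<And>k. k < i \<Longrightarrow> F $ k = 0" "\<And>k. k < j \<Longrightarrow> G $ k = 0" "n < i + j"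
  shows "(F * G) $ n = 0"
  unfolding fps_mult_nth
proof (rule sum.neutral, safe)
  fix k assume "k \<in> {0..n}"
  then have "k < i \<or> n - k < j" using assms(3) by auto
  then show "F $ k * G $ (n - k) = 0" using assms(1,2) by auto
qed

text \<open>
  The exponential of a derivation is a ring homomorphism; on generators it is the substitution of
  \<open>p m - w ^ m\<close> for \<open>p m\<close> (\<open>exp_neg_deriv_p\<close>).
\<close>

lemma exp_deriv_fps_mult: "exp_deriv_fps (f * g) = exp_deriv_fps f * exp_deriv_fps g"
proof (rule fps_ext)
  fix n
  let ?A = "\<lambda>i. deriv_divpow i (fps_const f)" and ?B = "\<lambda>i. deriv_divpow i (fps_const g)"
  have "exp_deriv_fps (f * g) $ n = (\<Sum>j\<le>n. \<Sum>i\<le>j. (?A i * ?B (j - i)) $ n)"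
    by (simp only: exp_deriv_fps_nth exp_neg_deriv_divpow [OF order_refl] fps_const_mult [symmetric]
        deriv_divpow_mult fps_sum_nth)
  also have "\<dots> = (\<Sum>(i, l) \<in> {(i, l). i + l \<le> n}. (?A i * ?B l) $ n)"
    by (simp add: sum.triangle_reindex_eq)
  also have "\<dots> = (\<Sum>(i, l) \<in> {..n} \<times> {..n}. (?A i * ?B l) $ n)"
  proof (rule sum.mono_neutral_left)
    show "\<forall>x\<in>{..n} \<times> {..n} - {(i, l). i + l \<le> n}. (case x of (i, l) \<Rightarrow> (?A i * ?B l) $ n) = 0"
      by (auto intro!: fps_mult_nth_eq_0 deriv_divpow_nth)
  qed auto
  also have "\<dots> = ((\<Sum>i\<le>n. ?A i) * (\<Sum>l\<le>n. ?B l)) $ n"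
    by (simp add: sum_product fps_sum_nth sum.cartesian_product split_def)
  also have "\<dots> = (exp_deriv_fps f * exp_deriv_fps g) $ n"
    unfolding fps_mult_nth exp_deriv_fps_nth
    by (intro sum.cong refl arg_cong2 [where f = "(*)"]) (auto simp: exp_neg_deriv_divpow [of _ n])
  finally show "exp_deriv_fps (f * g) $ n = (exp_deriv_fps f * exp_deriv_fps g) $ n" .
qed

lemma exp_neg_deriv_mult:
  "exp_neg_deriv n (f * g) = (\<Sum>i\<le>n. exp_neg_deriv i f * exp_neg_deriv (n - i) g)"
  using arg_cong [OF exp_deriv_fps_mult [of f g], of "\<lambda>F. F $ n"]
  by (simp add: exp_deriv_fps_nth fps_mult_nth atLeast0AtMost)

lemma exp_neg_deriv_add: "exp_neg_deriv n (f + g) = exp_neg_deriv n f + exp_neg_deriv n g"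
  by (simp add: exp_neg_deriv_def neg_deriv_op_power_add sum.distrib distrib_left
      flip: fps_const_add)

lemma neg_deriv_op_power_0 [simp]: "(neg_deriv_op ^^ j) 0 = 0"
  by (induction j) auto

lemma exp_neg_deriv_const: "exp_neg_deriv n (const c) = (if n = 0 then const c else 0)"
proof -
  have "neg_deriv_op (fps_const (const c)) = 0"
    by (auto simp: fps_eq_iff neg_deriv_op_nth fps_const_def intro!: sum.neutral)
  then have "(neg_deriv_op ^^ j) (fps_const (const c)) = (if j = 0 then fps_const (const c) else 0)" for j
    by (cases j) (simp_all add: funpow_Suc_right del: funpow.simps)
  then show ?thesis
    by (simp add: exp_neg_deriv_def if_distribR if_distrib [of "\<lambda>F. F $ _"] cong: if_cong)
qed

lemma exp_neg_deriv_p: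
  assumes "odd m"
  shows "exp_neg_deriv n (p m) = (if n = 0 then p m else if n = m then - 1 else 0)"
proof -
  have D: "neg_deriv_op (fps_const (p m)) = - (fps_X ^ m)"
  proof (rule fps_ext)
    fix n
    have "(\<Sum>i \<in> {i. i \<le> n \<and> odd i}. dp i (fps_const (p m) $ (n - i))) =
        (\<Sum>i \<in> {i. i \<le> n \<and> odd i}. if i = n then (if n = m then 1 else 0) else 0)"
      by (intro sum.cong) (auto simp: dp_p assms)
    also have "\<dots> = (if n = m then 1 else 0)"
      using assms by (simp add: sum.delta')
    finally show "neg_deriv_op (fps_const (p m)) $ n = (- (fps_X ^ m)) $ n"
      by (simp add: neg_deriv_op_nth fps_X_power_nth)
  qed
  have "neg_deriv_op (- (fps_X ^ m)) = 0"
    by (auto simp: fps_eq_iff neg_deriv_op_nth fps_X_power_nth dp_uminus intro!: sum.neutral)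
  then have "(neg_deriv_op ^^ j) (fps_const (p m)) =
      (if j = 0 then fps_const (p m) else if j = 1 then - (fps_X ^ m) else 0)" for j
  proof (cases j)
    case (Suc i)
    with \<open>neg_deriv_op (- (fps_X ^ m)) = 0\<close> show ?thesis
      by (cases i) (simp_all add: funpow_Suc_right D del: funpow.simps)
  qed simp
  then have "exp_neg_deriv n (p m) = (\<Sum>j\<le>n. if j = 0 then fps_const (p m) $ n else
      if j = 1 then - (fps_X ^ m $ n) else 0)"
    unfolding exp_neg_deriv_def by (intro sum.cong) auto
  also have "\<dots> = (if n = 0 then p m else if n = m then - 1 else 0)"
  proof (cases "n = 0")
    case False
    have "(\<Sum>j\<le>n. if j = 0 then fps_const (p m) $ n else if j = 1 then - (fps_X ^ m $ n) else 0)
        = (\<Sum>j\<in>{0,1::nat}. if j = 0 then fps_const (p m) $ n else if j = 1 then - (fps_X ^ m $ n) else 0)"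
      by (rule sum.mono_neutral_right) (use False in auto)
    then show ?thesis using False by (simp add: fps_X_power_nth)
  qed simp
  finally show ?thesis .
qed


section \<open>Plethysm and the series of the elements q\<close>

definition plethysm_monomial :: "nat \<Rightarrow> (nat \<Rightarrow>\<^sub>0 nat) \<Rightarrow> gamma"
  where "plethysm_monomial s e =
    (\<Prod>i \<in> Poly_Mapping.keys e. p (s * (2 * i + 1)) ^ Poly_Mapping.lookup e i)"

lemma plethysm_monomial_superset:
  assumes "finite A" and "Poly_Mapping.keys e \<subseteq> A"
  shows "plethysm_monomial s e = (\<Prod>i \<in> A. p (s * (2 * i + 1)) ^ Poly_Mapping.lookup e i)"
  unfolding plethysm_monomial_def
  by (rule prod.mono_neutral_left) (use assms in \<open>auto simp: in_keys_iff\<close>)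

lemma plethysm_monomial_add:
  "plethysm_monomial s (e + e') = plethysm_monomial s e * plethysm_monomial s e'"
proof -
  let ?A = "Poly_Mapping.keys e \<union> Poly_Mapping.keys e'"
  have "Poly_Mapping.keys (e + e') \<subseteq> ?A"
    by (rule keys_add)
  then show ?thesis
    by (simp add: plethysm_monomial_superset [of ?A] lookup_add power_add prod.distrib)
qed

lemma plethysm_p_superset:
  assumes "finite A" and "Poly_Mapping.keys f \<subseteq> A"
  shows "plethysm_p s f = (\<Sum>e \<in> A. const (Poly_Mapping.lookup f e) * plethysm_monomial s e)"
  unfolding plethysm_p_def plethysm_monomial_def [symmetric]
  by (rule sum.mono_neutral_left) (use assms in \<open>auto simp: in_keys_iff\<close>)

lemma plethysm_p_add: "plethysm_p s (f + g) = plethysm_p s f + plethysm_p s g"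
proof -
  let ?A = "Poly_Mapping.keys f \<union> Poly_Mapping.keys g"
  have "Poly_Mapping.keys (f + g) \<subseteq> ?A"
    by (rule keys_add)
  then show ?thesis
    by (simp add: plethysm_p_superset [of ?A] lookup_add const_add distrib_right sum.distrib)
qed

lemma plethysm_p_0 [simp]: "plethysm_p s 0 = 0"
  by (simp add: plethysm_p_def)

lemma plethysm_p_single: "plethysm_p s (Poly_Mapping.single e c) = const c * plethysm_monomial s e"
  by (subst plethysm_p_superset [of "{e}"]) auto

lemma plethysm_p_mult: "plethysm_p s (f * g) = plethysm_p s f * plethysm_p s g"
proof (induction f rule: poly_mapping_add_induct)
  case zero
  then show ?case by simp
next
  case (single a c)
  show ?case
  proof (induction g rule: poly_mapping_add_induct)
    case zero
    then show ?case by simp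
  next
    case (single b d)
    then show ?case
      by (simp add: mult_single plethysm_p_single plethysm_monomial_add const_mult mult_ac)
  next
    case (add g h)
    then show ?case by (simp add: distrib_left plethysm_p_add)
  qed
next
  case (add f h)
  then show ?case by (simp add: distrib_right plethysm_p_add)
qed

lemma plethysm_p_sum: "plethysm_p s (\<Sum>i\<in>A. f i) = (\<Sum>i\<in>A. plethysm_p s (f i))"
  by (induction A rule: infinite_finite_induct) (auto simp: plethysm_p_add)

lemma plethysm_p_const [simp]: "plethysm_p s (const c) = const c"
  by (simp add: const_def plethysm_p_single plethysm_monomial_def mult_single)

lemma plethysm_p_p: "odd m \<Longrightarrow> plethysm_p s (p m) = p (s * m)"
  by (simp add: p_def [of m] plethysm_p_single plethysm_monomial_def del: single_one)

lemma plethysm_p_1 [simp]: "plethysm_p (Suc 0) f = f"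
  by (induction f rule: gamma_induct)
    (simp_all add: plethysm_p_p plethysm_p_add plethysm_p_mult)

lemma exp_fps_deriv:
  assumes "F $ 0 = 0"
  shows "fps_deriv (exp_fps F) = exp_fps F * fps_deriv F"
proof -
  have "fps_deriv (Abs_fps (\<lambda>n. const (1 / fact n))) = Abs_fps (\<lambda>n. const (1 / fact n))"
  proof (rule fps_ext)
    fix n
    have "of_nat (Suc n) * const (1 / fact (Suc n)) = const (of_nat (Suc n) * (1 / fact (Suc n)))"
      by (simp only: const_mult const_of_nat)
    also have "of_nat (Suc n) * (1 / fact (Suc n)) = (1 / fact n :: rat)"
      by simp
    finally show "fps_deriv (Abs_fps (\<lambda>n. const (1 / fact n))) $ n =
        Abs_fps (\<lambda>n. const (1 / fact n)) $ n"
      by simp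
  qed
  then show ?thesis
    by (simp add: exp_fps_def fps_compose_deriv [OF assms])
qed

lemma q_0 [simp]: "q 0 = 1"
  by (simp add: q_def exp_fps_def)

lemma q_rec:
  "of_nat (Suc n) * q (Suc n) = (\<Sum>i\<le>n. q i * (if even (n - i) then 2 * p (Suc (n - i)) else 0))"
proof -
  define F where "F = Abs_fps (\<lambda>j. if odd j then const (2 / of_nat j) * p j else 0)"
  have F': "fps_deriv F $ j = (if even j then 2 * p (Suc j) else 0)" for j
  proof (cases "even j")
    case True
    have "of_nat (Suc j) * (const (2 / of_nat (Suc j)) * p (Suc j)) =
        const (of_nat (Suc j) * (2 / of_nat (Suc j))) * p (Suc j)"
      by (simp only: const_mult const_of_nat mult.assoc)
    also have "of_nat (Suc j) * (2 / of_nat (Suc j)) = (2 :: rat)"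
      by (simp del: of_nat_Suc)
    finally show ?thesis using True by (simp add: F_def)
  qed (simp add: F_def)
  have "F $ 0 = 0"
    by (simp add: F_def)
  from exp_fps_deriv [OF this]
  have "fps_deriv (exp_fps F) $ n = (exp_fps F * fps_deriv F) $ n"
    by (rule arg_cong)
  then show ?thesis
    unfolding fps_mult_nth F' by (simp add: q_def F_def [symmetric] atLeast0AtMost)
qed

definition plethysm_q :: "nat \<Rightarrow> nat \<Rightarrow> gamma"
  where "plethysm_q s k = plethysm_p s (q k)"

lemma plethysm_q_0 [simp]: "plethysm_q s 0 = 1"
  using plethysm_p_const [of s 1] by (simp add: plethysm_q_def)

lemma plethysm_q_1 [simp]: "plethysm_q (Suc 0) k = q k"
  by (simp add: plethysm_q_def)

lemma plethysm_q_rec: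
  "of_nat (Suc n) * plethysm_q s (Suc n) =
    (\<Sum>i\<le>n. plethysm_q s i * (if even (n - i) then 2 * p (s * Suc (n - i)) else 0))"
proof -
  have "plethysm_p s (const (of_nat (Suc n)) * q (Suc n)) =
      plethysm_p s (\<Sum>i\<le>n. q i * (if even (n - i) then const 2 * p (Suc (n - i)) else 0))"
    by (simp only: const_of_nat q_rec const_numeral)
  then have "const (of_nat (Suc n)) * plethysm_p s (q (Suc n)) =
      (\<Sum>i\<le>n. plethysm_p s (q i) * (if even (n - i) then const 2 * p (s * Suc (n - i)) else 0))"
    unfolding plethysm_p_sum plethysm_p_mult plethysm_p_const
    by (simp add: if_distrib [of "plethysm_p s"] plethysm_p_mult plethysm_p_p
        del: of_nat_Suc const_numeral mult_Suc_right cong: if_cong)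
  then show ?thesis
    by (simp only: plethysm_q_def const_of_nat const_numeral)
qed

text \<open>
  The coefficientwise form of the uniqueness of solutions of the differential equation
  \<open>F' = F * H\<close>, used to compare exponentials without computing them.
\<close>

lemma linear_recurrence_unique:
  fixes a b h :: "nat \<Rightarrow> 'a::idom"
  assumes "\<And>n. of_nat (Suc n) \<noteq> (0::'a)" and "a 0 = b 0"
    and "\<And>n. of_nat (Suc n) * a (Suc n) = (\<Sum>i\<le>n. a i * h (n - i))"
    and "\<And>n. of_nat (Suc n) * b (Suc n) = (\<Sum>i\<le>n. b i * h (n - i))"
  shows "a n = b n"
proof (induction n rule: less_induct)
  case (less n)
  show ?case
  proof (cases n)
    case (Suc m)
    have "of_nat (Suc m) * a (Suc m) = of_nat (Suc m) * b (Suc m)"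
      unfolding assms(3,4) using less Suc by (intro sum.cong) auto
    then show ?thesis using assms(1) Suc by (metis mult_cancel_left)
  qed (simp add: assms(2))
qed

text \<open>
  The coefficients of \<open>(1 - t) / (1 + t)\<close> and of its inverse \<open>(1 + t) / (1 - t)\<close>.
\<close>

definition dcoeff :: "nat \<Rightarrow> rat"
  where "dcoeff n = (if n = 0 then 1 else 2 * (- 1) ^ n)"

definition ccoeff :: "nat \<Rightarrow> rat"
  where "ccoeff n = (if n = 0 then 1 else 2)"

lemma dcoeff_0 [simp]: "dcoeff 0 = 1"
  by (simp add: dcoeff_def)

lemma ccoeff_0 [simp]: "ccoeff 0 = 1"
  by (simp add: ccoeff_def)

lemma sum_dcoeff_parity:
  "(\<Sum>i\<le>n. if even (n - i) then dcoeff i else 0) = (- 1) ^ n * of_nat (Suc n)"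
proof (induction n rule: less_induct)
  case (less n)
  consider "n = 0" | "n = 1" | m where "n = Suc (Suc m)"
    by (metis One_nat_def not0_implies_Suc)
  then show ?case
  proof cases
    case 3
    have "(\<Sum>i\<le>n. if even (n - i) then dcoeff i else 0) =
        (\<Sum>i\<le>m. if even (m - i) then dcoeff i else 0) + dcoeff n"
      unfolding 3 by (simp add: Suc_diff_le)
    then show ?thesis
      using less [of m] by (simp add: 3 dcoeff_def algebra_simps)
  qed (simp_all add: dcoeff_def)
qed

lemma dcoeff_rec:
  "of_nat (Suc n) * dcoeff (Suc n) = (\<Sum>i\<le>n. dcoeff i * (if even (n - i) then - 2 else 0))"
proof -
  have "(\<Sum>i\<le>n. dcoeff i * (if even (n - i) then - 2 else 0)) =
      - 2 * (\<Sum>i\<le>n. if even (n - i) then dcoeff i else 0)"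
    unfolding sum_distrib_left by (intro sum.cong) auto
  then show ?thesis
    by (simp only: sum_dcoeff_parity) (simp add: dcoeff_def)
qed

lemma sum_ccoeff_sign: "(\<Sum>j\<le>n. ccoeff j * (- 1) ^ j) = (- 1) ^ n"
  by (induction n) (auto simp: ccoeff_def)

lemma ccoeff_dcoeff_convolution:
  "(\<Sum>j\<le>n. ccoeff j * dcoeff (n - j)) = (if n = 0 then 1 else 0)"
proof (cases n)
  case (Suc m)
  have "(\<Sum>j\<le>m. ccoeff j * dcoeff (n - j)) = (\<Sum>j\<le>m. 2 * (- 1) ^ n * (ccoeff j * (- 1) ^ j))"
    by (intro sum.cong) (auto simp: dcoeff_def Suc Suc_diff_le minus_one_power_iff)
  also have "\<dots> = 2 * (- 1) ^ n * (- 1) ^ m"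
    by (simp only: sum_ccoeff_sign flip: sum_distrib_left)
  finally show ?thesis
    by (simp add: Suc ccoeff_def power_mult_distrib [symmetric])
qed simp

lemma exp_deriv_fps_add: "exp_deriv_fps (f + g) = exp_deriv_fps f + exp_deriv_fps g"
  by (simp add: fps_eq_iff exp_deriv_fps_nth exp_neg_deriv_add)

lemma exp_neg_deriv_0_right [simp]: "exp_neg_deriv n 0 = 0"
  using exp_neg_deriv_const [of n 0] by simp

lemma exp_deriv_fps_sum: "exp_deriv_fps (\<Sum>i\<in>A. f i) = (\<Sum>i\<in>A. exp_deriv_fps (f i))"
  by (induction A rule: infinite_finite_induct)
    (auto simp: exp_deriv_fps_add fps_eq_iff exp_deriv_fps_nth)

lemma exp_deriv_fps_const: "exp_deriv_fps (const c) = fps_const (const c)"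
  by (simp add: fps_eq_iff exp_deriv_fps_nth exp_neg_deriv_const)

lemma exp_deriv_fps_p: "odd m \<Longrightarrow> exp_deriv_fps (p m) = fps_const (p m) - fps_X ^ m"
  by (auto simp: fps_eq_iff exp_deriv_fps_nth exp_neg_deriv_p fps_X_power_nth)

lemma fps_const_sum:
  "fps_const (\<Sum>i\<in>A. f i) = (\<Sum>i\<in>A. fps_const (f i :: 'a::comm_ring_1))"
  by (induction A rule: infinite_finite_induct) (auto simp flip: fps_const_add)

text \<open>
  Replacing \<open>p m\<close> by \<open>p m - w ^ m\<close> multiplies \<open>exp (\<Sum>m odd. 2 / m * p (s * m) * z ^ m)\<close> by
  \<open>exp (- \<Sum>m odd. 2 / m * (z * w ^ s) ^ m) = (1 - z * w ^ s) / (1 + z * w ^ s)\<close>. Both sides have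
  the same logarithmic derivative in \<open>z\<close>.
\<close>

lemma exp_neg_deriv_plethysm_q:
  assumes "odd s"
  shows "exp_neg_deriv b (plethysm_q s i) =
    (\<Sum>n\<le>i. if b = s * n then const (dcoeff n) * plethysm_q s (i - n) else 0)"
proof -
  let ?pw = "\<lambda>n. fps_X ^ (s * n) :: gamma fps"
  \<comment> \<open>Series in \<open>z\<close> over series in \<open>w\<close>: the two factors \<open>G\<close>, \<open>D\<close> and their logarithmic derivatives
    \<open>A\<close>, \<open>B\<close>.\<close>
  define G where "G = Abs_fps (\<lambda>i. fps_const (plethysm_q s i))"
  define D where "D = Abs_fps (\<lambda>n. fps_const (const (dcoeff n)) * ?pw n)"
  define A where "A = Abs_fps (\<lambda>n. fps_const (if even n then 2 * p (s * Suc n) else 0))"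
  define B where "B = Abs_fps (\<lambda>n. if even n then - 2 * ?pw (Suc n) else 0)"
  have G': "fps_deriv G = G * A"
  proof (rule fps_ext)
    fix n
    have "fps_deriv G $ n = fps_const (of_nat (Suc n) * plethysm_q s (Suc n))"
      by (simp add: G_def del: of_nat_Suc fps_const_mult flip: fps_of_nat fps_const_mult)
    also have "\<dots> = (G * A) $ n"
      unfolding plethysm_q_rec
      by (simp add: fps_mult_nth G_def A_def fps_const_sum atLeast0AtMost)
    finally show "fps_deriv G $ n = (G * A) $ n" .
  qed
  have D': "fps_deriv D = D * B"
  proof (rule fps_ext)
    fix n
    have "fps_deriv D $ n = fps_const (const (of_nat (Suc n) * dcoeff (Suc n))) * ?pw (Suc n)"
      by (simp add: D_def const_mult const_of_nat mult.assoc
          del: of_nat_Suc mult_Suc_right fps_const_mult flip: fps_of_nat fps_const_mult)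
    also have "\<dots> = (\<Sum>i\<le>n. fps_const (const (dcoeff i * (if even (n - i) then - 2 else 0))) * ?pw (Suc n))"
      unfolding dcoeff_rec const_sum by (simp add: fps_const_sum sum_distrib_right)
    also have "\<dots> = (\<Sum>i\<le>n. (fps_const (const (dcoeff i)) * ?pw i) *
        (if even (n - i) then - 2 * ?pw (Suc (n - i)) else 0))"
    proof (intro sum.cong refl)
      fix i assume "i \<in> {..n}"
      then have "?pw (Suc n) = ?pw i * ?pw (Suc (n - i))"
        by (simp add: power_add [symmetric] distrib_left [symmetric] del: mult_Suc_right)
      moreover have "fps_const (const (- 2)) = (- 2 :: gamma fps)"
        by (simp add: const_uminus flip: fps_const_neg numeral_fps_const)
      ultimately show "fps_const (const (dcoeff i * (if even (n - i) then - 2 else 0))) * ?pw (Suc n) =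
          (fps_const (const (dcoeff i)) * ?pw i) * (if even (n - i) then - 2 * ?pw (Suc (n - i)) else 0)"
        by (simp add: const_mult del: mult_Suc_right fps_const_mult flip: fps_const_mult)
    qed
    also have "\<dots> = (D * B) $ n"
      by (simp add: fps_mult_nth D_def B_def atLeast0AtMost)
    finally show "fps_deriv D $ n = (D * B) $ n" .
  qed
  have GD': "fps_deriv (G * D) = (G * D) * (A + B)"
    by (simp add: G' D' algebra_simps)
  have "exp_deriv_fps (plethysm_q s i) = (G * D) $ i"
  proof (rule linear_recurrence_unique [where h = "\<lambda>n. (A + B) $ n"])
    show "exp_deriv_fps (plethysm_q s 0) = (G * D) $ 0"
      using exp_deriv_fps_const [of 1] by (simp add: G_def D_def)
  next
    fix n
    have "of_nat (Suc n) * (G * D) $ Suc n = fps_deriv (G * D) $ n"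
      by (simp only: fps_deriv_nth Suc_eq_plus1)
    then show "of_nat (Suc n) * (G * D) $ Suc n = (\<Sum>i\<le>n. (G * D) $ i * (A + B) $ (n - i))"
      unfolding GD' by (simp add: fps_mult_nth [of "G * D"] atLeast0AtMost)
    have E: "exp_deriv_fps (if even j then 2 * p (s * Suc j) else 0) = (A + B) $ j" for j
    proof (cases "even j")
      case True
      then have "odd (s * Suc j)" using assms by simp
      then have "exp_deriv_fps (const 2 * p (s * Suc j)) =
          2 * (fps_const (p (s * Suc j)) - ?pw (Suc j))"
        unfolding exp_deriv_fps_mult exp_deriv_fps_const
        by (simp add: exp_deriv_fps_p del: mult_Suc_right flip: numeral_fps_const)
      then show ?thesis
        using True by (simp add: A_def B_def right_diff_distrib del: mult_Suc_right
            flip: numeral_fps_const fps_const_mult)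
    next
      case False
      then show ?thesis
        using exp_deriv_fps_const [of 0] by (simp add: A_def B_def)
    qed
    have "of_nat (Suc n) * exp_deriv_fps (plethysm_q s (Suc n)) =
        exp_deriv_fps (const (of_nat (Suc n)) * plethysm_q s (Suc n))"
      unfolding exp_deriv_fps_mult exp_deriv_fps_const by (simp only: const_of_nat fps_of_nat)
    also have "\<dots> = (\<Sum>i\<le>n. exp_deriv_fps (plethysm_q s i) * (A + B) $ (n - i))"
      by (simp only: const_of_nat plethysm_q_rec exp_deriv_fps_sum exp_deriv_fps_mult E)
    finally show "of_nat (Suc n) * exp_deriv_fps (plethysm_q s (Suc n)) =
        (\<Sum>i\<le>n. exp_deriv_fps (plethysm_q s i) * (A + B) $ (n - i))" .
  qed (rule of_nat_gamma_fps_neq_0)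
  then have "exp_neg_deriv b (plethysm_q s i) =
      (\<Sum>k\<le>i. (G $ k * D $ (i - k)) $ b)"
    by (simp add: exp_deriv_fps_nth [symmetric] fps_mult_nth [of G D] fps_sum_nth atLeast0AtMost)
  also have "\<dots> = (\<Sum>k\<le>i. if b = s * (i - k) then const (dcoeff (i - k)) * plethysm_q s k else 0)"
    by (intro sum.cong)
      (auto simp: G_def D_def mult.assoc fps_X_power_nth mult.commute)
  also have "\<dots> = (\<Sum>n\<le>i. if b = s * n then const (dcoeff n) * plethysm_q s (i - n) else 0)"
    by (rule sum.reindex_bij_witness [of _ "\<lambda>n. i - n" "\<lambda>n. i - n"]) auto
  finally show ?thesis .
qed

text \<open>
  The exponent of the series of the elements \<open>q\<close> is odd in \<open>z\<close>, so that the values of the series at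
  \<open>z\<close> and \<open>- z\<close> are inverse to each other. The derivative of the product vanishes.
\<close>

lemma q_mult_neg:
  "(\<Sum>i\<le>n. const ((- 1) ^ i) * (q i * q (n - i))) = (if n = 0 then 1 else 0)"
proof -
  define F where "F = Abs_fps q"
  define F' where "F' = Abs_fps (\<lambda>n. const ((- 1) ^ n) * q n)"
  define A where "A = Abs_fps (\<lambda>n. if even n then 2 * p (Suc n) else 0)"
  have "fps_deriv F = F * A"
  proof (rule fps_ext)
    fix n
    show "fps_deriv F $ n = (F * A) $ n"
      using q_rec [of n] by (simp add: fps_mult_nth F_def A_def atLeast0AtMost)
  qed
  moreover have "fps_deriv F' = - F' * A"
  proof (rule fps_ext)
    fix n
    have "fps_deriv F' $ n = const ((- 1) ^ Suc n) * (of_nat (Suc n) * q (Suc n))"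
      by (simp add: F'_def)
    also have "\<dots> = (\<Sum>i\<le>n. const ((- 1) ^ Suc n) * q i * (if even (n - i) then 2 * p (Suc (n - i)) else 0))"
      by (simp only: q_rec sum_distrib_left mult.assoc)
    also have "\<dots> = (- F' * A) $ n"
      unfolding fps_mult_nth atLeast0AtMost
    proof (intro sum.cong refl)
      fix i assume "i \<in> {..n}"
      then have "even (n - i) \<Longrightarrow> (- 1) ^ n = ((- 1) ^ i :: rat)"
        by (auto simp: minus_one_power_iff)
      then show "const ((- 1) ^ Suc n) * q i * (if even (n - i) then 2 * p (Suc (n - i)) else 0) =
          (- F') $ i * A $ (n - i)"
        by (simp add: F'_def A_def const_uminus)
    qed
    finally show "fps_deriv F' $ n = (- F' * A) $ n" .
  qed
  ultimately have "fps_deriv (F' * F) = 0"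
    by (simp add: algebra_simps)
  then have "F' * F = fps_const ((F' * F) $ 0)"
    by (rule iffD1 [OF fps_deriv_eq_0_iff])
  also have "(F' * F) $ 0 = 1"
    by (simp add: F'_def F_def)
  finally have "(F' * F) $ n = (if n = 0 then 1 else 0)"
    by simp
  then show ?thesis
    by (simp add: fps_mult_nth F'_def F_def atLeast0AtMost mult.assoc)
qed


section \<open>The operators Q\<close>

lemma exp_neg_deriv_commute:
  "exp_neg_deriv a (exp_neg_deriv b f) = exp_neg_deriv b (exp_neg_deriv a f)"
proof (induction f arbitrary: a b rule: gamma_induct)
  case (const c)
  show ?case by (simp add: exp_neg_deriv_const)
next
  case (p m)
  have "exp_neg_deriv i (- 1) = (if i = 0 then - 1 else 0)" for i
    using exp_neg_deriv_const [of i "- 1"] by (simp add: const_uminus)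
  then show ?case using p
    by (auto simp: exp_neg_deriv_p)
next
  case (add f g)
  then show ?case by (simp add: exp_neg_deriv_add)
next
  case (mult f g)
  have sum: "exp_neg_deriv n (sum F A) = (\<Sum>i\<in>A. exp_neg_deriv n (F i))" for n and F :: "nat \<Rightarrow> gamma" and A
    by (induction A rule: infinite_finite_induct) (auto simp: exp_neg_deriv_add)
  have "exp_neg_deriv a (exp_neg_deriv b (f * g)) =
      (\<Sum>i\<le>b. \<Sum>j\<le>a. exp_neg_deriv j (exp_neg_deriv i f) *
        exp_neg_deriv (a - j) (exp_neg_deriv (b - i) g))"
    by (simp add: exp_neg_deriv_mult sum)
  also have "\<dots> = (\<Sum>j\<le>a. \<Sum>i\<le>b. exp_neg_deriv i (exp_neg_deriv j f) *
        exp_neg_deriv (b - i) (exp_neg_deriv (a - j) g))"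
    by (subst sum.swap) (simp only: mult)
  also have "\<dots> = exp_neg_deriv b (exp_neg_deriv a (f * g))"
    by (simp add: exp_neg_deriv_mult sum)
  finally show ?case .
qed

lemma exp_neg_deriv_sum:
  "exp_neg_deriv n (\<Sum>i\<in>A. f i) = (\<Sum>i\<in>A. exp_neg_deriv n (f i))"
  by (induction A rule: infinite_finite_induct) (auto simp: exp_neg_deriv_add)

lemma exp_neg_deriv_const_mult: "exp_neg_deriv n (const c * f) = const c * exp_neg_deriv n f"
proof -
  have "(\<Sum>i\<le>n. exp_neg_deriv i (const c) * exp_neg_deriv (n - i) f) =
      (\<Sum>i\<le>n. if i = 0 then const c * exp_neg_deriv n f else 0)"
    by (intro sum.cong) (auto simp: exp_neg_deriv_const)
  then show ?thesis by (simp add: exp_neg_deriv_mult)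
qed

text \<open>
  Since only odd powers of \<open>w\<close> occur in the exponent, the substitution of \<open>- w\<close> for \<open>w\<close> inverts the
  exponential. For products, the degree is distributed over the two factors.
\<close>

lemma exp_neg_deriv_inverse:
  "(\<Sum>a\<le>n. const ((- 1) ^ a) * exp_neg_deriv a (exp_neg_deriv (n - a) f)) = (if n = 0 then f else 0)"
  (is "?K n f = _")
proof (induction f arbitrary: n rule: gamma_induct)
  case (const c)
  have "?K n (const c) = (\<Sum>a\<le>n. if a = 0 then (if n = 0 then const c else 0) else 0)"
    by (intro sum.cong) (auto simp: exp_neg_deriv_const)
  then show ?case by simp
next
  case (p m)
  have neg1: "exp_neg_deriv i (- 1) = (if i = 0 then - 1 else 0)" for i
    using exp_neg_deriv_const [of i "- 1"] by (simp add: const_uminus)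
  have "m \<noteq> 0" using p by (rule contrapos_pn) auto
  show ?case
  proof (cases "n = 0")
    case False
    have "?K n (p m) = (\<Sum>a\<le>n. (if a = 0 then if n = m then - 1 else 0 else 0) +
        (if a = n then if n = m then 1 else 0 else 0))"
      using False p \<open>m \<noteq> 0\<close>
      by (intro sum.cong) (auto simp: exp_neg_deriv_p neg1 const_uminus)
    then show ?thesis using False
      by (simp add: sum.distrib)
  qed (simp add: exp_neg_deriv_p p)
next
  case (add f g)
  have "?K n (f + g) = ?K n f + ?K n g"
    by (simp add: exp_neg_deriv_add distrib_left sum.distrib)
  then show ?case using add by simp
next
  case (mult f g)
  let ?T = "\<lambda>j i j' i'. const ((- 1) ^ j) * exp_neg_deriv j (exp_neg_deriv i f) *
    (const ((- 1) ^ j') * exp_neg_deriv j' (exp_neg_deriv i' g))"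
  have "?K n (f * g) = (\<Sum>a\<le>n. \<Sum>j\<le>a. \<Sum>i\<le>n - a. ?T j i (a - j) (n - a - i))"
  proof (intro sum.cong refl)
    fix a
    have sgn: "const ((- 1) ^ a) = const ((- 1) ^ j) * const ((- 1) ^ (a - j))" if "j \<le> a" for j
      using that by (simp flip: const_mult power_add)
    have "const ((- 1) ^ a) * exp_neg_deriv a (exp_neg_deriv (n - a) (f * g)) =
        (\<Sum>i\<le>n - a. \<Sum>j\<le>a. const ((- 1) ^ a) * (exp_neg_deriv j (exp_neg_deriv i f) *
        exp_neg_deriv (a - j) (exp_neg_deriv (n - a - i) g)))"
      by (simp add: exp_neg_deriv_mult exp_neg_deriv_sum sum_distrib_left)
    also have "\<dots> = (\<Sum>i\<le>n - a. \<Sum>j\<le>a. ?T j i (a - j) (n - a - i))"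
      by (intro sum.cong refl) (simp add: sgn)
    also have "\<dots> = (\<Sum>j\<le>a. \<Sum>i\<le>n - a. ?T j i (a - j) (n - a - i))"
      by (rule sum.swap)
    finally show "const ((- 1) ^ a) * exp_neg_deriv a (exp_neg_deriv (n - a) (f * g)) = \<dots>" .
  qed
  also have "\<dots> = (\<Sum>(a, j, i)\<in>(SIGMA a:{..n}. {..a} \<times> {..n - a}). ?T j i (a - j) (n - a - i))"
    by (simp add: sum.cartesian_product sum.Sigma split_def)
  also have "\<dots> = (\<Sum>(M, j, j')\<in>(SIGMA M:{..n}. {..M} \<times> {..n - M}). ?T j (M - j) j' (n - M - j'))"
    by (rule sum.reindex_bij_witness
        [of _ "\<lambda>(M, j, j'). (j + j', j, M - j)" "\<lambda>(a, j, i). (i + j, j, a - j)"])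
      (auto simp: add.commute diff_diff_left)
  also have "\<dots> = (\<Sum>M\<le>n. \<Sum>j\<le>M. \<Sum>j'\<le>n - M. ?T j (M - j) j' (n - M - j'))"
    by (simp add: sum.cartesian_product sum.Sigma split_def)
  also have "\<dots> = (\<Sum>M\<le>n. ?K M f * ?K (n - M) g)"
    by (simp add: sum_product)
  also have "\<dots> = (\<Sum>M\<le>n. if M = 0 then (if n = 0 then f * g else 0) else 0)"
    unfolding mult by (intro sum.cong) auto
  finally show ?case by simp
qed

text \<open>
  This takes the place of a bound on the degree; it is what makes the formally infinite sums in
  \<^const>\<open>Q_op\<close> finite and lets them be compared termwise.
\<close>

definition deriv_bound :: "nat \<Rightarrow> gamma \<Rightarrow> bool"
  where "deriv_bound N f \<longleftrightarrow> (\<forall>n>N. exp_neg_deriv n f = 0)"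

lemma deriv_bound_mono: "deriv_bound N f \<Longrightarrow> N \<le> M \<Longrightarrow> deriv_bound M f"
  by (auto simp: deriv_bound_def)

lemma deriv_bound_mult:
  assumes "deriv_bound N f" and "deriv_bound M g"
  shows "deriv_bound (N + M) (f * g)"
  unfolding deriv_bound_def
proof safe
  fix n assume n: "N + M < n"
  show "exp_neg_deriv n (f * g) = 0"
    unfolding exp_neg_deriv_mult
  proof (rule sum.neutral, safe)
    fix i
    have "N < i \<or> M < n - i" using n by linarith
    then show "exp_neg_deriv i f * exp_neg_deriv (n - i) g = 0"
      using assms by (auto simp: deriv_bound_def)
  qed
qed

lemma deriv_bound_exists: "\<exists>N. deriv_bound N f"
proof (induction f rule: gamma_induct)
  case (const c)
  show ?case by (auto simp: deriv_bound_def exp_neg_deriv_const)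
next
  case (p m)
  then show ?case by (auto simp: deriv_bound_def exp_neg_deriv_p)
next
  case (add f g)
  then obtain N M where "deriv_bound N f" "deriv_bound M g" by blast
  then have "deriv_bound (max N M) (f + g)"
    by (simp add: deriv_bound_def exp_neg_deriv_add)
  then show ?case by blast
next
  case (mult f g)
  then show ?case using deriv_bound_mult by blast
qed

lemma deriv_bound_exists_finite:
  assumes "finite A"
  shows "\<exists>N\<ge>K. \<forall>f\<in>A. deriv_bound N f"
  using assms
proof (induction A)
  case (insert f A)
  then obtain N where N: "N \<ge> K" "\<forall>f\<in>A. deriv_bound N f" by blast
  obtain M where "deriv_bound M f" using deriv_bound_exists by blast
  then show ?case
    using N by (intro exI [of _ "max N M"]) (auto intro: deriv_bound_mono)
qed auto

text \<open>
  The extension of \<open>q\<close> by zero to negative indices, which saves all side conditions on indices when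
  sums over them are shifted.
\<close>

definition qz :: "int \<Rightarrow> gamma"
  where "qz m = (if 0 \<le> m then q (nat m) else 0)"

lemma Q_op_expand:
  assumes "deriv_bound N f"
  shows "Q_op m f = (\<Sum>n\<le>N. qz (m + int n) * exp_neg_deriv n f)"
proof -
  have "Q_op m f = Sum_any (\<lambda>n. qz (m + int n) * exp_neg_deriv n f)"
    unfolding Q_op_def qz_def by (rule arg_cong [of _ _ Sum_any]) auto
  also have "\<dots> = (\<Sum>n\<le>N. qz (m + int n) * exp_neg_deriv n f)"
  proof (rule Sum_any.expand_superset)
    show "{n. qz (m + int n) * exp_neg_deriv n f \<noteq> 0} \<subseteq> {..N}"
    proof
      fix n assume "n \<in> {n. qz (m + int n) * exp_neg_deriv n f \<noteq> 0}"
      then have "exp_neg_deriv n f \<noteq> 0" by auto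
      then show "n \<in> {..N}" using assms by (auto simp: deriv_bound_def not_less [symmetric])
    qed
  qed simp
  finally show ?thesis .
qed

lemma Q_op_add: "Q_op m (f + g) = Q_op m f + Q_op m g"
proof -
  obtain N where N: "\<forall>h\<in>{f, g, f + g}. deriv_bound N h"
    using deriv_bound_exists_finite [of "{f, g, f + g}" 0] by auto
  then show ?thesis
    by (simp add: Q_op_expand [of N] exp_neg_deriv_add distrib_left sum.distrib)
qed

lemma Q_op_const_mult: "Q_op m (const c * f) = const c * Q_op m f"
proof -
  obtain N where N: "\<forall>h\<in>{f, const c * f}. deriv_bound N h"
    using deriv_bound_exists_finite [of "{f, const c * f}" 0] by auto
  then show ?thesis
    by (simp add: Q_op_expand [of N] exp_neg_deriv_const_mult sum_distrib_left mult.left_commute)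
qed

lemma Q_op_0 [simp]: "Q_op m 0 = 0"
  using Q_op_const_mult [of m 0 0] by simp

lemma Q_op_sum: "Q_op m (\<Sum>i\<in>A. f i) = (\<Sum>i\<in>A. Q_op m (f i))"
  by (induction A rule: infinite_finite_induct) (auto simp: Q_op_add)

lemma Q_op_uminus: "Q_op m (- f) = - Q_op m f"
  using Q_op_const_mult [of m "- 1" f] by (simp add: const_uminus)

lemma Q_op_diff: "Q_op m (f - g) = Q_op m f - Q_op m g"
  using Q_op_add [of m f "- g"] by (simp add: Q_op_uminus)

lemma Q_op_const: "Q_op m (const c) = const c * qz m"
proof -
  have "deriv_bound 0 (const c)"
    by (auto simp: deriv_bound_def exp_neg_deriv_const)
  then show ?thesis
    by (simp add: Q_op_expand exp_neg_deriv_const mult.commute)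
qed

lemma Q_op_neg_1: "m < 0 \<Longrightarrow> Q_op m 1 = 0"
  using Q_op_const [of m 1] by (simp add: qz_def)

lemma Q_op_0_1 [simp]: "Q_op 0 1 = 1"
  using Q_op_const [of 0 1] by (simp add: qz_def)

lemma sum_nested_diagonal:
  fixes f :: "nat \<Rightarrow> nat \<Rightarrow> 'a::comm_monoid_add"
  shows "(\<Sum>j\<le>k. \<Sum>l\<le>k - j. f j l) = (\<Sum>t\<le>k. \<Sum>j\<le>t. f j (t - j))"
proof -
  have "(\<Sum>j\<le>k. \<Sum>l\<le>k - j. f j l) = (\<Sum>(j, l)\<in>(SIGMA j:{..k}. {..k - j}). f j l)"
    by (simp add: sum.Sigma)
  also have "(SIGMA j:{..k}. {..k - j}) = {(j, l). j + l \<le> k}"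
    by auto
  finally show ?thesis
    by (simp add: sum.triangle_reindex_eq)
qed

lemma exp_neg_deriv_plethysm_q_mult:
  assumes "odd s"
  shows "exp_neg_deriv a (plethysm_q s i * f) =
    (\<Sum>j\<le>i. if s * j \<le> a then const (dcoeff j) * plethysm_q s (i - j) * exp_neg_deriv (a - s * j) f else 0)"
proof -
  have "exp_neg_deriv a (plethysm_q s i * f) =
      (\<Sum>b\<le>a. \<Sum>j\<le>i. if b = s * j then
        const (dcoeff j) * plethysm_q s (i - j) * exp_neg_deriv (a - b) f else 0)"
    unfolding exp_neg_deriv_mult exp_neg_deriv_plethysm_q [OF assms] sum_distrib_right
    by (intro sum.cong) auto
  also have "\<dots> = (\<Sum>j\<le>i. \<Sum>b\<le>a. if b = s * j then
        const (dcoeff j) * plethysm_q s (i - j) * exp_neg_deriv (a - b) f else 0)"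
    by (rule sum.swap)
  finally show ?thesis by (simp add: sum.delta')
qed

lemma Q_op_plethysm_q_mult:
  assumes "odd s"
  shows "Q_op n (plethysm_q s i * f) =
    (\<Sum>j\<le>i. const (dcoeff j) * plethysm_q s (i - j) * Q_op (n + int (s * j)) f)"
proof -
  obtain N where N: "deriv_bound N f" using deriv_bound_exists by blast
  define M where "M = s * i + N"
  have "deriv_bound (s * i) (plethysm_q s i)"
    by (auto simp: deriv_bound_def exp_neg_deriv_plethysm_q [OF assms] intro!: sum.neutral)
  then have M: "deriv_bound M (plethysm_q s i * f)"
    unfolding M_def using N by (rule deriv_bound_mult)
  have "Q_op n (plethysm_q s i * f) = (\<Sum>a\<le>M. \<Sum>j\<le>i. if s * j \<le> a then
      const (dcoeff j) * plethysm_q s (i - j) * (qz (n + int a) * exp_neg_deriv (a - s * j) f) else 0)"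
    unfolding Q_op_expand [OF M] exp_neg_deriv_plethysm_q_mult [OF assms] sum_distrib_left
    by (intro sum.cong refl) (simp add: mult_ac)
  also have "\<dots> = (\<Sum>j\<le>i. \<Sum>a\<le>M. if s * j \<le> a then
      const (dcoeff j) * plethysm_q s (i - j) * (qz (n + int a) * exp_neg_deriv (a - s * j) f) else 0)"
    by (rule sum.swap)
  also have "\<dots> = (\<Sum>j\<le>i. const (dcoeff j) * plethysm_q s (i - j) * Q_op (n + int (s * j)) f)"
  proof (intro sum.cong refl)
    fix j assume "j \<in> {..i}"
    then have "s * j \<le> s * i" by simp
    then have le: "s * j \<le> M" "N \<le> M - s * j" unfolding M_def by linarith+
    have "(\<Sum>a\<le>M. if s * j \<le> a then
        const (dcoeff j) * plethysm_q s (i - j) * (qz (n + int a) * exp_neg_deriv (a - s * j) f) else 0) =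
      (\<Sum>a\<in>{s * j..M}.
        const (dcoeff j) * plethysm_q s (i - j) * (qz (n + int a) * exp_neg_deriv (a - s * j) f))"
      by (rule sum.mono_neutral_cong_right) auto
    also have "\<dots> = (\<Sum>a\<le>M - s * j.
        const (dcoeff j) * plethysm_q s (i - j) * (qz (n + int (s * j) + int a) * exp_neg_deriv a f))"
      by (rule sum.reindex_bij_witness [of _ "\<lambda>a. a + s * j" "\<lambda>a. a - s * j"])
        (use le in \<open>auto simp: add_ac\<close>)
    also have "\<dots> = const (dcoeff j) * plethysm_q s (i - j) * Q_op (n + int (s * j)) f"
      by (simp add: Q_op_expand [OF deriv_bound_mono [OF N le(2)]] sum_distrib_left)
    finally show "(\<Sum>a\<le>M. if s * j \<le> a then
        const (dcoeff j) * plethysm_q s (i - j) * (qz (n + int a) * exp_neg_deriv (a - s * j) f) else 0) = \<dots>" .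
  qed
  finally show ?thesis .
qed

text \<open>
  Conjugating \<open>Q(w)\<close> with multiplication by the series \<open>\<Sum>k. plethysm_q s k * z ^ k\<close> multiplies it
  by \<open>(1 + z / w ^ s) / (1 - z / w ^ s)\<close>, because \<open>Q(w)\<close> involves the substitution of
  \<open>p m - w ^ (- m)\<close> for \<open>p m\<close>, under which the series acquires the inverse factor.
\<close>

lemma plethysm_q_mult_Q_op:
  assumes "odd s"
  shows "plethysm_q s k * Q_op n f =
    (\<Sum>j\<le>k. const (ccoeff j) * Q_op (n + int (s * j)) (plethysm_q s (k - j) * f))"
proof -
  have "(\<Sum>j\<le>k. const (ccoeff j) * Q_op (n + int (s * j)) (plethysm_q s (k - j) * f)) =
      (\<Sum>j\<le>k. \<Sum>l\<le>k - j. const (ccoeff j * dcoeff l) * (plethysm_q s (k - (j + l)) * Q_op (n + int (s * (j + l))) f))"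
    unfolding Q_op_plethysm_q_mult [OF assms] sum_distrib_left
    by (intro sum.cong refl) (simp add: const_mult mult.assoc distrib_left add.assoc diff_diff_left)
  also have "\<dots> = (\<Sum>t\<le>k. \<Sum>j\<le>t. const (ccoeff j * dcoeff (t - j)) *
      (plethysm_q s (k - t) * Q_op (n + int (s * t)) f))"
    unfolding sum_nested_diagonal by (intro sum.cong refl) simp
  also have "\<dots> = (\<Sum>t\<le>k. const (\<Sum>j\<le>t. ccoeff j * dcoeff (t - j)) *
      (plethysm_q s (k - t) * Q_op (n + int (s * t)) f))"
    by (simp add: const_sum sum_distrib_right)
  also have "\<dots> = (\<Sum>t\<le>k. if t = 0 then plethysm_q s k * Q_op n f else 0)"
    unfolding ccoeff_dcoeff_convolution by (intro sum.cong) auto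
  finally show ?thesis by simp
qed

definition parity_sign :: "int \<Rightarrow> rat"
  where "parity_sign m = (if even m then 1 else - 1)"

lemma parity_sign_add: "parity_sign (m + n) = parity_sign m * parity_sign n"
  by (simp add: parity_sign_def)

lemma parity_sign_int: "parity_sign (int n) = (- 1) ^ n"
  by (simp add: parity_sign_def minus_one_power_iff)

text \<open>
  The coefficient of \<open>z ^ u * w ^ v\<close> in \<open>(1 - w / z) / (1 + w / z)\<close> times the product of the series
  of the elements \<open>q\<close> at \<open>z\<close> and \<open>w\<close>, provided that \<open>v \<le> J\<close>. That product is the multiplication
  part of \<open>Q(z) Q(w)\<close>.
\<close>

definition qq_sum :: "nat \<Rightarrow> int \<Rightarrow> int \<Rightarrow> gamma"
  where "qq_sum J u v = (\<Sum>j\<le>J. const (dcoeff j) * (qz (u + int j) * qz (v - int j)))"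

text \<open>
  The two sums are the two halves of a sum over all integers \<open>k\<close> of
  \<open>2 * (- 1) ^ k * q (u + k) * q (v - k)\<close>, which is a coefficient of the product of the
  series at \<open>z\<close> and \<open>- z\<close>.
\<close>

lemma qq_sum_symmetrized:
  assumes "u \<le> int J" and "v \<le> int J"
  shows "qq_sum J u v + qq_sum J v u = (if u + v = 0 then const (2 * parity_sign u) else 0)"
proof (cases "u + v < 0")
  case True
  have "qq_sum J x y = 0" if "x + y < 0" for x y
    unfolding qq_sum_def by (rule sum.neutral) (use that in \<open>auto simp: qz_def\<close>)
  from this [of u v] this [of v u] True show ?thesis
    by (simp add: add.commute)
next
  case False
  let ?t = "nat (u + v)"
  let ?f = "\<lambda>k. const (2 * parity_sign k) * (qz (u + k) * qz (v - k))"
  have "qq_sum J u v = qz u * qz v + (\<Sum>j\<in>{1..J}. ?f (int j))"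
    by (simp add: qq_sum_def atMost_atLeast0 sum.atLeast_Suc_atMost [of 0] dcoeff_def parity_sign_int)
  also have "(\<Sum>j\<in>{1..J}. ?f (int j)) = (\<Sum>k\<in>{1..int J}. ?f k)"
    by (rule sum.reindex_bij_witness [of _ nat int]) auto
  finally have 1: "qq_sum J u v = qz u * qz v + (\<Sum>k\<in>{1..int J}. ?f k)" .
  have "qq_sum J v u = qz u * qz v + (\<Sum>j\<in>{1..J}. ?f (- int j))"
    by (simp add: qq_sum_def atMost_atLeast0 sum.atLeast_Suc_atMost [of 0] dcoeff_def
        parity_sign_def minus_one_power_iff mult.commute [of "qz u"] mult.commute [of "qz (u - _)"])
  also have "(\<Sum>j\<in>{1..J}. ?f (- int j)) = (\<Sum>k\<in>{- int J..- 1}. ?f k)"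
    by (rule sum.reindex_bij_witness [of _ "\<lambda>k. nat (- k)" "\<lambda>j. - int j"]) auto
  finally have "qq_sum J u v + qq_sum J v u = ?f 0 + (\<Sum>k\<in>{1..int J}. ?f k) + (\<Sum>k\<in>{- int J..- 1}. ?f k)"
    using 1 by (simp add: parity_sign_def)
  also have "\<dots> = (\<Sum>k\<in>{0} \<union> {1..int J} \<union> {- int J..- 1}. ?f k)"
    by (subst sum.union_disjoint; (subst sum.union_disjoint)?) auto
  also have "{0} \<union> {1..int J} \<union> {- int J..- 1} = {- int J..int J}"
    by auto
  also have "(\<Sum>k\<in>{- int J..int J}. ?f k) = (\<Sum>k\<in>{- u..v}. ?f k)"
    by (rule sum.mono_neutral_right) (use assms in \<open>auto simp: qz_def\<close>)
  also have "\<dots> = (\<Sum>i\<le>?t. const (2 * parity_sign u) * (const ((- 1) ^ i) * (q i * q (?t - i))))"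
  proof (rule sum.reindex_bij_witness [of _ "\<lambda>i. int i - u" "\<lambda>k. nat (u + k)"])
    fix k assume k: "k \<in> {- u..v}"
    have "parity_sign k = parity_sign u * (- 1) ^ nat (u + k)"
      using k by (auto simp: parity_sign_def minus_one_power_iff even_nat_iff)
    moreover have "nat (u + v) - nat (u + k) = nat (v - k)"
      using k by auto
    ultimately show "const (2 * parity_sign u) *
        (const ((- 1) ^ nat (u + k)) * (q (nat (u + k)) * q (?t - nat (u + k)))) = ?f k"
      using k by (simp add: qz_def const_mult mult.assoc)
  qed (use False in auto)
  also have "\<dots> = (if u + v = 0 then const (2 * parity_sign u) else 0)"
    using False unfolding sum_distrib_left [symmetric] q_mult_neg by auto
  finally show ?thesis .
qed

lemma Q_op_qz_mult:
  assumes "v \<le> int J"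
  shows "Q_op m (qz v * f) = (\<Sum>j\<le>J. const (dcoeff j) * qz (v - int j) * Q_op (m + int j) f)"
proof (cases "v < 0")
  case True
  then show ?thesis by (simp add: qz_def)
next
  case False
  have "Q_op m (qz v * f) =
      (\<Sum>j\<le>nat v. const (dcoeff j) * q (nat v - j) * Q_op (m + int j) f)"
    using Q_op_plethysm_q_mult [of "Suc 0" m "nat v" f] False by (simp add: qz_def)
  also have "\<dots> = (\<Sum>j\<le>J. const (dcoeff j) * qz (v - int j) * Q_op (m + int j) f)"
    by (rule sum.mono_neutral_cong_left)
      (use assms False in \<open>auto simp: qz_def nat_diff_distrib\<close>)
  finally show ?thesis .
qed

lemma Q_op_Q_op:
  assumes "deriv_bound N f" and "\<And>b. b \<le> N \<Longrightarrow> deriv_bound N (exp_neg_deriv b f)"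
    and "n + int N \<le> int J"
  shows "Q_op m (Q_op n f) =
    (\<Sum>a\<le>N. \<Sum>b\<le>N. qq_sum J (m + int a) (n + int b) * exp_neg_deriv a (exp_neg_deriv b f))"
proof -
  have "Q_op m (Q_op n f) = (\<Sum>b\<le>N. Q_op m (qz (n + int b) * exp_neg_deriv b f))"
    by (simp add: Q_op_expand [OF assms(1), of n] Q_op_sum)
  also have "\<dots> = (\<Sum>b\<le>N. \<Sum>a\<le>N. qq_sum J (m + int a) (n + int b) * exp_neg_deriv a (exp_neg_deriv b f))"
  proof (intro sum.cong refl)
    fix b assume "b \<in> {..N}"
    then have b: "b \<le> N" by simp
    have "Q_op m (qz (n + int b) * exp_neg_deriv b f) =
        (\<Sum>j\<le>J. \<Sum>a\<le>N. const (dcoeff j) * (qz (m + int a + int j) * qz (n + int b - int j)) *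
          exp_neg_deriv a (exp_neg_deriv b f))"
      using b assms(3)
      by (subst Q_op_qz_mult [of _ J])
        (auto simp: Q_op_expand [OF assms(2)] sum_distrib_left mult_ac add_ac)
    also have "\<dots> = (\<Sum>a\<le>N. \<Sum>j\<le>J. const (dcoeff j) * (qz (m + int a + int j) * qz (n + int b - int j)) *
          exp_neg_deriv a (exp_neg_deriv b f))"
      by (rule sum.swap)
    also have "\<dots> = (\<Sum>a\<le>N. qq_sum J (m + int a) (n + int b) * exp_neg_deriv a (exp_neg_deriv b f))"
      by (simp add: qq_sum_def sum_distrib_right)
    finally show "Q_op m (qz (n + int b) * exp_neg_deriv b f) = \<dots>" .
  qed
  also have "\<dots> = (\<Sum>a\<le>N. \<Sum>b\<le>N. qq_sum J (m + int a) (n + int b) * exp_neg_deriv a (exp_neg_deriv b f))"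
    by (rule sum.swap)
  finally show ?thesis .
qed

text \<open>
  The Clifford relation on which everything rests. In \<open>Q(z) Q(w)\<close> and \<open>Q(w) Q(z)\<close> the multiplication
  parts are expanded in opposite directions, and their sum is concentrated on \<open>w = - z\<close> by
  \<open>qq_sum_symmetrized\<close>, where the derivative parts cancel by \<open>exp_neg_deriv_inverse\<close>.
\<close>

lemma Q_op_anticommute:
  "Q_op m (Q_op n f) + Q_op n (Q_op m f) =
    (if m + n = 0 then const (2 * parity_sign m) * f else 0)"
proof -
  obtain N0 where N0: "deriv_bound N0 f"
    using deriv_bound_exists by blast
  \<comment> \<open>A common length of all sums: it bounds \<open>f\<close> and its images under \<open>exp_neg_deriv\<close>, and exceeds
    the total degree \<open>- (m + n)\<close> that the derivatives have in the surviving terms.\<close>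
  obtain N where N: "N \<ge> max N0 (nat (- (m + n)))"
    "\<forall>g\<in>(\<lambda>b. exp_neg_deriv b f) ` {..N0}. deriv_bound N g"
    using deriv_bound_exists_finite [of "(\<lambda>b. exp_neg_deriv b f) ` {..N0}"] by blast
  have fN: "deriv_bound N f"
    using N0 N(1) by (auto intro: deriv_bound_mono)
  have EN: "deriv_bound N (exp_neg_deriv b f)" for b
    by (cases "b \<le> N0") (use N(2) N0 in \<open>auto simp: deriv_bound_def\<close>)
  define J where "J = nat (max m n) + N"
  have J: "m + int N \<le> int J" "n + int N \<le> int J"
    by (auto simp: J_def)
  have "Q_op n (Q_op m f) =
      (\<Sum>b\<le>N. \<Sum>a\<le>N. qq_sum J (n + int b) (m + int a) * exp_neg_deriv b (exp_neg_deriv a f))"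
    by (rule Q_op_Q_op [OF fN EN J(1)])
  also have "\<dots> = (\<Sum>a\<le>N. \<Sum>b\<le>N. qq_sum J (n + int b) (m + int a) * exp_neg_deriv b (exp_neg_deriv a f))"
    by (rule sum.swap)
  also have "\<dots> = (\<Sum>a\<le>N. \<Sum>b\<le>N. qq_sum J (n + int b) (m + int a) * exp_neg_deriv a (exp_neg_deriv b f))"
    by (intro sum.cong refl) (simp add: exp_neg_deriv_commute)
  finally have "Q_op m (Q_op n f) + Q_op n (Q_op m f) =
      (\<Sum>a\<le>N. \<Sum>b\<le>N. (qq_sum J (m + int a) (n + int b) + qq_sum J (n + int b) (m + int a)) *
        exp_neg_deriv a (exp_neg_deriv b f))"
    by (simp add: Q_op_Q_op [OF fN EN J(2)] distrib_right sum.distrib)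
  also have "\<dots> = (\<Sum>a\<le>N. \<Sum>b\<le>N. if m + int a + (n + int b) = 0
      then const (2 * parity_sign (m + int a)) * exp_neg_deriv a (exp_neg_deriv b f) else 0)"
    using J by (intro sum.cong refl) (simp add: qq_sum_symmetrized)
  also have "\<dots> = (if m + n = 0 then const (2 * parity_sign m) * f else 0)"
  proof (cases "m + n > 0")
    case True
    then show ?thesis by (auto intro!: sum.neutral)
  next
    case False
    define M where "M = nat (- (m + n))"
    have M: "m + int a + (n + int b) = 0 \<longleftrightarrow> a \<le> M \<and> b = M - a" for a b
      using False by (auto simp: M_def)
    have "M \<le> N" using N(1) by (simp add: M_def)
    have "(\<Sum>a\<le>N. \<Sum>b\<le>N. if m + int a + (n + int b) = 0
        then const (2 * parity_sign (m + int a)) * exp_neg_deriv a (exp_neg_deriv b f) else 0) =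
      (\<Sum>a\<le>N. if a \<le> M then const (2 * parity_sign (m + int a)) * exp_neg_deriv a (exp_neg_deriv (M - a) f) else 0)"
      unfolding M
    proof (intro sum.cong refl)
      fix a
      have "M - a \<le> N" using \<open>M \<le> N\<close> by simp
      then show "(\<Sum>b\<le>N. if a \<le> M \<and> b = M - a then const (2 * parity_sign (m + int a)) *
          exp_neg_deriv a (exp_neg_deriv b f) else 0) =
        (if a \<le> M then const (2 * parity_sign (m + int a)) * exp_neg_deriv a (exp_neg_deriv (M - a) f) else 0)"
        by (cases "a \<le> M") (simp_all add: sum.delta')
    qed
    also have "\<dots> = (\<Sum>a\<le>M. const (2 * parity_sign m) *
        (const ((- 1) ^ a) * exp_neg_deriv a (exp_neg_deriv (M - a) f)))"
      by (rule sum.mono_neutral_cong_right)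
        (use \<open>M \<le> N\<close> in \<open>auto simp: parity_sign_add parity_sign_int const_mult mult.assoc\<close>)
    also have "\<dots> = (if M = 0 then const (2 * parity_sign m) * f else 0)"
      unfolding sum_distrib_left [symmetric] exp_neg_deriv_inverse by simp
    also have "M = 0 \<longleftrightarrow> m + n = 0"
      using False by (auto simp: M_def)
    finally show ?thesis .
  qed
  finally show ?thesis .
qed

lemma const_term_q: "0 < n \<Longrightarrow> const_term (q n) = 0"
proof (cases n)
  case (Suc m)
  have "const_term (const (of_nat (Suc m)) * q (Suc m)) = 0"
    unfolding const_of_nat q_rec const_term_sum
    by (intro sum.neutral) (auto simp: const_term_mult const_term_def [of 0])
  then show ?thesis
    by (simp add: Suc const_term_mult del: of_nat_Suc)
qed simp

lemma const_term_Q_op: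
  assumes "0 \<le> m"
  shows "const_term (Q_op m f) = (if m = 0 then const_term f else 0)"
proof -
  obtain N where N: "deriv_bound N f" using deriv_bound_exists by blast
  have qz: "const_term (qz (m + int n)) = (if m = 0 \<and> n = 0 then 1 else 0)" for n
    using assms by (auto simp: qz_def const_term_q)
  have "const_term (Q_op m f) =
      (\<Sum>n\<le>N. if n = 0 then (if m = 0 then const_term (exp_neg_deriv 0 f) else 0) else 0)"
    unfolding Q_op_expand [OF N] const_term_sum const_term_mult qz by (intro sum.cong) auto
  also have "exp_neg_deriv 0 f = f"
    by (simp add: exp_neg_deriv_def)
  finally show ?thesis by simp
qed

text \<open>
  As \<open>Q_op (- n) f\<close> is \<open>exp_neg_deriv n f\<close> plus multiples of \<open>exp_neg_deriv i f\<close> with \<open>i > n\<close>,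
  descending induction shows that every \<open>exp_neg_deriv n f\<close> with \<open>n > 0\<close> vanishes. For odd \<open>n\<close> this
  is \<open>- dp n f\<close> plus terms with iterated derivatives of lower degree, so that by ascending induction
  all partial derivatives vanish.
\<close>

lemma constant_if_Q_op_neg_zero:
  assumes "\<And>n. 0 < n \<Longrightarrow> Q_op (- int n) f = 0"
  shows "f = const (const_term f)"
proof -
  obtain N where N: "deriv_bound N f" using deriv_bound_exists by blast
  have "exp_neg_deriv n f = 0" if "0 < n" for n
    using that
  proof (induction "N - n" arbitrary: n rule: less_induct)
    case less
    show ?case
    proof (cases "n \<le> N")
      case True
      have "(\<Sum>i\<le>N. qz (- int n + int i) * exp_neg_deriv i f) =
          (\<Sum>i\<le>N. if i = n then exp_neg_deriv i f else 0)"
      proof (intro sum.cong refl)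
        fix i assume "i \<in> {..N}"
        then show "qz (- int n + int i) * exp_neg_deriv i f = (if i = n then exp_neg_deriv i f else 0)"
          using less(1) [of i] less.prems by (cases i n rule: linorder_cases) (auto simp: qz_def)
      qed
      then show ?thesis
        using assms [OF less.prems] True by (simp add: Q_op_expand [OF N])
    next
      case False
      then show ?thesis using N by (simp add: deriv_bound_def)
    qed
  qed note E = this
  have "dp n f = 0" if "odd n" for n
    using that
  proof (induction n rule: less_induct)
    case (less n)
    have D1: "neg_deriv_op (fps_const f) $ i = - (if odd i then dp i f else 0)" for i
    proof -
      have "(\<Sum>m | m \<le> i \<and> odd m. dp m (fps_const f $ (i - m))) =
          (\<Sum>m | m \<le> i \<and> odd m. if m = i then dp m f else 0)"
        by (intro sum.cong) auto
      then show ?thesis by (simp add: neg_deriv_op_nth sum.delta')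
    qed
    have low: "(neg_deriv_op ^^ Suc j) (fps_const f) $ i = 0" if "i < n" for i j
      using that
    proof (induction j arbitrary: i)
      case 0
      then show ?case using less by (auto simp: D1)
    next
      case (Suc j)
      have "(neg_deriv_op ^^ Suc (Suc j)) (fps_const f) $ i =
          neg_deriv_op ((neg_deriv_op ^^ Suc j) (fps_const f)) $ i"
        by simp
      also have "\<dots> = 0"
        unfolding neg_deriv_op_nth using Suc by (simp del: funpow.simps)
      finally show ?case .
    qed
    have high: "(neg_deriv_op ^^ Suc (Suc j)) (fps_const f) $ n = 0" for j
    proof -
      have "(neg_deriv_op ^^ Suc (Suc j)) (fps_const f) $ n =
          neg_deriv_op ((neg_deriv_op ^^ Suc j) (fps_const f)) $ n"
        by simp
      also have "\<dots> = 0"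
        unfolding neg_deriv_op_nth
      proof (simp only: neg_equal_0_iff_equal, rule sum.neutral, safe)
        fix m :: nat assume "m \<le> n" "odd m"
        then have "n - m < n" using odd_pos [of m] by linarith
        then show "dp m ((neg_deriv_op ^^ Suc j) (fps_const f) $ (n - m)) = 0"
          by (simp add: low del: funpow.simps)
      qed
      finally show ?thesis .
    qed
    have "0 < n" using less.prems by (rule odd_pos)
    have "exp_neg_deriv n f = (\<Sum>j\<le>n. if j = 1 then neg_deriv_op (fps_const f) $ n else 0)"
      unfolding exp_neg_deriv_def
    proof (intro sum.cong refl)
      fix j
      consider "j = 0" | "j = 1" | i where "j = Suc (Suc i)"
        by (metis One_nat_def not0_implies_Suc)
      then show "const (1 / fact j) * (neg_deriv_op ^^ j) (fps_const f) $ n =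
          (if j = 1 then neg_deriv_op (fps_const f) $ n else 0)"
      proof cases
        case 3
        then show ?thesis using high [of i] by (simp del: funpow.simps)
      qed (use \<open>0 < n\<close> in simp_all)
    qed
    also have "\<dots> = - dp n f"
      using \<open>0 < n\<close> less.prems by (simp add: D1)
    finally show ?case using E [OF \<open>0 < n\<close>] by simp
  qed
  then show ?thesis by (rule constant_if_dp_zero)
qed


section \<open>Generating series of the operators Q\<close>

text \<open>
  The operator \<open>\<Sum>a. w a * x ^ a * Q_op a\<close> on power series in \<open>x\<close>; the exponent of \<open>x\<close> makes the
  infinite sum meaningful and records the size of the resulting partitions.
\<close>

definition Q_gen :: "(nat \<Rightarrow> rat) \<Rightarrow> gamma fps \<Rightarrow> gamma fps"
  where "Q_gen w F = Abs_fps (\<lambda>d. \<Sum>a\<le>d. const (w a) * Q_op (int a) (F $ (d - a)))"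

lemma Q_gen_nth: "Q_gen w F $ d = (\<Sum>a\<le>d. const (w a) * Q_op (int a) (F $ (d - a)))"
  by (simp add: Q_gen_def)

lemma Q_gen_add: "Q_gen w (F + G) = Q_gen w F + Q_gen w G"
  by (simp add: fps_eq_iff Q_gen_nth Q_op_add distrib_left sum.distrib)

lemma Q_gen_0 [simp]: "Q_gen w 0 = 0"
  by (simp add: fps_eq_iff Q_gen_nth)

lemma Q_gen_const_mult: "Q_gen w (fps_const (const c) * F) = fps_const (const c) * Q_gen w F"
  by (simp add: fps_eq_iff Q_gen_nth Q_op_const_mult sum_distrib_left mult.left_commute)

lemma Q_gen_uminus: "Q_gen w (- F) = - Q_gen w F"
  by (simp add: fps_eq_iff Q_gen_nth Q_op_uminus sum_negf)

lemma Q_gen_diff: "Q_gen w (F - G) = Q_gen w F - Q_gen w G"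
  using Q_gen_add [of w F "- G"] by (simp add: Q_gen_uminus)

lemma Q_gen_sum: "Q_gen w (\<Sum>i\<in>A. F i) = (\<Sum>i\<in>A. Q_gen w (F i))"
  by (induction A rule: infinite_finite_induct) (auto simp: Q_gen_add)

lemma Q_gen_weight_add:
  "Q_gen (\<lambda>a. v a + c * u a) F = Q_gen v F + fps_const (const c) * Q_gen u F"
  by (simp add: fps_eq_iff Q_gen_nth const_add const_mult distrib_right sum.distrib
      sum_distrib_left mult.assoc)

lemma Q_gen_X_power_mult: "Q_gen w (fps_X ^ n * F) = fps_X ^ n * Q_gen w F"
proof (rule fps_ext)
  fix d
  show "Q_gen w (fps_X ^ n * F) $ d = (fps_X ^ n * Q_gen w F) $ d"
  proof (cases "n \<le> d")
    case True
    have "(\<Sum>a\<le>d. const (w a) * Q_op (int a) ((fps_X ^ n * F) $ (d - a))) =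
        (\<Sum>a\<le>d - n. const (w a) * Q_op (int a) (F $ (d - n - a)))"
      by (rule sum.mono_neutral_cong_right)
        (use True in \<open>auto simp: fps_X_power_mult_nth diff_commute add.commute\<close>)
    then show ?thesis
      using True by (simp add: Q_gen_nth fps_X_power_mult_nth)
  qed (auto simp: Q_gen_nth fps_X_power_mult_nth intro!: sum.neutral)
qed

text \<open>
  Of the Clifford relation only the case of two indices \<open>0\<close> remains, because no negative indices occur
  in \<^const>\<open>Q_gen\<close>. Hence all these operators anticommute, except for the contribution of \<open>Q_op 0\<close>,
  whose square is \<open>1\<close>.
\<close>

lemma Q_gen_anticommute:
  "Q_gen w (Q_gen v F) + Q_gen v (Q_gen w F) = fps_const (const (2 * w 0 * v 0)) * F"
proof (rule fps_ext)
  fix d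
  have expand: "Q_gen w (Q_gen v F) $ d = (\<Sum>a\<le>d. \<Sum>b\<le>d. if a + b \<le> d then
      const (w a * v b) * Q_op (int a) (Q_op (int b) (F $ (d - (a + b)))) else 0)" for w v
    unfolding Q_gen_nth Q_op_sum sum_distrib_left
  proof (rule sum.cong [OF refl])
    fix a assume "a \<in> {..d}"
    then show "(\<Sum>b\<le>d - a. const (w a) * Q_op (int a) (const (v b) * Q_op (int b) (F $ (d - a - b)))) =
        (\<Sum>b\<le>d. if a + b \<le> d then const (w a * v b) * Q_op (int a) (Q_op (int b) (F $ (d - (a + b)))) else 0)"
      by (intro sum.mono_neutral_cong_left) (auto simp: Q_op_const_mult const_mult mult.assoc)
  qed
  have swapped: "Q_gen v (Q_gen w F) $ d = (\<Sum>a\<le>d. \<Sum>b\<le>d. if a + b \<le> d then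
      const (w a * v b) * Q_op (int b) (Q_op (int a) (F $ (d - (a + b)))) else 0)"
    unfolding expand
    by (subst sum.swap) (intro sum.cong refl, simp add: mult.commute add.commute)
  have "(Q_gen w (Q_gen v F) + Q_gen v (Q_gen w F)) $ d =
      (\<Sum>a\<le>d. \<Sum>b\<le>d. if a + b \<le> d then const (w a * v b) *
        (Q_op (int a) (Q_op (int b) (F $ (d - (a + b)))) + Q_op (int b) (Q_op (int a) (F $ (d - (a + b))))) else 0)"
    unfolding fps_add_nth expand [of w v] swapped sum.distrib [symmetric]
    by (intro sum.cong refl) (simp add: distrib_left)
  also have "\<dots> = (\<Sum>a\<le>d. if a = 0 then (\<Sum>b\<le>d. if b = 0 then const (2 * w 0 * v 0) * F $ d else 0) else 0)"
    unfolding Q_op_anticommute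
  proof (intro sum.cong refl)
    fix a
    show "(\<Sum>b\<le>d. if a + b \<le> d then const (w a * v b) * (if int a + int b = 0
        then const (2 * parity_sign (int a)) * F $ (d - (a + b)) else 0) else 0) =
      (if a = 0 then (\<Sum>b\<le>d. if b = 0 then const (2 * w 0 * v 0) * F $ d else 0) else 0)"
    proof (cases "a = 0")
      case True
      show ?thesis
        unfolding True if_P [OF refl]
        by (intro sum.cong refl) (auto simp: parity_sign_def const_mult mult_ac)
    qed (auto intro!: sum.neutral)
  qed
  finally show "(Q_gen w (Q_gen v F) + Q_gen v (Q_gen w F)) $ d =
      (fps_const (const (2 * w 0 * v 0)) * F) $ d"
    by simp
qed

lemma Q_gen_swap:
  assumes "w 0 = 0 \<or> v 0 = 0"
  shows "Q_gen w (Q_gen v F) = - Q_gen v (Q_gen w F)"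
proof -
  have "Q_gen w (Q_gen v F) + Q_gen v (Q_gen w F) = 0"
    unfolding Q_gen_anticommute using assms by auto
  then show ?thesis by (simp add: eq_neg_iff_add_eq_0)
qed

lemma fps_double_eq_0:
  assumes "F + F = (0 :: gamma fps)"
  shows "F = 0"
proof -
  have "of_nat (Suc 1) * F = 0" using assms by (simp add: algebra_simps)
  then show ?thesis using of_nat_gamma_fps_neq_0 [of 1] by (simp only: mult_eq_0_iff) blast
qed

lemma Q_gen_square: "w 0 = 0 \<Longrightarrow> Q_gen w (Q_gen w F) = 0"
  using Q_gen_anticommute [of w w F] by (auto intro: fps_double_eq_0)

lemma Q_gen_involution:
  assumes "w 0 = 1"
  shows "Q_gen w (Q_gen w F) = F"
proof -
  have "Q_gen w (Q_gen w F) + Q_gen w (Q_gen w F) = fps_const (const (2 * w 0 * w 0)) * F"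
    by (rule Q_gen_anticommute)
  also have "\<dots> = 2 * F"
    by (simp add: assms numeral_fps_const)
  finally have double: "Q_gen w (Q_gen w F) + Q_gen w (Q_gen w F) = F + F"
    unfolding mult_2 .
  have "(Q_gen w (Q_gen w F) - F) + (Q_gen w (Q_gen w F) - F) = 0"
    unfolding add_diff_add [symmetric] double by (rule diff_self)
  then have "Q_gen w (Q_gen w F) - F = 0" by (rule fps_double_eq_0)
  then show ?thesis by (simp only: right_minus_eq)
qed

lemma const_term_Q_gen: "const_term (Q_gen w F $ d) = w 0 * const_term (F $ d)"
proof -
  have "const_term (Q_gen w F $ d) = (\<Sum>a\<le>d. if a = 0 then w 0 * const_term (F $ d) else 0)"
    unfolding Q_gen_nth const_term_sum const_term_mult by (intro sum.cong) (auto simp: const_term_Q_op)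
  then show ?thesis by simp
qed


section \<open>The plethysm as a quadratic exponential\<close>

text \<open>
  The generating series in \<open>x ^ s\<close>, so that the exponent of \<open>x\<close> is the degree.
\<close>

definition plethysm_series :: "nat \<Rightarrow> gamma fps"
  where "plethysm_series s = Abs_fps (\<lambda>d. if s dvd d then plethysm_q s (d div s) else 0)"

lemma sum_multiples:
  fixes f :: "nat \<Rightarrow> 'a::comm_monoid_add"
  assumes "0 < s"
  shows "(\<Sum>i\<le>d. if s dvd i then f i else 0) = (\<Sum>k\<le>d div s. f (s * k))"
proof -
  have "(\<Sum>i\<le>d. if s dvd i then f i else 0) = (\<Sum>i\<in>{i. i \<le> d \<and> s dvd i}. f i)"
    by (rule sum.mono_neutral_cong_right) auto
  also have "\<dots> = (\<Sum>k\<le>d div s. f (s * k))"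
    by (rule sum.reindex_bij_witness [of _ "\<lambda>k. s * k" "\<lambda>i. i div s"])
      (use assms in \<open>auto simp: div_le_mono less_eq_div_iff_mult_less_eq mult.commute\<close>)
  finally show ?thesis .
qed

text \<open>
  The operator \<open>\<Sum>j. ccoeff j * x ^ (s * j) * Q_op (s * j - n)\<close>, which is
  \<open>Q_op (- n)\<close> conjugated by multiplication with the plethysm series.
\<close>

definition conj_annihilator :: "nat \<Rightarrow> nat \<Rightarrow> gamma fps \<Rightarrow> gamma fps"
  where "conj_annihilator s n F =
    Abs_fps (\<lambda>d. \<Sum>j\<le>d div s. const (ccoeff j) * Q_op (int (s * j) - int n) (F $ (d - s * j)))"

lemma conj_annihilator_nth:
  "conj_annihilator s n F $ d =
    (\<Sum>j\<le>d div s. const (ccoeff j) * Q_op (int (s * j) - int n) (F $ (d - s * j)))"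
  by (simp add: conj_annihilator_def)

lemma conj_annihilator_add:
  "conj_annihilator s n (F + G) = conj_annihilator s n F + conj_annihilator s n G"
  by (simp add: fps_eq_iff conj_annihilator_nth Q_op_add distrib_left sum.distrib)

text \<open>
  The left hand side is the product of the series with \<open>Q_op (- n) 1\<close>, which is zero.
\<close>

lemma conj_annihilator_plethysm_series:
  assumes "odd s" and "0 < n"
  shows "conj_annihilator s n (plethysm_series s) = 0"
proof (rule fps_ext)
  fix d
  have s: "0 < s" using assms(1) by (rule odd_pos)
  have nth: "plethysm_series s $ (d - s * j) = (if s dvd d then plethysm_q s (d div s - j) else 0)"
    if "j \<le> d div s" for j
  proof -
    have "s * j \<le> d" using that s by (simp add: less_eq_div_iff_mult_less_eq mult.commute)
    then obtain e where "d = s * j + e"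
      by (auto simp: le_iff_add)
    then show ?thesis
      using s by (simp add: plethysm_series_def dvd_add_right_iff)
  qed
  have "plethysm_q s (d div s) * Q_op (- int n) 1 = (\<Sum>j\<le>d div s.
      const (ccoeff j) * Q_op (int (s * j) - int n) (plethysm_q s (d div s - j)))"
    by (simp add: plethysm_q_mult_Q_op [OF assms(1)])
  then show "conj_annihilator s n (plethysm_series s) $ d = 0 $ d"
    using assms(2) by (cases "s dvd d") (simp_all add: conj_annihilator_nth nth Q_op_neg_1)
qed

text \<open>
  The coefficient of \<open>x ^ 0\<close> in the operator \<^const>\<open>conj_annihilator\<close> is \<open>Q_op (- n)\<close>, so that each
  coefficient of a series killed by these operators is determined by the lower ones up to a constant.
\<close>

lemma conj_annihilator_kernel_unique:
  assumes "\<And>n. 0 < n \<Longrightarrow> conj_annihilator s n F = 0"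
    and "\<And>n. 0 < n \<Longrightarrow> conj_annihilator s n G = 0"
    and "\<And>d. const_term (F $ d) = const_term (G $ d)" and "0 < s"
  shows "F = G"
proof (rule fps_ext)
  fix d
  show "F $ d = G $ d"
  proof (induction d rule: less_induct)
    case (less d)
    have "Q_op (- int n) (F $ d - G $ d) = 0" if "0 < n" for n
    proof -
      have expand: "conj_annihilator s n H $ d = Q_op (- int n) (H $ d) +
          (\<Sum>j\<in>{1..d div s}. const (ccoeff j) * Q_op (int (s * j) - int n) (H $ (d - s * j)))" for H
        unfolding conj_annihilator_nth
        by (simp add: atMost_atLeast0 sum.atLeast_Suc_atMost [of 0])
      have lower: "(\<Sum>j\<in>{1..d div s}. const (ccoeff j) * Q_op (int (s * j) - int n) (F $ (d - s * j))) =
          (\<Sum>j\<in>{1..d div s}. const (ccoeff j) * Q_op (int (s * j) - int n) (G $ (d - s * j)))"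
      proof (intro sum.cong refl)
        fix j assume j: "j \<in> {1..d div s}"
        then have "d \<noteq> 0" by (auto intro: ccontr)
        then have "d - s * j < d" using j \<open>0 < s\<close> by (simp add: diff_less)
        then show "const (ccoeff j) * Q_op (int (s * j) - int n) (F $ (d - s * j)) =
            const (ccoeff j) * Q_op (int (s * j) - int n) (G $ (d - s * j))"
          using less by simp
      qed
      have "conj_annihilator s n F $ d = conj_annihilator s n G $ d"
        using assms(1,2) [OF that] by simp
      then have "Q_op (- int n) (F $ d) = Q_op (- int n) (G $ d)"
        unfolding expand lower by (simp only: add_right_cancel)
      then show ?thesis by (simp add: Q_op_diff)
    qed
    then have "F $ d - G $ d = const (const_term (F $ d - G $ d))"
      by (rule constant_if_Q_op_neg_zero)
    then show ?case
      by (simp add: const_term_diff assms(3))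
  qed
qed

definition class_indicator :: "nat \<Rightarrow> nat \<Rightarrow> nat \<Rightarrow> rat"
  where "class_indicator s r a = (if a mod s = r then 1 else 0)"

lemma class_indicator_0: "class_indicator s r 0 = (if r = 0 then 1 else 0)"
  by (simp add: class_indicator_def)

text \<open>
  By the Clifford relation the anticommutator is a scalar multiple of \<open>x ^ n\<close>: the term with
  \<open>Q_op (s * j - n)\<close> pairs with the term of \<^const>\<open>Q_gen\<close> that has index \<open>n - s * j\<close>.
\<close>

lemma conj_annihilator_Q_gen:
  assumes "0 < s"
  shows "conj_annihilator s n (Q_gen w F) + Q_gen w (conj_annihilator s n F) =
    fps_const (const (\<Sum>j\<le>n div s. 2 * ccoeff j * (- 1) ^ (n - s * j) * w (n - s * j))) *
      (fps_X ^ n * F)"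
proof (rule fps_ext)
  fix d
  have le: "j \<le> m div s \<longleftrightarrow> s * j \<le> m" for j m
    using assms by (simp add: less_eq_div_iff_mult_less_eq mult.commute)
  have j_le: "s * j \<le> m \<Longrightarrow> j \<le> m" for j m
    using assms by (metis le div_le_dividend le_trans)
  have "conj_annihilator s n (Q_gen w F) $ d = (\<Sum>j\<le>d. \<Sum>a\<le>d. if s * j + a \<le> d then
      const (ccoeff j * w a) * Q_op (int (s * j) - int n) (Q_op (int a) (F $ (d - (s * j + a)))) else 0)"
    unfolding conj_annihilator_nth Q_gen_nth Q_op_sum sum_distrib_left
  proof (rule sum.mono_neutral_cong_left)
    fix j assume "j \<in> {..d div s}"
    then have "s * j \<le> d" by (simp add: le)
    then show "(\<Sum>a\<le>d - s * j. const (ccoeff j) * Q_op (int (s * j) - int n)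
        (const (w a) * Q_op (int a) (F $ (d - s * j - a)))) =
      (\<Sum>a\<le>d. if s * j + a \<le> d then const (ccoeff j * w a) *
        Q_op (int (s * j) - int n) (Q_op (int a) (F $ (d - (s * j + a)))) else 0)"
      by (intro sum.mono_neutral_cong_left) (auto simp: Q_op_const_mult const_mult mult.assoc)
  qed (auto intro!: sum.neutral simp: le)
  moreover have "Q_gen w (conj_annihilator s n F) $ d = (\<Sum>j\<le>d. \<Sum>a\<le>d. if s * j + a \<le> d then
      const (ccoeff j * w a) * Q_op (int a) (Q_op (int (s * j) - int n) (F $ (d - (s * j + a)))) else 0)"
  proof -
    have "Q_gen w (conj_annihilator s n F) $ d = (\<Sum>a\<le>d. \<Sum>j\<le>d. if s * j + a \<le> d then
        const (ccoeff j * w a) * Q_op (int a) (Q_op (int (s * j) - int n) (F $ (d - (s * j + a)))) else 0)"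
      unfolding conj_annihilator_nth Q_gen_nth Q_op_sum sum_distrib_left
    proof (rule sum.cong [OF refl])
      fix a assume "a \<in> {..d}"
      then show "(\<Sum>j\<le>(d - a) div s. const (w a) * Q_op (int a)
          (const (ccoeff j) * Q_op (int (s * j) - int n) (F $ (d - a - s * j)))) =
        (\<Sum>j\<le>d. if s * j + a \<le> d then const (ccoeff j * w a) *
          Q_op (int a) (Q_op (int (s * j) - int n) (F $ (d - (s * j + a)))) else 0)"
        by (intro sum.mono_neutral_cong_left)
          (auto simp: Q_op_const_mult const_mult mult_ac le add.commute intro: order_trans [OF j_le]
            order_trans [OF div_le_dividend])
    qed
    then show ?thesis by (subst sum.swap)
  qed
  ultimately have "(conj_annihilator s n (Q_gen w F) + Q_gen w (conj_annihilator s n F)) $ d =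
      (\<Sum>j\<le>d. \<Sum>a\<le>d. if s * j + a \<le> d then const (ccoeff j * w a) *
        (Q_op (int (s * j) - int n) (Q_op (int a) (F $ (d - (s * j + a)))) +
         Q_op (int a) (Q_op (int (s * j) - int n) (F $ (d - (s * j + a))))) else 0)"
    unfolding fps_add_nth sum.distrib [symmetric] 
    by (simp add: sum.distrib [symmetric] distrib_left if_distrib cong: if_cong)
  also have "\<dots> = (\<Sum>j\<le>d. \<Sum>a\<le>d. if a = n - s * j then (if s * j \<le> n \<and> n \<le> d then
        const (2 * ccoeff j * (- 1) ^ (n - s * j) * w (n - s * j)) * F $ (d - n) else 0) else 0)"
    unfolding Q_op_anticommute
  proof (intro sum.cong refl)
    fix j a
    have eq: "int (s * j) - int n + int a = 0 \<longleftrightarrow> s * j + a = n"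
      by linarith
    show "(if s * j + a \<le> d then const (ccoeff j * w a) * (if int (s * j) - int n + int a = 0
        then const (2 * parity_sign (int (s * j) - int n)) * F $ (d - (s * j + a)) else 0) else 0) =
      (if a = n - s * j then (if s * j \<le> n \<and> n \<le> d then
        const (2 * ccoeff j * (- 1) ^ (n - s * j) * w (n - s * j)) * F $ (d - n) else 0) else 0)"
    proof (cases "s * j + a = n")
      case True
      have "parity_sign (- int a) = (- 1) ^ a"
        by (simp add: parity_sign_def minus_one_power_iff)
      then show ?thesis by (simp add: True [symmetric] const_mult mult_ac)
    next
      case False
      then show ?thesis unfolding eq by auto
    qed
  qed
  also have "\<dots> = (\<Sum>j\<le>d. if s * j \<le> n \<and> n \<le> d then
        const (2 * ccoeff j * (- 1) ^ (n - s * j) * w (n - s * j)) * F $ (d - n) else 0)"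
    by (intro sum.cong refl) (auto simp: sum.delta')
  also have "\<dots> = (if n \<le> d then (\<Sum>j\<le>n div s.
        const (2 * ccoeff j * (- 1) ^ (n - s * j) * w (n - s * j)) * F $ (d - n)) else 0)"
  proof (cases "n \<le> d")
    case True
    then show ?thesis
      by (simp, intro sum.mono_neutral_cong_right) (auto simp: le intro: order_trans [OF j_le]
          order_trans [OF div_le_dividend])
  qed simp
  finally show "(conj_annihilator s n (Q_gen w F) + Q_gen w (conj_annihilator s n F)) $ d =
      (fps_const (const (\<Sum>j\<le>n div s. 2 * ccoeff j * (- 1) ^ (n - s * j) * w (n - s * j))) *
        (fps_X ^ n * F)) $ d"
    by (simp add: fps_X_power_mult_nth const_sum sum_distrib_right)
qed

lemma conj_annihilator_class:
  assumes "odd s" and "r < s"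
  shows "conj_annihilator s n (Q_gen (class_indicator s r) F) =
    (if n mod s = r then fps_const (const (2 * (- 1) ^ r)) * (fps_X ^ n * F) else 0) -
    Q_gen (class_indicator s r) (conj_annihilator s n F)"
proof -
  have s: "0 < s" using assms(1) by (rule odd_pos)
  have "(\<Sum>j\<le>n div s. 2 * ccoeff j * (- 1) ^ (n - s * j) * class_indicator s r (n - s * j)) =
      (if n mod s = r then 2 * (- 1) ^ r else 0)"
  proof -
    have "(\<Sum>j\<le>n div s. 2 * ccoeff j * (- 1) ^ (n - s * j) * class_indicator s r (n - s * j)) =
        (\<Sum>j\<le>n div s. if n mod s = r then 2 * (- 1) ^ n * (ccoeff j * (- 1) ^ j) else 0)"
    proof (intro sum.cong refl)
      fix j assume "j \<in> {..n div s}"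
      then have j: "s * j \<le> n" using s by (simp add: less_eq_div_iff_mult_less_eq mult.commute)
      then have "(n - s * j) mod s = n mod s"
        by (metis mod_mult_self2 le_add_diff_inverse2)
      moreover have "(- 1) ^ (n - s * j) = ((- 1) ^ n * (- 1) ^ j :: rat)"
        using j assms(1) by (auto simp: minus_one_power_iff)
      ultimately show "2 * ccoeff j * (- 1) ^ (n - s * j) * class_indicator s r (n - s * j) =
          (if n mod s = r then 2 * (- 1) ^ n * (ccoeff j * (- 1) ^ j) else 0)"
        by (simp add: class_indicator_def)
    qed
    also have "\<dots> = (if n mod s = r then 2 * (- 1) ^ n * (- 1) ^ (n div s) else 0)"
      by (simp add: sum_ccoeff_sign flip: sum_distrib_left)
    also have "\<dots> = (if n mod s = r then 2 * (- 1) ^ r else 0)"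
    proof -
      have "(- 1) ^ n * (- 1) ^ (n div s) = ((- 1) ^ (n mod s) :: rat)"
      proof -
        have "even n \<longleftrightarrow> even (s * (n div s) + n mod s)" by simp
        then have "even n \<longleftrightarrow> even (n div s + n mod s)" using assms(1) by (simp only: even_add even_mult_iff) simp
        then show ?thesis by (auto simp: minus_one_power_iff)
      qed
      then show ?thesis by simp
    qed
    finally show ?thesis .
  qed
  with conj_annihilator_Q_gen [OF s, of n "class_indicator s r" F] show ?thesis
    by (auto simp: eq_diff_eq)
qed

text \<open>
  On \<open>1\<close> only the multiples \<open>s * j \<ge> n\<close> contribute. Their indices \<open>s * j - n\<close> run through the residue
  class \<open>r\<close> of \<open>- n\<close>, and all have coefficient \<open>ccoeff j = 2\<close> as \<open>j > 0\<close>.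
\<close>

lemma conj_annihilator_1:
  assumes "0 < n" and "0 < s" and "s dvd n + r" and "r < s"
  shows "conj_annihilator s n 1 = fps_const 2 * (fps_X ^ n * Q_gen (class_indicator s r) 1)"
proof (rule fps_ext)
  fix d
  have le: "j \<le> d div s \<longleftrightarrow> s * j \<le> d" for j
    using assms by (simp add: less_eq_div_iff_mult_less_eq mult.commute)
  have "conj_annihilator s n 1 $ d = (\<Sum>j\<le>d div s. if d = s * j then
      const (ccoeff j) * Q_op (int (s * j) - int n) 1 else 0)"
    unfolding conj_annihilator_nth by (intro sum.cong refl) (auto simp: le)
  also have "\<dots> = (if s dvd d then const (ccoeff (d div s)) * Q_op (int d - int n) 1 else 0)"
  proof (cases "s dvd d")
    case True
    have "(\<Sum>j\<le>d div s. if d = s * j then const (ccoeff j) * Q_op (int (s * j) - int n) 1 else 0) =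
        (\<Sum>j\<le>d div s. if j = d div s then const (ccoeff j) * Q_op (int (s * j) - int n) 1 else 0)"
      using True assms(2) by (intro sum.cong refl) auto
    then show ?thesis using True by simp
  qed (auto intro!: sum.neutral)
  also have "\<dots> = (if n \<le> d \<and> s dvd d then const 2 * Q_op (int (d - n)) 1 else 0)"
    using assms by (auto simp: ccoeff_def Q_op_neg_1 of_nat_diff dvd_div_eq_0_iff)
  also have "\<dots> = (if n \<le> d \<and> (d - n) mod s = r then 2 * Q_op (int (d - n)) 1 else 0)"
  proof -
    have "s dvd d \<longleftrightarrow> (d - n) mod s = r" if "n \<le> d"
    proof -
      obtain e where e: "d = n + e" using \<open>n \<le> d\<close> by (auto simp: le_iff_add)
      have "s dvd n + e \<longleftrightarrow> e mod s = r mod s"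
      proof (cases "r \<le> e")
        case True
        then have "n + e = (n + r) + (e - r)" by simp
        then show ?thesis
          using assms(3) True by (metis dvd_add_right_iff mod_eq_dvd_iff_nat)
      next
        case False
        then have "n + r = (n + e) + (r - e)" by simp
        then show ?thesis
          using assms(3) False by (metis dvd_add_left_iff dvd_add_right_iff mod_eq_dvd_iff_nat nat_le_linear)
      qed
      then show ?thesis using assms(4) by (simp add: e)
    qed
    then show ?thesis by auto
  qed
  also have "\<dots> = (fps_const 2 * (fps_X ^ n * Q_gen (class_indicator s r) 1)) $ d"
  proof (cases "n \<le> d")
    case True
    have "(\<Sum>a\<le>d - n. const (class_indicator s r a) * Q_op (int a) (1 $ (d - n - a))) =
        (\<Sum>a\<le>d - n. if a = d - n then const (class_indicator s r a) * Q_op (int a) 1 else 0)"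
      by (intro sum.cong refl) auto
    then show ?thesis
      using True by (simp add: fps_X_power_mult_nth Q_gen_nth class_indicator_def)
  qed (simp add: fps_X_power_mult_nth)
  finally show "conj_annihilator s n 1 $ d =
      (fps_const 2 * (fps_X ^ n * Q_gen (class_indicator s r) 1)) $ d" .
qed

text \<open>
  The exponential of the product of the operators of the classes \<open>j\<close> and \<open>s - j\<close>, a product whose
  square is zero. Subsets of these factors
  will account for the classes in which a strip has one part more than \<open>mu\<close>.
\<close>

definition pair_factor :: "nat \<Rightarrow> nat \<Rightarrow> gamma fps \<Rightarrow> gamma fps"
  where "pair_factor s j F = F + Q_gen (class_indicator s j) (Q_gen (class_indicator s (s - j)) F)"

text \<open>
  The operator acts on \<open>1\<close> like \<open>2 * x ^ n\<close> times the operator of class \<open>r\<close>, and that term commutes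
  past the pairs of other classes. The pair containing \<open>r\<close> contributes the same term with the opposite
  sign by its anticommutator; the signs fit because the odd class stands on the left.
\<close>

lemma conj_annihilator_pairs:
  assumes "odd s" and "0 < n" and "s dvd n + r" and "r < s"
    and "distinct js" and "\<And>j. j \<in> set js \<Longrightarrow> odd j \<and> j < s"
  shows "conj_annihilator s n (foldr (pair_factor s) js 1) =
    (if r \<in> set js \<or> s - r \<in> set js then 0
     else fps_const 2 * (fps_X ^ n * Q_gen (class_indicator s r) (foldr (pair_factor s) js 1)))"
  using assms(5,6)
proof (induction js)
  case Nil
  then show ?case
    using conj_annihilator_1 [OF assms(2) odd_pos [OF assms(1)] assms(3,4)] by simp
next
  case (Cons j js)
  let ?e = "class_indicator s" and ?A = "conj_annihilator s n"
  define v where "v = foldr (pair_factor s) js 1"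
  have j: "odd j" "j < s" "0 < j" "even (s - j)" "0 < s - j" "s - j < s"
    using Cons.prems(2) [of j] assms(1) odd_pos [of j] by auto
  have notin: "s - j \<notin> set js" "j \<notin> set js"
    using Cons.prems(1) Cons.prems(2) [of "s - j"] j(4) by auto
  have e0: "?e j 0 = 0" "?e (s - j) 0 = 0"
    using j by (auto simp: class_indicator_0)
  have nmod: "n mod s = t \<longleftrightarrow> s - t = r" if "0 < t" "t < s" for t
  proof -
    show ?thesis
    proof
      assume "n mod s = t"
      then have "s dvd t + r" using assms(3) by (metis dvd_eq_mod_eq_0 mod_add_left_eq)
      then obtain k where k: "t + r = s * k" by (auto simp: dvd_def)
      moreover have "k = 1"
      proof -
        have "0 < s * k" "s * k < s * 2" using k that assms(4) by linarith+
        then have "0 < k" "k < 2" by (simp_all only: nat_0_less_mult_iff nat_mult_less_cancel1)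
        then show ?thesis by simp
      qed
      ultimately show "s - t = r" by simp
    next
      assume "s - t = r"
      then have r: "t + r = s" using that by simp
      obtain k where k: "n + r = s * k" using assms(3) by (auto simp: dvd_def)
      then have "0 < k" using assms(2) by (cases k) auto
      then have "n = s * (k - 1) + t" using k r by (cases k) (auto simp: algebra_simps)
      then show "n mod s = t" using that by simp
    qed
  qed
  have IH: "?A v = (if r \<in> set js \<or> s - r \<in> set js then 0
      else fps_const 2 * (fps_X ^ n * Q_gen (?e r) v))"
    unfolding v_def using Cons by simp
  have A: "?A (foldr (pair_factor s) (j # js) 1) =
      ?A v + ((if s - j = r then fps_const (const (- 2)) * (fps_X ^ n * Q_gen (?e (s - j)) v) else 0) -
      ((if j = r then fps_const (const 2) * (fps_X ^ n * Q_gen (?e j) v) else 0) -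
       Q_gen (?e j) (Q_gen (?e (s - j)) (?A v))))"
  proof -
    have *: "Q_gen (?e j) (if j = r then fps_const (const 2) * (fps_X ^ n * v) else 0) =
        (if j = r then fps_const (const 2) * (fps_X ^ n * Q_gen (?e j) v) else 0)"
      by (simp only: if_distrib [of "Q_gen (?e j)"] Q_gen_const_mult Q_gen_X_power_mult Q_gen_0)
    have nm: "n mod s = j \<longleftrightarrow> s - j = r" "n mod s = s - j \<longleftrightarrow> j = r"
      using nmod [of j] nmod [of "s - j"] j by auto
    have sg: "(- 1) ^ (s - j) = (1 :: rat)" "(- 1) ^ j = (- 1 :: rat)"
      using j by (auto simp: minus_one_power_iff)
    have "?A (Q_gen (?e (s - j)) v) =
        (if j = r then fps_const (const 2) * (fps_X ^ n * v) else 0) - Q_gen (?e (s - j)) (?A v)"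
      and "?A (Q_gen (?e j) G) =
        (if s - j = r then fps_const (const (- 2)) * (fps_X ^ n * G) else 0) - Q_gen (?e j) (?A G)" for G
      unfolding conj_annihilator_class [OF assms(1) j(6)] conj_annihilator_class [OF assms(1) j(2)]
        nm sg by simp_all
    then show ?thesis
      by (simp only: foldr.simps comp_apply pair_factor_def v_def [symmetric] conj_annihilator_add Q_gen_diff *)
  qed
  have swap: "Q_gen (?e j) (Q_gen (?e (s - j)) (Q_gen (?e r) v)) =
      Q_gen (?e r) (Q_gen (?e j) (Q_gen (?e (s - j)) v))"
    using e0 by (simp add: Q_gen_swap [of "?e (s - j)" "?e r"] Q_gen_swap [of "?e j" "?e r"] Q_gen_uminus)
  consider "s - j = r" | "j = r" | "s - j \<noteq> r" "j \<noteq> r" by blast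
  then show ?case
  proof cases
    case 1
    have "s - r = j" "r \<noteq> j" "r \<notin> set js" using 1 j notin by auto
    moreover have "Q_gen (?e j) (Q_gen (?e r) (Q_gen (?e r) v)) = 0"
      using Q_gen_square [of "?e r"] e0 1 by simp
    ultimately show ?thesis
      unfolding A IH using 1 notin
      by (simp add: const_uminus flip: fps_const_neg numeral_fps_const)
        (simp add: numeral_fps_const Q_gen_X_power_mult Q_gen_const_mult [of _ 2, simplified])
  next
    case 2
    have "s - j \<noteq> j"
    proof
      assume "s - j = j"
      then have "s = 2 * j" using j(2) by simp
      then show False using assms(1) by simp
    qed
    moreover have "Q_gen (?e r) (Q_gen (?e r) (Q_gen (?e (s - r)) v)) = 0"
      using Q_gen_square [of "?e r"] e0 2 by simp
    ultimately show ?thesis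
      unfolding A IH using 2 notin swap
      by (simp add: Q_gen_X_power_mult Q_gen_const_mult [of _ 2, simplified])
  next
    case 3
    then have "r \<noteq> j" "s - r \<noteq> j" using j assms(4) by auto
    then show ?thesis
      unfolding A IH using 3 swap
      by (simp add: Q_gen_X_power_mult Q_gen_const_mult [of _ 2, simplified] pair_factor_def
          v_def [symmetric] Q_gen_add distrib_left)
  qed
qed

definition odd_classes :: "nat \<Rightarrow> nat list"
  where "odd_classes s = filter odd [1..<s - 1]"

lemma in_set_odd_classes: "j \<in> set (odd_classes s) \<longleftrightarrow> odd j \<and> j < s - 1"
  by (auto simp: odd_classes_def intro: Suc_leI odd_pos)

lemma odd_classes_cover:
  assumes "odd s" and "0 < r" and "r < s"
  shows "r \<in> set (odd_classes s) \<or> s - r \<in> set (odd_classes s)"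
proof (cases "odd r")
  case True
  moreover have "r \<noteq> s - 1" using True assms by auto
  ultimately show ?thesis using assms by (auto simp: in_set_odd_classes)
next
  case False
  moreover have "r \<noteq> 1" using False by auto
  ultimately show ?thesis using assms by (auto simp: in_set_odd_classes)
qed

lemma distinct_odd_classes [simp]: "distinct (odd_classes s)"
  by (simp add: odd_classes_def)

lemma const_term_plethysm_p: "const_term (plethysm_p s f) = const_term f"
  by (induction f rule: gamma_induct)
    (simp_all add: plethysm_p_p plethysm_p_add plethysm_p_mult const_term_add const_term_mult)

lemma const_term_pairs:
  assumes "\<And>j. j \<in> set js \<Longrightarrow> 0 < j"
  shows "const_term (foldr (pair_factor s) js 1 $ d) = (if d = 0 then 1 else 0)"
  using assms
  by (induction js)
    (auto simp: pair_factor_def const_term_add const_term_Q_gen class_indicator_0 const_term_def [of 0])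

text \<open>
  Both sides are killed by the conjugated annihilators and have the same constant terms. On the right
  hand side let \<open>r\<close> be the class of \<open>- n\<close>. For \<open>r \<noteq> 0\<close> the product of the pairs is already killed; for
  \<open>r = 0\<close> the remaining term \<open>2 * x ^ n * Q_gen (class_indicator s 0)\<close> is cancelled by the
  anticommutator with the leading factor, which is an involution.
\<close>

theorem plethysm_series_factorization:
  assumes "odd s"
  shows "plethysm_series s =
    Q_gen (class_indicator s 0) (foldr (pair_factor s) (odd_classes s) 1)"
    (is "_ = ?F")
proof (rule conj_annihilator_kernel_unique [of s])
  show s: "0 < s" using assms by (rule odd_pos)
  fix n :: nat assume n: "0 < n"
  show "conj_annihilator s n (plethysm_series s) = 0"
    using assms n by (rule conj_annihilator_plethysm_series)
  define r where "r = (s - n mod s) mod s"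
  let ?v = "foldr (pair_factor s) (odd_classes s) 1"
  have r: "r < s" "s dvd n + r"
  proof -
    show "r < s" using s by (simp add: r_def)
    have "(n + r) mod s = (n mod s + (s - n mod s)) mod s"
      unfolding r_def by (simp only: mod_add_right_eq mod_add_left_eq)
    also have "\<dots> = 0" using s by simp
    finally show "s dvd n + r" by (simp add: dvd_eq_mod_eq_0)
  qed
  have n0: "n mod s = 0 \<longleftrightarrow> r = 0"
  proof (cases "n mod s = 0")
    case False
    then have "s - n mod s < s" using s by simp
    then have "r = s - n mod s" by (simp add: r_def)
    then show ?thesis using False mod_less_divisor [OF s, of n] by linarith
  qed (simp add: r_def)
  have v: "conj_annihilator s n ?v =
      (if r = 0 then fps_const 2 * (fps_X ^ n * Q_gen (class_indicator s 0) ?v) else 0)"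
  proof (subst conj_annihilator_pairs [OF assms n r(2,1)])
    show "odd j \<and> j < s" if "j \<in> set (odd_classes s)" for j
      using that by (auto simp: in_set_odd_classes)
    have "r \<in> set (odd_classes s) \<or> s - r \<in> set (odd_classes s) \<longleftrightarrow> r \<noteq> 0"
    proof
      assume "r \<noteq> 0"
      then show "r \<in> set (odd_classes s) \<or> s - r \<in> set (odd_classes s)"
        using odd_classes_cover [OF assms _ r(1)] by simp
    next
      assume "r \<in> set (odd_classes s) \<or> s - r \<in> set (odd_classes s)"
      then show "r \<noteq> 0"
        using assms by (cases "r = 0") (simp_all add: in_set_odd_classes)
    qed
    then show "(if r \<in> set (odd_classes s) \<or> s - r \<in> set (odd_classes s) then 0
        else fps_const 2 * (fps_X ^ n * Q_gen (class_indicator s r) ?v)) =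
      (if r = 0 then fps_const 2 * (fps_X ^ n * Q_gen (class_indicator s 0) ?v) else 0)"
      by auto
  qed simp
  show "conj_annihilator s n ?F = 0"
  proof (cases "r = 0")
    case True
    have "Q_gen (class_indicator s 0) (Q_gen (class_indicator s 0) ?v) = ?v"
      by (rule Q_gen_involution) (simp add: class_indicator_0)
    then show ?thesis
      using True n0 s by (simp add: conj_annihilator_class [OF assms] v Q_gen_X_power_mult
          Q_gen_const_mult [of _ 2, simplified])
  next
    case False
    then show ?thesis
      using n0 s by (simp add: conj_annihilator_class [OF assms] v)
  qed
next
  fix d
  have "const_term (plethysm_q s k) = (if k = 0 then 1 else 0)" for k
    by (simp add: plethysm_q_def const_term_plethysm_p const_term_q)
  then have "const_term (plethysm_series s $ d) = (if d = 0 then 1 else 0)"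
    by (auto simp: plethysm_series_def dvd_div_eq_0_iff const_term_def [of 0])
  moreover have "const_term (?F $ d) = (if d = 0 then 1 else 0)"
    by (subst const_term_Q_gen, subst const_term_pairs)
      (auto simp: in_set_odd_classes class_indicator_0 intro: odd_pos)
  ultimately show "const_term (plethysm_series s $ d) = const_term (?F $ d)"
    by simp
qed


section \<open>Multiplication by the plethysm series\<close>

text \<open>
  The weights of \<open>(1 + u) / (1 - u)\<close> with \<open>u = x ^ s\<close>, placed along the numbers \<open>m\<close>, \<open>m + s\<close>,
  \<open>m + 2 * s\<close> and so on.
\<close>

definition ladder_weight :: "nat \<Rightarrow> nat \<Rightarrow> nat \<Rightarrow> rat"
  where "ladder_weight s m a = (if m \<le> a \<and> s dvd a - m then ccoeff ((a - m) div s) else 0)"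

definition point_weight :: "nat \<Rightarrow> nat \<Rightarrow> rat"
  where "point_weight m a = (if a = m then 1 else 0)"

lemma Q_gen_point_weight_nth:
  "Q_gen (point_weight m) F $ d = (if m \<le> d then Q_op (int m) (F $ (d - m)) else 0)"
proof -
  have "(\<Sum>a\<le>d. const (point_weight m a) * Q_op (int a) (F $ (d - a))) =
      (\<Sum>a\<le>d. if a = m then Q_op (int m) (F $ (d - m)) else 0)"
    by (intro sum.cong refl) (simp add: point_weight_def)
  then show ?thesis by (simp add: Q_gen_nth)
qed

lemma plethysm_series_mult_nth:
  assumes "0 < s"
  shows "(plethysm_series s * F) $ d = (\<Sum>l\<le>d div s. plethysm_q s l * F $ (d - s * l))"
proof -
  have "(plethysm_series s * F) $ d =
      (\<Sum>i\<le>d. if s dvd i then plethysm_q s (i div s) * F $ (d - i) else 0)"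
    unfolding fps_mult_nth atLeast0AtMost
    by (intro sum.cong refl) (simp add: plethysm_series_def)
  then show ?thesis
    using assms by (simp add: sum_multiples)
qed

text \<open>
  This is \<open>plethysm_q_mult_Q_op\<close> summed over all \<open>k\<close>. It moves the series to the right through a
  product of operators, until it meets \<open>1\<close>.
\<close>

lemma plethysm_series_mult_Q_gen:
  assumes "odd s"
  shows "plethysm_series s * Q_gen (point_weight m) F =
    Q_gen (ladder_weight s m) (plethysm_series s * F)"
proof (rule fps_ext)
  fix d
  have s: "0 < s" using assms by (rule odd_pos)
  have le: "j \<le> e div s \<longleftrightarrow> s * j \<le> e" for j e
    using s by (simp add: less_eq_div_iff_mult_less_eq mult.commute)
  show "(plethysm_series s * Q_gen (point_weight m) F) $ d =
      Q_gen (ladder_weight s m) (plethysm_series s * F) $ d"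
  proof (cases "m \<le> d")
    case False
    then show ?thesis
      by (auto simp: Q_gen_nth [of "ladder_weight s m"] fps_mult_nth Q_gen_point_weight_nth ladder_weight_def intro!: sum.neutral)
  next
    case True
    define D where "D = d - m"
    let ?K = "D div s"
    have "(plethysm_series s * Q_gen (point_weight m) F) $ d =
        (\<Sum>k\<le>?K. plethysm_q s k * Q_op (int m) (F $ (D - s * k)))"
      unfolding plethysm_series_mult_nth [OF s] Q_gen_point_weight_nth
    proof (rule sum.mono_neutral_cong_right)
      show "{..?K} \<subseteq> {..d div s}" by (simp add: D_def div_le_mono)
      show "\<forall>i\<in>{..d div s} - {..?K}. plethysm_q s i *
          (if m \<le> d - s * i then Q_op (int m) (F $ (d - s * i - m)) else 0) = 0"
      proof
        fix i assume "i \<in> {..d div s} - {..?K}"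
        then have "s * i \<le> d" "\<not> s * i \<le> D" by (simp_all add: le)
        then have "\<not> m \<le> d - s * i" unfolding D_def using True by linarith
        then show "plethysm_q s i *
            (if m \<le> d - s * i then Q_op (int m) (F $ (d - s * i - m)) else 0) = 0" by simp
      qed
      fix i assume "i \<in> {..?K}"
      then have "s * i \<le> D" by (simp add: le)
      then have "m \<le> d - s * i" "d - s * i - m = D - s * i" unfolding D_def using True by linarith+
      then show "plethysm_q s i * (if m \<le> d - s * i then Q_op (int m) (F $ (d - s * i - m)) else 0) =
          plethysm_q s i * Q_op (int m) (F $ (D - s * i))" by simp
    qed simp
    also have "\<dots> = (\<Sum>k\<le>?K. \<Sum>j\<le>k. const (ccoeff j) *
        Q_op (int m + int (s * j)) (plethysm_q s (k - j) * F $ (D - s * k)))"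
      by (simp only: plethysm_q_mult_Q_op [OF assms])
    also have "\<dots> = (\<Sum>k\<le>?K. \<Sum>j\<le>k. const (ccoeff j) *
        Q_op (int m + int (s * j)) (plethysm_q s (k - j) * F $ (D - s * j - s * (k - j))))"
    proof (rule sum.cong [OF refl], rule sum.cong [OF refl])
      fix k j :: nat assume "j \<in> {..k}"
      then have "s * j + s * (k - j) = s * k"
        by (simp flip: distrib_left)
      then show "const (ccoeff j) * Q_op (int m + int (s * j)) (plethysm_q s (k - j) * F $ (D - s * k)) =
          const (ccoeff j) * Q_op (int m + int (s * j)) (plethysm_q s (k - j) * F $ (D - s * j - s * (k - j)))"
        by (simp only: diff_diff_left)
    qed
    also have "\<dots> = (\<Sum>j\<le>?K. \<Sum>l\<le>?K - j. const (ccoeff j) *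
        Q_op (int m + int (s * j)) (plethysm_q s l * F $ (D - s * j - s * l)))"
      by (rule sum_nested_diagonal [symmetric])
    also have "\<dots> = (\<Sum>j\<le>?K. const (ccoeff j) *
        Q_op (int m + int (s * j)) ((plethysm_series s * F) $ (D - s * j)))"
    proof (rule sum.cong [OF refl])
      fix j assume "j \<in> {..?K}"
      then have "s * j \<le> D" by (simp add: le)
      then obtain e where e: "D = s * j + e" by (auto simp: le_iff_add)
      then have "(D - s * j) div s = ?K - j" using s by simp
      then show "(\<Sum>l\<le>?K - j. const (ccoeff j) *
          Q_op (int m + int (s * j)) (plethysm_q s l * F $ (D - s * j - s * l))) =
        const (ccoeff j) * Q_op (int m + int (s * j)) ((plethysm_series s * F) $ (D - s * j))"
        by (simp add: plethysm_series_mult_nth [OF s] Q_op_sum sum_distrib_left)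
    qed
    also have "\<dots> = (\<Sum>i\<le>D. if s dvd i then const (ccoeff (i div s)) *
        Q_op (int m + int i) ((plethysm_series s * F) $ (D - i)) else 0)"
      using s by (simp add: sum_multiples)
    also have "\<dots> = (\<Sum>a\<in>{m..d}. const (ladder_weight s m a) *
        Q_op (int a) ((plethysm_series s * F) $ (d - a)))"
      by (rule sum.reindex_bij_witness [of _ "\<lambda>a. a - m" "\<lambda>i. i + m"])
        (use True in \<open>auto simp: D_def ladder_weight_def add.commute\<close>)
    also have "\<dots> = Q_gen (ladder_weight s m) (plethysm_series s * F) $ d"
      unfolding Q_gen_nth by (rule sum.mono_neutral_left) (auto simp: ladder_weight_def)
    finally show ?thesis .
  qed
qed

lemma plethysm_series_mult_word:
  assumes "odd s"
  shows "plethysm_series s * foldr Q_gen (map point_weight mu) F =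
    foldr Q_gen (map (ladder_weight s) mu) (plethysm_series s * F)"
  by (induction mu) (simp_all add: plethysm_series_mult_Q_gen [OF assms])

lemma schur_Q_Cons [simp]: "schur_Q (m # mu) = Q_op (int m) (schur_Q mu)"
  by (simp add: schur_Q_def)

lemma schur_Q_Nil [simp]: "schur_Q [] = 1"
  by (simp add: schur_Q_def)

lemma point_weight_word_nth:
  "foldr Q_gen (map point_weight mu) 1 $ d = (if d = sum_list mu then schur_Q mu else 0)"
proof (induction mu arbitrary: d)
  case (Cons m mu)
  have "d - m = sum_list mu \<longleftrightarrow> d = m + sum_list mu" if "m \<le> d"
    using that by auto
  then show ?case
    by (auto simp: Q_gen_point_weight_nth Cons)
qed simp

lemma plethysm_mult_schur_Q:
  assumes "odd s"
  shows "plethysm_p s (q k) * schur_Q mu =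
    foldr Q_gen (map (ladder_weight s) mu) (plethysm_series s) $ (sum_list mu + s * k)"
proof -
  have s: "0 < s" using assms by (rule odd_pos)
  let ?d = "sum_list mu + s * k"
  have "foldr Q_gen (map (ladder_weight s) mu) (plethysm_series s) $ ?d =
      (plethysm_series s * foldr Q_gen (map point_weight mu) 1) $ ?d"
    by (simp add: plethysm_series_mult_word [OF assms])
  also have "\<dots> = (\<Sum>i\<le>?d. if i = s * k then plethysm_q s k * schur_Q mu else 0)"
    unfolding fps_mult_nth atLeast0AtMost
  proof (rule sum.cong [OF refl])
    fix i assume "i \<in> {..?d}"
    then have "?d - i = sum_list mu \<longleftrightarrow> i = s * k" by auto
    then show "plethysm_series s $ i * foldr Q_gen (map point_weight mu) 1 $ (?d - i) =
        (if i = s * k then plethysm_q s k * schur_Q mu else 0)"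
      using s by (simp add: point_weight_word_nth plethysm_series_def)
  qed
  also have "\<dots> = plethysm_q s k * schur_Q mu" by simp
  finally show ?thesis by (simp add: plethysm_q_def)
qed

definition class_pairs :: "nat \<Rightarrow> nat list \<Rightarrow> nat list"
  where "class_pairs s js = concat (map (\<lambda>j. [j, s - j]) js)"

lemma class_pairs_simps [simp]:
  "class_pairs s [] = []" "class_pairs s (j # js) = j # (s - j) # class_pairs s js"
  by (simp_all add: class_pairs_def)

lemma pair_factors_expand:
  assumes "distinct js"
  shows "foldr (pair_factor s) js 1 = (\<Sum>S\<in>Pow (set js).
    foldr Q_gen (map (class_indicator s) (class_pairs s (filter (\<lambda>j. j \<in> S) js))) 1)"
  using assms
proof (induction js)
  case (Cons j js)
  let ?w = "\<lambda>S js. foldr Q_gen (map (class_indicator s) (class_pairs s (filter (\<lambda>j. j \<in> S) js))) 1"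
  have j: "j \<notin> set js" using Cons.prems by simp
  have "(\<Sum>S\<in>Pow (set (j # js)). ?w S (j # js)) =
      (\<Sum>S\<in>Pow (set js). ?w S (j # js)) + (\<Sum>S\<in>insert j ` Pow (set js). ?w S (j # js))"
    unfolding list.set Pow_insert by (rule sum.union_disjoint) (use j in auto)
  also have "(\<Sum>S\<in>Pow (set js). ?w S (j # js)) = (\<Sum>S\<in>Pow (set js). ?w S js)"
    by (intro sum.cong refl) (use j in auto)
  also have "(\<Sum>S\<in>insert j ` Pow (set js). ?w S (j # js)) =
      (\<Sum>S\<in>Pow (set js). ?w (insert j S) (j # js))"
  proof (rule sum.reindex [unfolded comp_def])
    show "inj_on (insert j) (Pow (set js))"
    proof (rule inj_onI)
      fix A B assume "A \<in> Pow (set js)" "B \<in> Pow (set js)" "insert j A = insert j B"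
      then show "A = B" using j by (metis PowD insert_ident subsetD)
    qed
  qed
  also have "\<dots> = (\<Sum>S\<in>Pow (set js).
      Q_gen (class_indicator s j) (Q_gen (class_indicator s (s - j)) (?w S js)))"
  proof (rule sum.cong [OF refl])
    fix S
    have "filter (\<lambda>i. i \<in> insert j S) js = filter (\<lambda>i. i \<in> S) js"
      using j by (intro filter_cong) auto
    then show "?w (insert j S) (j # js) =
        Q_gen (class_indicator s j) (Q_gen (class_indicator s (s - j)) (?w S js))"
      by simp
  qed
  finally show ?case
    using Cons by (simp add: pair_factor_def Q_gen_sum)
qed simp

lemma foldr_Q_gen_sum:
  "foldr Q_gen ws (\<Sum>i\<in>A. F i) = (\<Sum>i\<in>A. foldr Q_gen ws (F i))"
  by (induction ws) (simp_all add: Q_gen_sum)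


section \<open>Truncating the weights\<close>

lemma foldr_Q_gen_0 [simp]: "foldr Q_gen ws 0 = 0"
  by (induction ws) simp_all

lemma Q_gen_move:
  assumes "w 0 = 0"
  shows "Q_gen w (foldr Q_gen ws F) = fps_const (const ((- 1) ^ length ws)) * foldr Q_gen ws (Q_gen w F)"
proof (induction ws)
  case (Cons v ws)
  have "Q_gen w (foldr Q_gen (v # ws) F) = - Q_gen v (Q_gen w (foldr Q_gen ws F))"
    using Q_gen_swap [of w v] assms by simp
  then show ?case
    by (simp add: Cons Q_gen_const_mult const_uminus flip: fps_const_neg)
qed simp

text \<open>
  The operator of weight \<open>u\<close> can be moved to the left by anticommutation up to its second occurrence,
  and its square is zero.
\<close>

lemma foldr_Q_gen_repeat:
  assumes "u 0 = 0" and "u \<in> set A"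
  shows "foldr Q_gen A (Q_gen u F) = 0"
proof -
  obtain B C where A: "A = B @ u # C" using assms(2) by (meson split_list)
  have "Q_gen u (foldr Q_gen C (Q_gen u F)) = 0"
    using assms(1) by (simp add: Q_gen_move Q_gen_square)
  then show ?thesis by (simp add: A)
qed

lemma foldr_Q_gen_reduce:
  assumes "u 0 = 0" and "u \<in> set A"
  shows "foldr Q_gen A (Q_gen (\<lambda>a. v a + c * u a) F) = foldr Q_gen A (Q_gen v F)"
proof -
  have add: "foldr Q_gen A (G + H) = foldr Q_gen A G + foldr Q_gen A H" for G H
    by (induction A) (simp_all add: Q_gen_add)
  have scale: "foldr Q_gen A (fps_const (const c) * G) = fps_const (const c) * foldr Q_gen A G" for G
    by (induction A) (simp_all add: Q_gen_const_mult)
  show ?thesis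
    by (simp add: Q_gen_weight_add add scale foldr_Q_gen_repeat [OF assms])
qed

text \<open>
  To the left of the operator with weight \<open>w\<close> stands the one for \<open>m = last ms\<close>, the smallest part
  in the same residue class that precedes. In both uses, the weights \<open>w\<close> and
  \<open>c * ladder_weight s m\<close> agree beyond \<open>m\<close>, so that after the subtraction only entries up to \<open>m\<close> remain; this produces the interlacing
  condition of a horizontal strip.
\<close>

definition cut_weight :: "nat \<Rightarrow> rat \<Rightarrow> nat list \<Rightarrow> nat \<Rightarrow> (nat \<Rightarrow> rat) \<Rightarrow> nat \<Rightarrow> rat"
  where "cut_weight s c M r w a =
    (let ms = residue_parts s r M in if ms = [] then w a else w a - c * ladder_weight s (last ms) a)"

text \<open>
  The argument \<open>M\<close> collects the parts already passed, which stand to the left in the product.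
\<close>

fun row_weights :: "nat \<Rightarrow> nat list \<Rightarrow> nat list \<Rightarrow> (nat \<Rightarrow> rat) list"
  where
    "row_weights s M [] = []"
  | "row_weights s M (m # ms) =
      cut_weight s 1 M (m mod s) (ladder_weight s m) # row_weights s (M @ [m]) ms"

text \<open>
  The coefficient is \<open>1 / 2\<close> because the indicator is \<open>1\<close> where the ladder is \<open>2\<close>.
\<close>

definition extra_weight :: "nat \<Rightarrow> nat list \<Rightarrow> nat \<Rightarrow> nat \<Rightarrow> rat"
  where "extra_weight s mu r = cut_weight s (1 / 2) mu r (class_indicator s r)"

lemma row_weights_append:
  "row_weights s M (xs @ ys) = row_weights s M xs @ row_weights s (M @ xs) ys"
  by (induction xs arbitrary: M) simp_all

lemma length_row_weights [simp]: "length (row_weights s M ms) = length ms"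
  by (induction ms arbitrary: M) simp_all

lemma foldr_Q_gen_cut:
  assumes "\<And>m. m \<in> set M \<Longrightarrow> 0 < m" and "ladder_weight s ` set M \<subseteq> set A"
  shows "foldr Q_gen A (Q_gen w F) = foldr Q_gen A (Q_gen (cut_weight s c M r w) F)"
proof (cases "residue_parts s r M = []")
  case True
  then have "cut_weight s c M r w = w" by (simp add: cut_weight_def fun_eq_iff)
  then show ?thesis by simp
next
  case False
  define m where "m = last (residue_parts s r M)"
  have m: "m \<in> set M"
    using last_in_set [OF False] by (auto simp: m_def residue_parts_def)
  have w: "(\<lambda>a. cut_weight s c M r w a + c * ladder_weight s m a) = w"
    using False by (auto simp: cut_weight_def m_def)
  have "ladder_weight s m 0 = 0" "ladder_weight s m \<in> set A"
    using assms(1) [OF m] assms(2) m by (auto simp: ladder_weight_def)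
  then have "foldr Q_gen A (Q_gen (\<lambda>a. cut_weight s c M r w a + c * ladder_weight s m a) F) =
      foldr Q_gen A (Q_gen (cut_weight s c M r w) F)"
    by (rule foldr_Q_gen_reduce)
  then show ?thesis by (simp only: w)
qed

lemma foldr_Q_gen_extra_weights:
  assumes "\<And>m. m \<in> set mu \<Longrightarrow> 0 < m" and "ladder_weight s ` set mu \<subseteq> set A"
  shows "foldr Q_gen (A @ map (class_indicator s) rs) F = foldr Q_gen (A @ map (extra_weight s mu) rs) F"
  using assms(2)
proof (induction rs arbitrary: A)
  case (Cons r rs)
  have "foldr Q_gen (A @ map (class_indicator s) (r # rs)) F =
      foldr Q_gen A (Q_gen (extra_weight s mu r) (foldr Q_gen (map (class_indicator s) rs) F))"
    using foldr_Q_gen_cut [OF assms(1) Cons.prems] by (simp add: extra_weight_def)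
  also have "\<dots> = foldr Q_gen ((A @ [extra_weight s mu r]) @ map (class_indicator s) rs) F"
    by simp
  also have "\<dots> = foldr Q_gen ((A @ [extra_weight s mu r]) @ map (extra_weight s mu) rs) F"
    by (rule Cons.IH) (use Cons.prems in auto)
  finally show ?case by simp
qed simp

text \<open>
  The cuts are made from right to left, so that the ladders needed for a cut are still present.
\<close>

lemma foldr_Q_gen_row_weights:
  assumes "\<And>m. m \<in> set mu \<Longrightarrow> 0 < m"
  shows "foldr Q_gen (map (ladder_weight s) mu) F = foldr Q_gen (row_weights s [] mu) F"
  using assms
proof (induction mu arbitrary: F rule: rev_induct)
  case (snoc m mu)
  have "foldr Q_gen (map (ladder_weight s) (mu @ [m])) F =
      foldr Q_gen (map (ladder_weight s) mu) (Q_gen (cut_weight s 1 mu (m mod s) (ladder_weight s m)) F)"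
    using foldr_Q_gen_cut [of mu s "map (ladder_weight s) mu"] snoc.prems by simp
  also have "\<dots> = foldr Q_gen (row_weights s [] mu) (Q_gen (cut_weight s 1 mu (m mod s) (ladder_weight s m)) F)"
    by (rule snoc.IH) (use snoc.prems in auto)
  finally show ?case by (simp add: row_weights_append)
qed simp

definition word_weight :: "(nat \<Rightarrow> rat) list \<Rightarrow> nat list \<Rightarrow> rat"
  where "word_weight ws as = prod_list (map2 (\<lambda>w a. w a) ws as)"

lemma word_weight_simps [simp]:
  "word_weight [] as = 1" "word_weight (w # ws) (a # as) = w a * word_weight ws as"
  by (simp_all add: word_weight_def)

lemma finite_lists_sum: "finite {as :: nat list. length as = n \<and> sum_list as = d}"
  by (rule finite_subset [OF _ finite_lists_length_eq [of "{..d}" n]])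
    (auto intro: member_le_sum_list)

lemma foldr_Q_gen_nth:
  "foldr Q_gen ws 1 $ d =
    (\<Sum>as | length as = length ws \<and> sum_list as = d. const (word_weight ws as) * schur_Q as)"
proof (induction ws arbitrary: d)
  case Nil
  have "{as :: nat list. length as = 0 \<and> sum_list as = d} = (if d = 0 then {[]} else {})"
    by auto
  then show ?case by simp
next
  case (Cons w ws)
  let ?L = "\<lambda>d. {as :: nat list. length as = length ws \<and> sum_list as = d}"
  have "foldr Q_gen (w # ws) 1 $ d = (\<Sum>a\<le>d. \<Sum>as\<in>?L (d - a).
      const (word_weight (w # ws) (a # as)) * schur_Q (a # as))"
    by (simp add: Q_gen_nth Cons Q_op_sum Q_op_const_mult sum_distrib_left const_mult mult.assoc)
  also have "\<dots> = (\<Sum>(a, as)\<in>(SIGMA a:{..d}. ?L (d - a)).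
      const (word_weight (w # ws) (a # as)) * schur_Q (a # as))"
    by (subst sum.Sigma) (auto intro: finite_lists_sum)
  also have "\<dots> = (\<Sum>as | length as = length (w # ws) \<and> sum_list as = d.
      const (word_weight (w # ws) as) * schur_Q as)"
    by (rule sum.reindex_bij_witness [of _ "\<lambda>as. (hd as, tl as)" "\<lambda>(a, as). a # as"])
      (auto simp: length_Suc_conv)
  finally show ?case .
qed

text \<open>
  This will be used with \<open>classes = 0 # excess_classes s S\<close>. The entry for the leading \<open>0\<close> is the
  part matched with an appended zero if there is one, and is itself \<open>0\<close> otherwise.
\<close>

definition strip_weights :: "nat \<Rightarrow> nat list \<Rightarrow> nat list \<Rightarrow> (nat \<Rightarrow> rat) list"
  where "strip_weights s mu classes = row_weights s [] mu @ map (extra_weight s mu) classes"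

definition excess_classes :: "nat \<Rightarrow> nat set \<Rightarrow> nat list"
  where "excess_classes s S = class_pairs s (filter (\<lambda>j. j \<in> S) (odd_classes s))"

text \<open>
  Apart from those with repeated entries, the words \<open>as\<close> of nonzero weight will turn out to be the
  lists of the parts of the strips in the order of the reordering, with a zero inserted if needed.
\<close>

theorem plethysm_mult_schur_Q_expansion:
  assumes "odd s" and "\<And>m. m \<in> set mu \<Longrightarrow> 0 < m"
  shows "plethysm_p s (q k) * schur_Q mu =
    (\<Sum>S\<in>Pow (set (odd_classes s)).
      \<Sum>as | length as = length (strip_weights s mu (0 # excess_classes s S)) \<and>
          sum_list as = sum_list mu + s * k.
        const (word_weight (strip_weights s mu (0 # excess_classes s S)) as) * schur_Q as)"
proof -
  have "foldr Q_gen (map (ladder_weight s) mu) (plethysm_series s) =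
      (\<Sum>S\<in>Pow (set (odd_classes s)). foldr Q_gen (strip_weights s mu (0 # excess_classes s S)) 1)"
  proof -
    have "plethysm_series s = (\<Sum>S\<in>Pow (set (odd_classes s)).
        foldr Q_gen (map (class_indicator s) (0 # excess_classes s S)) 1)"
      unfolding plethysm_series_factorization [OF assms(1)] excess_classes_def
      by (simp add: pair_factors_expand Q_gen_sum)
    then have "foldr Q_gen (map (ladder_weight s) mu) (plethysm_series s) =
        (\<Sum>S\<in>Pow (set (odd_classes s)).
          foldr Q_gen (map (ladder_weight s) mu @ map (class_indicator s) (0 # excess_classes s S)) 1)"
      by (simp add: foldr_Q_gen_sum)
    also have "\<dots> = (\<Sum>S\<in>Pow (set (odd_classes s)).
        foldr Q_gen (strip_weights s mu (0 # excess_classes s S)) 1)"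
      unfolding strip_weights_def
      by (subst foldr_Q_gen_extra_weights [OF assms(2)])
        (simp_all only: foldr_append foldr_Q_gen_row_weights [OF assms(2)], simp)
    finally show ?thesis .
  qed
  then show ?thesis
    by (simp only: plethysm_mult_schur_Q [OF assms(1)] fps_sum_nth foldr_Q_gen_nth)
qed


section \<open>Alternating behaviour\<close>

abbreviation Q_word :: "nat list \<Rightarrow> gamma \<Rightarrow> gamma"
  where "Q_word as \<equiv> foldr (\<lambda>m. Q_op (int m)) as"

lemma Q_op_swap: "0 < m + n \<Longrightarrow> Q_op m (Q_op n f) = - Q_op n (Q_op m f)"
  using Q_op_anticommute [of m n f] by (simp add: eq_neg_iff_add_eq_0)

lemma Q_op_square: "0 < m \<Longrightarrow> Q_op m (Q_op m f) = 0"
  using Q_op_anticommute [of m m f] by (simp flip: mult_2)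

lemma Q_word_uminus: "Q_word as (- f) = - Q_word as f"
  by (induction as) (simp_all add: Q_op_uminus)

lemma Q_word_0 [simp]: "Q_word as 0 = 0"
  by (induction as) simp_all

lemma Q_op_move:
  assumes "\<And>a. a \<in> set as \<Longrightarrow> 0 < m + int a"
  shows "Q_op m (Q_word as f) = const ((- 1) ^ length as) * Q_word as (Q_op m f)"
  using assms
proof (induction as)
  case (Cons a as)
  then have "Q_op m (Q_word (a # as) f) = - Q_op (int a) (Q_op m (Q_word as f))"
    using Q_op_swap [of m "int a"] by simp
  then show ?case
    using Cons by (simp add: Q_op_const_mult const_uminus)
qed simp

lemma schur_Q_append: "schur_Q (as @ bs) = Q_word as (schur_Q bs)"
  by (simp add: schur_Q_def)

lemma schur_Q_repeat:
  assumes "0 < m"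
  shows "schur_Q (A @ m # B @ m # C) = 0"
proof -
  have "Q_op (int m) (Q_word B (Q_op (int m) (schur_Q C))) = 0"
    using assms by (simp add: Q_op_move Q_op_square)
  then show ?thesis by (simp add: schur_Q_append)
qed

lemma schur_Q_not_distinct:
  assumes "\<not> distinct as" and "\<And>a. a \<in> set as \<Longrightarrow> 0 < a"
  shows "schur_Q as = 0"
proof -
  obtain A m B C where "as = A @ [m] @ B @ [m] @ C"
    using not_distinct_decomp [OF assms(1)] by blast
  then show ?thesis
    using schur_Q_repeat [of m A B C] assms(2) by simp
qed

lemma schur_Q_swap:
  assumes "0 < u" and "0 < v"
  shows "schur_Q (A @ v # B @ u # C) = - schur_Q (A @ u # B @ v # C)"
proof -
  let ?f = "schur_Q C" and ?c = "const ((- 1) ^ length B)"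
  have "Q_op (int v) (Q_word B (Q_op (int u) ?f)) = ?c * Q_word B (Q_op (int v) (Q_op (int u) ?f))"
    by (rule Q_op_move) (use assms in simp)
  also have "\<dots> = - (?c * Q_word B (Q_op (int u) (Q_op (int v) ?f)))"
    using assms by (simp add: Q_op_swap [of "int v" "int u"] Q_word_uminus)
  also have "?c * Q_word B (Q_op (int u) (Q_op (int v) ?f)) = Q_op (int u) (Q_word B (Q_op (int v) ?f))"
    by (rule Q_op_move [symmetric]) (use assms in simp)
  finally show ?thesis
    by (simp add: schur_Q_append Q_word_uminus)
qed

text \<open>
  \<open>Q_op 0\<close> passes through an even number of operators without a sign and fixes \<open>1\<close>.
\<close>

lemma schur_Q_remove_0:
  assumes "even (length B)" and "\<And>b. b \<in> set B \<Longrightarrow> 0 < b"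
  shows "schur_Q (A @ 0 # B) = schur_Q (A @ B)"
proof -
  have "Q_op 0 (Q_word B 1) = const ((- 1) ^ length B) * Q_word B (Q_op 0 1)"
    by (rule Q_op_move) (use assms in simp)
  then have "Q_op 0 (schur_Q B) = schur_Q B"
    using assms(1) by (simp add: schur_Q_def)
  then show ?thesis by (simp add: schur_Q_append)
qed

text \<open>
  Induction over transpositions, each of which changes the sign by \<open>schur_Q_swap\<close>.
\<close>

lemma schur_Q_permute_list:
  assumes "\<sigma> permutes {..<length as}" and "\<And>a. a \<in> set as \<Longrightarrow> 0 < a"
  shows "schur_Q (permute_list \<sigma> as) = const (of_int (sign \<sigma>)) * schur_Q as"
  using finite_lessThan assms(1)
proof (induction rule: permutes_rev_induct)
  case id
  then show ?case by simp
next
  case (swap a b p)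
  define ys where "ys = permute_list p as"
  have ys: "length ys = length as" "\<And>y. y \<in> set ys \<Longrightarrow> 0 < y"
    using assms(2) by (simp_all add: ys_def set_permute_list [OF swap(4)])
  have transp: "transpose a b permutes {..<length as}"
    using swap(1,2) by (rule permutes_swap_id)
  have "schur_Q (permute_list (transpose i j) ys) = - schur_Q ys" if "i < j" "j < length ys" for i j
  proof -
    define A B C where "A = take i ys" and "B = take (j - Suc i) (drop (Suc i) ys)" and "C = drop (Suc j) ys"
    have split: "ys = A @ ys ! i # B @ ys ! j # C"
    proof -
      have "drop (Suc i) ys = B @ drop (j - Suc i) (drop (Suc i) ys)"
        by (simp add: B_def del: drop_drop)
      also have "drop (j - Suc i) (drop (Suc i) ys) = drop j ys"
        using that by simp
      also have "drop j ys = ys ! j # C"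
        unfolding C_def using that by (simp add: Cons_nth_drop_Suc)
      finally have "drop (Suc i) ys = B @ ys ! j # C" .
      then show ?thesis
        unfolding A_def using that by (metis id_take_nth_drop less_trans)
    qed
    have len: "length A = i" "length B = j - Suc i"
      using that by (simp_all add: A_def B_def)
    have "permute_list (transpose i j) ys = A @ ys ! j # B @ ys ! i # C"
    proof (rule nth_equalityI)
      show "length (permute_list (transpose i j) ys) = length (A @ ys ! j # B @ ys ! i # C)"
        using arg_cong [OF split, of length] by simp
      fix n assume n: "n < length (permute_list (transpose i j) ys)"
      have perm: "transpose i j permutes {..<length ys}"
        using that by (intro permutes_swap_id) auto
      have "permute_list (transpose i j) ys ! n = ys ! transpose i j n"
        using n by (intro permute_list_nth [OF perm]) simp
      also have "\<dots> = (A @ ys ! j # B @ ys ! i # C) ! n"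
      proof -
        consider "n < i" | "n = i" | "i < n" "n < j" | "n = j" | "j < n" by linarith
        then show ?thesis
        proof cases
          case 1
          then have "ys ! n = A ! n" by (subst split) (simp add: nth_append len)
          then show ?thesis using 1 that by (simp add: nth_append len transpose_def)
        next
          case 2
          then show ?thesis by (simp add: nth_append len)
        next
          case 3
          then have "n - Suc i < j - Suc i" by linarith
          moreover from this have "ys ! n = B ! (n - Suc i)"
            by (subst split) (use 3 in \<open>simp add: nth_append len nth_Cons'\<close>)
          ultimately show ?thesis using 3 by (simp add: nth_append len nth_Cons' transpose_def)
        next
          case 4
          then show ?thesis using that by (simp add: nth_append len nth_Cons')
        next
          case 5
          then obtain e f where ef: "n = Suc (j + e)" "j = Suc (i + f)"
            using \<open>i < j\<close> by (metis less_imp_Suc_add)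
          then have "ys ! n = C ! e"
            by (subst split) (simp add: nth_append len nth_Cons')
          then show ?thesis using ef by (simp add: nth_append len nth_Cons' transpose_def)
        qed
      qed
      finally show "permute_list (transpose i j) ys ! n = (A @ ys ! j # B @ ys ! i # C) ! n" .
    qed
    moreover have "schur_Q (A @ ys ! j # B @ ys ! i # C) = - schur_Q (A @ ys ! i # B @ ys ! j # C)"
      using ys(2) that by (intro schur_Q_swap) auto
    ultimately show ?thesis using split by simp
  qed
  from this [of a b] this [of b a] have "schur_Q (permute_list (transpose a b) ys) = - schur_Q ys"
    using swap(1-3) ys(1) by (cases a b rule: linorder_cases) (auto simp: transpose_commute)
  moreover have "permute_list (p \<circ> transpose a b) as = permute_list (transpose a b) ys"
    unfolding ys_def using transp by (rule permute_list_compose)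
  moreover have "sign (p \<circ> transpose a b) = - sign p"
    using swap(3,4) permutes_imp_permutation [OF finite_lessThan]
    by (subst sign_compose) (auto simp: sign_swap_id permutation_swap_id)
  ultimately show ?case
    using swap(5) by (simp only: ys_def const_uminus of_int_minus mult_minus_left)
qed


section \<open>Residue classes of list entries\<close>

lemma residue_parts_simps [simp]:
  "residue_parts s r [] = []"
  "residue_parts s r (x # xs) = (if x mod s = r then x # residue_parts s r xs else residue_parts s r xs)"
  "residue_parts s r (xs @ ys) = residue_parts s r xs @ residue_parts s r ys"
  by (simp_all add: residue_parts_def)

lemma set_residue_parts: "x \<in> set (residue_parts s r xs) \<longleftrightarrow> x \<in> set xs \<and> x mod s = r"
  by (auto simp: residue_parts_def)

lemma length_residue_parts:
  "length (residue_parts s r xs) = length (filter (\<lambda>c. c = r) (map (\<lambda>x. x mod s) xs))"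
  by (simp add: residue_parts_def filter_map comp_def)

lemma length_residue_parts_cong:
  assumes "map (\<lambda>x. x mod s) xs = map (\<lambda>x. x mod s) ys"
  shows "length (residue_parts s r xs) = length (residue_parts s r ys)"
  by (simp only: length_residue_parts assms)

lemma distinct_residue_parts: "distinct xs \<Longrightarrow> distinct (residue_parts s r xs)"
  by (simp add: residue_parts_def)

lemma sorted_wrt_residue_parts: "sorted_wrt R xs \<Longrightarrow> sorted_wrt R (residue_parts s r xs)"
  by (simp add: residue_parts_def sorted_wrt_filter)

lemma nth_residue_parts:
  assumes "i < length xs" and "r = xs ! i mod s"
  shows "length (residue_parts s r (take i xs)) < length (residue_parts s r xs)"
    and "residue_parts s r xs ! length (residue_parts s r (take i xs)) = xs ! i"
proof -
  have "xs = take i xs @ xs ! i # drop (Suc i) xs"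
    using assms(1) by (rule id_take_nth_drop)
  then have "residue_parts s r xs =
      residue_parts s r (take i xs) @ xs ! i # residue_parts s r (drop (Suc i) xs)"
    using assms(2) by (metis residue_parts_simps(2,3))
  then show "length (residue_parts s r (take i xs)) < length (residue_parts s r xs)"
    and "residue_parts s r xs ! length (residue_parts s r (take i xs)) = xs ! i"
    by (simp_all add: nth_append)
qed

text \<open>
  A product over the positions of a list, in which each factor sees its entry only through the residue
  class and the position within it, splits into products over the classes.
\<close>

lemma prod_by_residue:
  fixes g :: "nat \<Rightarrow> nat \<Rightarrow> nat \<Rightarrow> 'a::comm_monoid_mult"
  assumes "0 < s"
  shows "(\<Prod>i<length xs. g (xs ! i mod s) (length (residue_parts s (xs ! i mod s) (take i xs))) (xs ! i)) =
    (\<Prod>r<s. \<Prod>j<length (residue_parts s r xs). g r j (residue_parts s r xs ! j))"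
proof (induction xs rule: rev_induct)
  case (snoc x xs)
  let ?h = "\<lambda>xs r. \<Prod>j<length (residue_parts s r xs). g r j (residue_parts s r xs ! j)"
  let ?c = "g (x mod s) (length (residue_parts s (x mod s) xs)) x"
  have "x mod s < s" using assms by simp
  have "?h (xs @ [x]) r = (if r = x mod s then ?h xs r * ?c else ?h xs r)" for r
    by (auto simp: nth_append intro!: prod.cong arg_cong2 [where f = "(*)"])
  then have "(\<Prod>r<s. ?h (xs @ [x]) r) = (\<Prod>r<s. ?h xs r * (if r = x mod s then ?c else 1))"
    by (intro prod.cong) auto
  also have "\<dots> = (\<Prod>r<s. ?h xs r) * ?c"
    using \<open>x mod s < s\<close> by (simp add: prod.distrib prod.delta')
  finally show ?case
    using snoc by (simp add: nth_append)
qed simp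

lemma sum_length_residue_parts:
  assumes "0 < s"
  shows "(\<Sum>r<s. length (residue_parts s r xs)) = length xs"
proof (induction xs)
  case (Cons x xs)
  have "(\<Sum>r<s. length (residue_parts s r (x # xs))) =
      (\<Sum>r<s. length (residue_parts s r xs) + (if r = x mod s then 1 else 0))"
    by (intro sum.cong) auto
  then show ?case using Cons assms by (simp add: sum.distrib)
qed simp

lemma strict_decreasing_unique:
  fixes xs ys :: "'a::linorder list"
  assumes "sorted_wrt (>) xs" and "sorted_wrt (>) ys" and "set xs = set ys"
  shows "xs = ys"
proof -
  have "sorted_wrt (<) (rev xs)" "sorted_wrt (<) (rev ys)"
    using assms(1,2) by (simp_all add: sorted_wrt_rev)
  then have "rev xs = rev ys"
    using assms(3) by (intro strict_sorted_equal) auto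
  then show ?thesis by simp
qed

lemma strict_decreasing_nth:
  assumes "sorted_wrt (>) (xs :: nat list)" and "i < j" and "j < length xs"
  shows "xs ! j < xs ! i"
  using sorted_wrt_nth_less [OF assms] by simp

lemma mset_eq_if_residue_parts_eq:
  assumes "0 < s" and "\<And>r. r < s \<Longrightarrow> residue_parts s r xs = residue_parts s r ys"
  shows "mset xs = mset ys"
proof (rule multiset_eqI)
  fix x
  have "count (mset xs) x = count (mset (residue_parts s (x mod s) xs)) x" for xs
    by (simp add: residue_parts_def)
  then show "count (mset xs) x = count (mset ys) x"
    using assms by (metis mod_less_divisor)
qed


section \<open>Interlacing sequences and the a-number\<close>

text \<open>
  For decreasing lists with \<open>length ms \<le> length ys \<le> Suc (length ms)\<close>, this says that the skew diagram
  \<open>ys / ms\<close> is a horizontal strip.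
\<close>

definition interlaced :: "nat list \<Rightarrow> nat list \<Rightarrow> bool"
  where "interlaced ms ys \<longleftrightarrow>
    (\<forall>j<length ys. (j < length ms \<longrightarrow> ms ! j \<le> ys ! j) \<and> (0 < j \<longrightarrow> ys ! j \<le> ms ! (j - 1)))"

text \<open>
  Interlacing gives weak decrease through the entry of \<open>ms\<close> in between, and distinctness excludes
  equality.
\<close>

lemma interlaced_strict_decreasing:
  assumes "interlaced ms ys" and "distinct ys" and "length ys \<le> Suc (length ms)"
  shows "sorted_wrt (>) ys"
proof -
  have "ys ! Suc j < ys ! j" if "Suc j < length ys" for j
  proof -
    have "j < length ys" "j < length ms"
      using that assms(3) by auto
    then have "ys ! Suc j \<le> ms ! j" "ms ! j \<le> ys ! j"
      using assms(1) that unfolding interlaced_def by (force, blast)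
    moreover have "ys ! Suc j \<noteq> ys ! j"
      using assms(2) that by (simp add: nth_eq_iff_index_eq)
    ultimately show ?thesis by linarith
  qed
  then show ?thesis
    by (simp add: sorted_wrt_iff_nth_Suc_transp)
qed

definition strip_cell :: "nat list \<Rightarrow> nat \<Rightarrow> nat \<Rightarrow> rat"
  where "strip_cell ms j a =
    (if j < length ms \<and> a = ms ! j \<or> 0 < j \<and> a = ms ! (j - 1) then 1 else 2)"

text \<open>
  A column with a box is followed by one without exactly if it ends a nonempty row \<open>j\<close> and the boxes
  of the row above, which begin right after column \<open>ms ! (j - 1)\<close>, do not continue it. Both
  exceptions, the empty row and the continued row, are recorded by \<^const>\<open>strip_cell\<close>.
\<close>

lemma two_power_a_number:
  assumes "sorted_wrt (>) ms" and "sorted_wrt (>) ys" and "interlaced ms ys"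
    and "length ms \<le> length ys" "length ys \<le> Suc (length ms)" and "\<And>y. y \<in> set ys \<Longrightarrow> 0 < y"
  shows "2 ^ a_number ys ms = (\<Prod>j<length ys. strip_cell ms j (ys ! j))"
proof -
  define J where "J = {j. j < length ys \<and> strip_cell ms j (ys ! j) = 2}"
  have J: "j \<in> J \<longleftrightarrow> j < length ys \<and> \<not> (j < length ms \<and> ys ! j = ms ! j) \<and>
      \<not> (0 < j \<and> ys ! j = ms ! (j - 1))" for j
    by (auto simp: J_def strip_cell_def)
  have low: "part ms j \<le> ys ! j" if "j < length ys" for j
    using assms(3) that by (auto simp: part_def interlaced_def)
  have up: "ys ! j \<le> ms ! (j - 1)" if "j < length ys" "0 < j" for j
    using assms(3) that by (auto simp: interlaced_def)
  have box: "has_box_in_column ys ms c \<longleftrightarrow> (\<exists>i<length ys. part ms i < c \<and> c \<le> ys ! i)" for c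
    by (auto simp: has_box_in_column_def part_def [of ys])
  have "{c. 1 \<le> c \<and> has_box_in_column ys ms c \<and> \<not> has_box_in_column ys ms (c + 1)} = (\<lambda>j. ys ! j) ` J"
  proof (intro equalityI subsetI)
    fix c assume "c \<in> {c. 1 \<le> c \<and> has_box_in_column ys ms c \<and> \<not> has_box_in_column ys ms (c + 1)}"
    then have c: "has_box_in_column ys ms c" "\<not> has_box_in_column ys ms (c + 1)" by auto
    then obtain i where i: "i < length ys" "part ms i < c" "c \<le> ys ! i"
      unfolding box by blast
    have no: "\<not> (part ms l < c + 1 \<and> c + 1 \<le> ys ! l)" if "l < length ys" for l
      using c(2) that unfolding box by blast
    have ci: "c = ys ! i"
      using no [OF i(1)] i by auto
    have "\<not> (0 < i \<and> ys ! i = ms ! (i - 1))"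
    proof
      assume *: "0 < i \<and> ys ! i = ms ! (i - 1)"
      then have "i - 1 < i" by simp
      then have "ys ! i < ys ! (i - 1)"
        using i(1) by (rule strict_decreasing_nth [OF assms(2)])
      moreover have "i - 1 < length ms"
        using \<open>i - 1 < i\<close> i(1) assms(5) by linarith
      then have "part ms (i - 1) = c"
        using * by (simp add: part_def ci)
      ultimately show False
        using no [of "i - 1"] less_trans [OF \<open>i - 1 < i\<close> i(1)] by (simp add: ci)
    qed
    then have "i \<in> J"
      unfolding J using i ci by (auto simp: part_def)
    then show "c \<in> (\<lambda>j. ys ! j) ` J" using ci by blast
  next
    fix c assume "c \<in> (\<lambda>j. ys ! j) ` J"
    then obtain j where j: "j \<in> J" "c = ys ! j" by blast
    then have jl: "j < length ys" by (simp add: J)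
    have "0 < c" using assms(6) jl j(2) by simp
    have "part ms j < c"
      using low [OF jl] j \<open>0 < c\<close> by (auto simp: J part_def split: if_splits)
    then have "has_box_in_column ys ms c"
      unfolding box using jl j(2) by blast
    moreover have "\<not> has_box_in_column ys ms (c + 1)"
    proof
      assume "has_box_in_column ys ms (c + 1)"
      then obtain i where i: "i < length ys" "part ms i < c + 1" "c + 1 \<le> ys ! i"
        unfolding box by blast
      have "i < j"
      proof (rule ccontr)
        assume "\<not> i < j"
        then have "ys ! i \<le> ys ! j"
          using strict_decreasing_nth [OF assms(2), of j i] i(1) by (cases "i = j") auto
        then show False using i(3) j(2) by simp
      qed
      then have "i \<le> j - 1" "j - 1 < length ms" "0 < j"
        using jl assms(5) by auto
      then have "ms ! (j - 1) \<le> ms ! i"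
        using strict_decreasing_nth [OF assms(1), of i "j - 1"] by (cases "i = j - 1") auto
      moreover have "ms ! i \<le> c"
        using i(2) \<open>i \<le> j - 1\<close> \<open>j - 1 < length ms\<close> by (auto simp: part_def)
      ultimately have "ys ! j = ms ! (j - 1)"
        using up [OF jl \<open>0 < j\<close>] j(2) by linarith
      then show False using j(1) \<open>0 < j\<close> by (auto simp: J)
    qed
    ultimately show "c \<in> {c. 1 \<le> c \<and> has_box_in_column ys ms c \<and> \<not> has_box_in_column ys ms (c + 1)}"
      using \<open>0 < c\<close> by simp
  qed
  moreover have "inj_on (\<lambda>j. ys ! j) J"
  proof (rule inj_onI)
    fix i j assume "i \<in> J" "j \<in> J" "ys ! i = ys ! j"
    then show "i = j"
      using strict_decreasing_nth [OF assms(2), of i j] strict_decreasing_nth [OF assms(2), of j i]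
      by (cases i j rule: linorder_cases) (auto simp: J)
  qed
  ultimately have "a_number ys ms = card J"
    by (simp add: a_number_def card_image)
  moreover have "(\<Prod>j<length ys. strip_cell ms j (ys ! j)) = (\<Prod>j\<in>J. 2)"
    by (rule prod.mono_neutral_cong_right) (auto simp: J_def strip_cell_def)
  ultimately show ?thesis by simp
qed


section \<open>The weight of a word\<close>

lemma ladder_weight_other: "a mod s \<noteq> m mod s \<Longrightarrow> ladder_weight s m a = 0"
  by (auto simp: ladder_weight_def mod_eq_dvd_iff_nat)

lemma ladder_weight_same:
  assumes "0 < s" and "a mod s = m mod s"
  shows "ladder_weight s m a = (if a < m then 0 else if a = m then 1 else 2)"
proof (cases "m \<le> a")
  case True
  then have "s dvd a - m" using assms(2) by (simp add: mod_eq_dvd_iff_nat)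
  then show ?thesis
    using True assms(1) by (auto simp: ladder_weight_def ccoeff_def dvd_div_eq_0_iff)
qed (simp add: ladder_weight_def)

text \<open>
  The values of \<^const>\<open>strip_weights\<close> in terms of a single residue class: \<open>ms\<close> are the parts of
  \<open>mu\<close> of residue \<open>r\<close>, and \<open>j\<close> counts the preceding entries of the word of that residue. The entry
  with \<open>j = length ms\<close> is the one in excess.
\<close>

definition cell_weight :: "nat \<Rightarrow> nat \<Rightarrow> nat list \<Rightarrow> nat \<Rightarrow> nat \<Rightarrow> rat"
  where "cell_weight s r ms j a =
    (if j < length ms then ladder_weight s (ms ! j) a else class_indicator s r a) -
    (if j = 0 then 0 else (if j < length ms then 1 else 1 / 2) * ladder_weight s (ms ! (j - 1)) a)"

text \<open>
  Between two consecutive parts \<open>m < m'\<close> of the class the weight is \<open>1\<close> at \<open>m\<close> and \<open>2\<close> strictly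
  between, and at \<open>m'\<close> it is \<open>2 - 1\<close>. Beyond \<open>m'\<close> the ladders cancel. The entry in excess has half
  of these weights.
\<close>

lemma cell_weight_value:
  assumes "0 < s" and "a mod s = r" and "\<And>m. m \<in> set ms \<Longrightarrow> m mod s = r"
    and "sorted_wrt (>) ms" and "j \<le> length ms"
  shows "cell_weight s r ms j a =
    (if (j < length ms \<longrightarrow> ms ! j \<le> a) \<and> (0 < j \<longrightarrow> a \<le> ms ! (j - 1))
     then (if j < length ms then 1 else 1 / 2) * strip_cell ms j a else 0)"
proof -
  have ladder: "ladder_weight s (ms ! i) a = (if a < ms ! i then 0 else if a = ms ! i then 1 else 2)"
    if "i < length ms" for i
    by (rule ladder_weight_same) (use assms that in auto)
  have desc: "ms ! j < ms ! (j - 1)" if "0 < j" "j < length ms"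
    using strict_decreasing_nth [OF assms(4)] that by simp
  have ind: "class_indicator s r a = 1"
    using assms(2) by (simp add: class_indicator_def)
  show ?thesis
  proof (cases "j = 0")
    case True
    then show ?thesis
      using ladder [of 0] ind by (auto simp: cell_weight_def strip_cell_def)
  next
    case False
    then have "j - 1 < length ms" using assms(5) by simp
    show ?thesis
    proof (cases "j < length ms")
      case True
      then show ?thesis
        using False ladder [OF True] ladder [OF \<open>j - 1 < length ms\<close>] desc
        by (auto simp: cell_weight_def strip_cell_def)
    next
      case j: False
      then show ?thesis
        using False ladder [OF \<open>j - 1 < length ms\<close>] ind
        by (auto simp: cell_weight_def strip_cell_def)
    qed
  qed
qed

lemma row_weights_nth:
  assumes "i < length ms"
  shows "row_weights s M ms ! i =
    cut_weight s 1 (M @ take i ms) (ms ! i mod s) (ladder_weight s (ms ! i))"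
  using assms
proof (induction ms arbitrary: M i)
  case (Cons m ms)
  then show ?case by (cases i) simp_all
qed simp

lemma last_residue_parts_mod: "residue_parts s r M \<noteq> [] \<Longrightarrow> last (residue_parts s r M) mod s = r"
  using last_in_set [of "residue_parts s r M"] by (simp add: set_residue_parts)

lemma cut_weight_support:
  assumes "cut_weight s c M r w a \<noteq> 0" and "w a \<noteq> 0 \<Longrightarrow> a mod s = r"
  shows "a mod s = r"
proof (rule ccontr)
  assume a: "a mod s \<noteq> r"
  then have "w a = 0" using assms(2) by blast
  moreover have "ladder_weight s (last (residue_parts s r M)) a = 0" if "residue_parts s r M \<noteq> []"
    using a last_residue_parts_mod [OF that] by (simp add: ladder_weight_other)
  ultimately show False
    using assms(1) by (auto simp: cut_weight_def Let_def split: if_splits)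
qed

lemma word_weight_prod:
  assumes "length ws = length as"
  shows "word_weight ws as = (\<Prod>i<length as. (ws ! i) (as ! i))"
  using assms by (simp add: word_weight_def prod.list_conv_set_nth atLeast0LessThan)

lemma strip_weights_nth_support:
  assumes "i < length mu + length classes" and "(strip_weights s mu classes ! i) a \<noteq> 0"
  shows "a mod s = (map (\<lambda>m. m mod s) mu @ classes) ! i"
proof (cases "i < length mu")
  case True
  have "a mod s = mu ! i mod s"
  proof (rule cut_weight_support)
    show "cut_weight s 1 (take i mu) (mu ! i mod s) (ladder_weight s (mu ! i)) a \<noteq> 0"
      using assms(2) True by (simp add: strip_weights_def nth_append row_weights_nth)
    show "a mod s = mu ! i mod s" if "ladder_weight s (mu ! i) a \<noteq> 0"
      using that ladder_weight_other by blast
  qed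
  then show ?thesis using True by (simp add: nth_append)
next
  case False
  let ?c = "classes ! (i - length mu)"
  have "i - length mu < length classes" using assms(1) False by simp
  then have "extra_weight s mu ?c a \<noteq> 0"
    using assms(2) False by (simp add: strip_weights_def nth_append)
  then have "a mod s = ?c"
    unfolding extra_weight_def
    by (rule cut_weight_support) (simp add: class_indicator_def split: if_splits)
  then show ?thesis using False by (simp add: nth_append)
qed

text \<open>
  As the residues of the word agree with those of \<open>mu\<close>, the number of preceding entries of residue
  \<open>r\<close> in the word and in \<open>mu\<close> is the same. Distinctness of \<open>classes\<close> ensures that each class has at
  most one entry in excess, so that its predecessor in the class is a part of \<open>mu\<close>.
\<close>

lemma strip_weights_nth_cell:
  assumes classes: "map (\<lambda>a. a mod s) as = map (\<lambda>m. m mod s) mu @ classes" and "distinct classes"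
    and i: "i < length as" and r: "r = as ! i mod s"
  shows "(strip_weights s mu classes ! i) (as ! i) =
    cell_weight s r (residue_parts s r mu) (length (residue_parts s r (take i as))) (as ! i)"
proof -
  let ?ms = "residue_parts s r mu" and ?j = "length (residue_parts s r (take i as))"
  have len: "length as = length mu + length classes"
    using arg_cong [OF classes, of length] by simp
  have cls: "map (\<lambda>a. a mod s) (take k as) = take k (map (\<lambda>m. m mod s) mu @ classes)" for k
    unfolding classes [symmetric] by (rule take_map [symmetric])
  have ri: "r = (map (\<lambda>m. m mod s) mu @ classes) ! i"
    using i r unfolding classes [symmetric] by simp
  show ?thesis
  proof (cases "i < length mu")
    case True
    then have ri': "r = mu ! i mod s" using ri by (simp add: nth_append)
    have j: "?j = length (residue_parts s r (take i mu))"
      by (rule length_residue_parts_cong) (use True cls in \<open>simp add: take_map\<close>)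
    have "mu = take i mu @ mu ! i # drop (Suc i) mu"
      using True by (rule id_take_nth_drop)
    then have ms: "?ms = residue_parts s r (take i mu) @ mu ! i # residue_parts s r (drop (Suc i) mu)"
      using ri' by (metis residue_parts_simps(2,3))
    have "residue_parts s r (take i mu) \<noteq> [] \<Longrightarrow> ?ms ! (?j - 1) = last (residue_parts s r (take i mu))"
      unfolding ms j by (simp add: nth_append last_conv_nth)
    moreover have "?j < length ?ms" "?ms ! ?j = mu ! i"
      unfolding ms j by (simp_all add: nth_append)
    ultimately show ?thesis
      using True ri' j
      by (auto simp: strip_weights_def nth_append row_weights_nth cut_weight_def cell_weight_def Let_def)
  next
    case False
    let ?i = "i - length mu"
    have i': "?i < length classes" using i len False by simp
    have rc: "r = classes ! ?i" using ri False by (simp add: nth_append)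
    have "r \<notin> set (take ?i classes)"
      using assms(2) i' rc by (metis distinct_take id_take_nth_drop not_distinct_conv_prefix)
    then have "filter (\<lambda>c. c = r) (take ?i classes) = []"
      by (auto simp: filter_empty_conv)
    then have "?j = length ?ms"
      unfolding length_residue_parts cls using False by simp
    then show ?thesis
      using False rc i'
      by (auto simp: strip_weights_def nth_append extra_weight_def cut_weight_def cell_weight_def
          Let_def last_conv_nth)
  qed
qed

lemma word_weight_by_class:
  assumes "0 < s" and "map (\<lambda>a. a mod s) as = map (\<lambda>m. m mod s) mu @ classes" and "distinct classes"
  shows "word_weight (strip_weights s mu classes) as =
    (\<Prod>r<s. \<Prod>j<length (residue_parts s r as).
      cell_weight s r (residue_parts s r mu) j (residue_parts s r as ! j))"
proof -
  have len: "length as = length mu + length classes"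
    using arg_cong [OF assms(2), of length] by simp
  then have "word_weight (strip_weights s mu classes) as =
      (\<Prod>i<length as. (strip_weights s mu classes ! i) (as ! i))"
    by (intro word_weight_prod) (simp add: strip_weights_def)
  also have "\<dots> = (\<Prod>i<length as. cell_weight s (as ! i mod s) (residue_parts s (as ! i mod s) mu)
      (length (residue_parts s (as ! i mod s) (take i as))) (as ! i))"
    by (intro prod.cong refl strip_weights_nth_cell [OF assms(2,3)]) auto
  also have "\<dots> = (\<Prod>r<s. \<Prod>j<length (residue_parts s r as).
      cell_weight s r (residue_parts s r mu) j (residue_parts s r as ! j))"
    by (rule prod_by_residue [OF assms(1)])
  finally show ?thesis .
qed


section \<open>Excess classes\<close>

lemma set_class_pairs: "r \<in> set (class_pairs s js) \<longleftrightarrow> (\<exists>j\<in>set js. r = j \<or> r = s - j)"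
  by (auto simp: class_pairs_def)

lemma length_class_pairs: "length (class_pairs s js) = 2 * length js"
  by (induction js) simp_all

lemma distinct_class_pairs:
  assumes "odd s" and "distinct js" and "\<And>j. j \<in> set js \<Longrightarrow> odd j \<and> j < s"
  shows "distinct (class_pairs s js)"
  using assms(2,3)
proof (induction js)
  case (Cons j js)
  have j: "odd j" "j < s" using Cons.prems(2) by auto
  have other: "i \<noteq> s - j" "s - i \<noteq> j" if "i \<in> insert j (set js)" for i
  proof -
    have i: "odd i" "i < s" using Cons.prems(2) that by auto
    have "even (s - i)" "even (s - j)" using i j assms(1) by simp_all
    then show "i \<noteq> s - j" "s - i \<noteq> j" using i(1) j(1) by metis+
  qed
  have "s - i \<noteq> s - j" if "i \<in> set js" for i
  proof -
    have "i < s" "i \<noteq> j" using Cons.prems that by auto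
    then show ?thesis using j(2) by linarith
  qed
  then have "s - j \<notin> set (class_pairs s js)"
    using other by (fastforce simp: set_class_pairs)
  moreover have "j \<notin> set (class_pairs s js)"
    using other Cons.prems(1) by (fastforce simp: set_class_pairs)
  moreover have "j \<noteq> s - j"
    using other [of j] by simp
  ultimately show ?case
    using Cons by simp
qed simp

lemma even_length_excess_classes: "even (length (excess_classes s S))"
  by (simp add: excess_classes_def length_class_pairs)

lemma in_set_excess_classes:
  assumes "S \<subseteq> set (odd_classes s)"
  shows "r \<in> set (excess_classes s S) \<longleftrightarrow> (\<exists>j\<in>S. r = j \<or> r = s - j)"
  using assms by (auto simp: excess_classes_def set_class_pairs)

lemma odd_classes_range: "j \<in> set (odd_classes s) \<Longrightarrow> 0 < j \<and> j < s"
  using odd_pos [of j] by (auto simp: in_set_odd_classes)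

lemma excess_classes_range:
  assumes "S \<subseteq> set (odd_classes s)" and "r \<in> set (excess_classes s S)"
  shows "0 < r" and "r < s"
proof -
  obtain j where "j \<in> set (odd_classes s)" "r = j \<or> r = s - j"
    using assms by (auto simp: in_set_excess_classes)
  then show "0 < r" "r < s"
    using odd_classes_range [of j s] by auto
qed

lemma excess_classes_symmetric:
  assumes "S \<subseteq> set (odd_classes s)" and "0 < r" and "r < s"
  shows "s - r \<in> set (excess_classes s S) \<longleftrightarrow> r \<in> set (excess_classes s S)"
proof -
  have "s - r = j \<longleftrightarrow> r = s - j" "s - r = s - j \<longleftrightarrow> r = j" if "j \<in> S" for j
  proof -
    have "j < s" using assms(1) that by (force simp: in_set_odd_classes)
    then show "s - r = j \<longleftrightarrow> r = s - j" "s - r = s - j \<longleftrightarrow> r = j" using assms(2,3) by linarith+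
  qed
  then show ?thesis
    unfolding in_set_excess_classes [OF assms(1)] by blast
qed

lemma distinct_excess_classes:
  assumes "odd s"
  shows "distinct (0 # excess_classes s S)"
proof -
  have "distinct (excess_classes s S)"
    unfolding excess_classes_def
    by (rule distinct_class_pairs [OF assms]) (auto simp: in_set_odd_classes)
  moreover have "0 \<notin> set (excess_classes s S)"
    by (auto simp: excess_classes_def set_class_pairs dest: odd_classes_range)
  ultimately show ?thesis by simp
qed

lemma excess_classes_determine:
  assumes "odd s" and "S \<subseteq> set (odd_classes s)"
  shows "S = {j \<in> set (excess_classes s S). odd j}"
  using assms by (force simp: in_set_excess_classes in_set_odd_classes)

text \<open>
  The excess entries are at most one in each class and already listed in the order of the classes, so
  the extraction of residue classes by which \<^const>\<open>reordering\<close> sorts them has no effect.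
\<close>

lemma collect_excess:
  assumes "odd s" and "distinct js" and "\<And>j. j \<in> set js \<Longrightarrow> odd j \<and> j < s"
    and "map (\<lambda>x. x mod s) xs = class_pairs s (filter (\<lambda>j. j \<in> S) js)"
  shows "concat (map (\<lambda>j. residue_parts s j xs @ residue_parts s (s - j) xs) js) = xs"
  using assms(2-4)
proof (induction js arbitrary: xs)
  case (Cons j js)
  let ?c = "\<lambda>xs js. concat (map (\<lambda>j. residue_parts s j xs @ residue_parts s (s - j) xs) js)"
  have dist: "distinct (class_pairs s (j # js))"
    by (rule distinct_class_pairs [OF assms(1) Cons.prems(1,2)])
  have none: "residue_parts s r ys = []"
    if "map (\<lambda>x. x mod s) ys = class_pairs s (filter (\<lambda>j. j \<in> S) js)" "r \<in> {j, s - j}" for r ys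
  proof -
    have "r \<notin> set (class_pairs s (filter (\<lambda>j. j \<in> S) js))"
      using dist that(2) by (auto simp: set_class_pairs)
    then have "r \<notin> (\<lambda>x. x mod s) ` set ys"
      using that(1) by (metis list.set_map)
    then show ?thesis by (auto simp: residue_parts_def filter_empty_conv)
  qed
  show ?case
  proof (cases "j \<in> S")
    case True
    then obtain u v ys where xs: "xs = u # v # ys" "u mod s = j" "v mod s = s - j"
      "map (\<lambda>x. x mod s) ys = class_pairs s (filter (\<lambda>j. j \<in> S) js)"
      using Cons.prems(3) by (auto simp: Cons_eq_map_conv map_eq_Cons_conv)
    have "residue_parts s i xs @ residue_parts s (s - i) xs =
        residue_parts s i ys @ residue_parts s (s - i) ys" if "i \<in> set js" for i
    proof -
      have "{i, s - i} \<inter> {j, s - j} = {}"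
        using dist that by (auto simp: set_class_pairs)
      then show ?thesis using xs by auto
    qed
    then have "?c xs js = ?c ys js"
      by (intro arg_cong [where f = concat] map_cong) auto
    also have "\<dots> = ys"
      by (rule Cons.IH) (use Cons.prems xs in auto)
    finally have "?c xs js = ys" .
    moreover have "residue_parts s j xs = [u]" "residue_parts s (s - j) xs = [v]"
      using xs none [OF xs(4)] dist by auto
    ultimately show ?thesis using xs(1) by simp
  next
    case False
    then have "map (\<lambda>x. x mod s) xs = class_pairs s (filter (\<lambda>j. j \<in> S) js)"
      using Cons.prems(3) by simp
    then show ?thesis
      using none [of xs] Cons by simp
  qed
qed simp


section \<open>From words to strips\<close>

definition decreasing_parts :: "nat list \<Rightarrow> nat list"
  where "decreasing_parts as = rev (sort (filter (\<lambda>a. 0 < a) as))"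

lemma decreasing_parts_desc:
  assumes "distinct as"
  shows "sorted_wrt (>) (decreasing_parts as)"
proof -
  have "sorted_wrt (<) (sort (filter (\<lambda>a. 0 < a) as))"
    using assms by (simp add: strict_sorted_iff)
  then show ?thesis by (simp add: decreasing_parts_def sorted_wrt_rev)
qed

text \<open>
  The words of nonzero weight. The set \<open>S\<close> consists of the odd classes \<open>j\<close> for which the pair
  \<open>j\<close>, \<open>s - j\<close> is in excess. The entry \<open>as ! length mu\<close> of residue \<open>0\<close> may be \<open>0\<close>, all others are
  positive.
\<close>

locale interlaced_word =
  fixes s :: nat and mu :: "nat list" and S :: "nat set" and as :: "nat list"
  assumes odd_s: "odd s" and mu: "strict_partition mu"
    and S: "S \<subseteq> set (odd_classes s)"
    and classes: "map (\<lambda>a. a mod s) as = map (\<lambda>m. m mod s) mu @ 0 # excess_classes s S"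
    and interlaced: "\<And>r. r < s \<Longrightarrow> interlaced (residue_parts s r mu) (residue_parts s r as)"
begin

abbreviation n :: nat where "n \<equiv> length mu"

abbreviation ext :: "nat list" where "ext \<equiv> drop (Suc n) as"

abbreviation parts :: "nat list" where "parts \<equiv> filter (\<lambda>a. 0 < a) as"

lemma s_pos: "0 < s"
  using odd_s by (rule odd_pos)

lemma mu_desc: "sorted_wrt (>) mu" and mu_pos: "m \<in> set mu \<Longrightarrow> 0 < m"
  using mu by (auto simp: strict_partition_def)

lemma length_as: "length as = n + Suc (length (excess_classes s S))"
  using arg_cong [OF classes, of length] by simp

lemma nth_mod: "i < length as \<Longrightarrow> as ! i mod s = (map (\<lambda>m. m mod s) mu @ 0 # excess_classes s S) ! i"
  unfolding classes [symmetric] by simp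

lemma take_classes: "map (\<lambda>a. a mod s) (take n as) = map (\<lambda>m. m mod s) mu"
  by (simp only: take_map [symmetric] classes) simp

lemma ext_classes: "map (\<lambda>a. a mod s) ext = excess_classes s S"
  by (simp only: drop_map [symmetric] classes) simp

lemma zero_mod: "as ! n mod s = 0"
  using nth_mod [of n] length_as by (simp add: nth_append)

lemma as_split: "as = take n as @ as ! n # ext"
  using length_as by (intro id_take_nth_drop) simp

lemma mu_le_as:
  assumes "i < n"
  shows "mu ! i \<le> as ! i"
proof -
  have i: "i < length as" using assms length_as by simp
  define r where "r = as ! i mod s"
  have r: "r < s" "r = mu ! i mod s"
    using s_pos nth_mod [OF i] assms by (auto simp: r_def nth_append)
  let ?j = "length (residue_parts s r (take i as))"
  have "map (\<lambda>a. a mod s) (take i as) = map (\<lambda>m. m mod s) (take i mu)"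
    using assms by (simp only: take_map [symmetric] classes) simp
  then have j: "?j = length (residue_parts s r (take i mu))"
    by (rule length_residue_parts_cong)
  have "?j < length (residue_parts s r as)" "residue_parts s r as ! ?j = as ! i"
    using nth_residue_parts [OF i r_def] by auto
  moreover have "?j < length (residue_parts s r mu)" "residue_parts s r mu ! ?j = mu ! i"
    using nth_residue_parts [OF assms r(2)] j by auto
  ultimately show ?thesis
    using interlaced [OF r(1)] by (auto simp: interlaced_def)
qed

lemma take_pos: "a \<in> set (take n as) \<Longrightarrow> 0 < a"
  using mu_le_as mu_pos length_as by (fastforce simp: in_set_conv_nth)

lemma ext_pos: "a \<in> set ext \<Longrightarrow> 0 < a"
proof (rule ccontr)
  assume a: "a \<in> set ext" "\<not> 0 < a"
  then have "0 \<in> set (map (\<lambda>a. a mod s) ext)" by (auto intro: rev_image_eqI)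
  then show False
    unfolding ext_classes using distinct_excess_classes [OF odd_s, of S] by simp
qed

lemma parts_split: "parts = take n as @ (if as ! n = 0 then [] else [as ! n]) @ ext"
proof -
  have "filter (\<lambda>a. 0 < a) (take n as) = take n as" "filter (\<lambda>a. 0 < a) ext = ext"
    using take_pos ext_pos by (simp_all add: filter_id_conv)
  moreover have "parts = filter (\<lambda>a. 0 < a) (take n as) @ filter (\<lambda>a. 0 < a) [as ! n] @ filter (\<lambda>a. 0 < a) ext"
    by (subst as_split) simp
  ultimately show ?thesis by simp
qed

lemma length_parts: "length parts = n + length (excess_classes s S) + (if as ! n = 0 then 0 else 1)"
  unfolding parts_split using length_as by simp

lemma schur_Q_parts: "schur_Q as = schur_Q parts"
proof -
  have "schur_Q (take n as @ 0 # ext) = schur_Q (take n as @ ext)"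
    using even_length_excess_classes [of s S] ext_pos length_as
    by (intro schur_Q_remove_0) auto
  then show ?thesis
    unfolding parts_split using as_split by (cases "as ! n = 0") auto
qed

lemma distinct_as_if_distinct_parts:
  assumes "distinct parts"
  shows "distinct as"
proof (cases "as ! n = 0")
  case True
  then have "as = take n as @ 0 # ext" using as_split by simp
  moreover have "distinct (take n as @ 0 # ext)"
    using assms True take_pos [of 0] ext_pos [of 0] unfolding parts_split by auto
  ultimately show ?thesis by metis
next
  case False
  then show ?thesis using assms as_split unfolding parts_split by simp
qed

lemma schur_Q_as_not_distinct:
  assumes "\<not> distinct as"
  shows "schur_Q as = 0"
  unfolding schur_Q_parts
  by (rule schur_Q_not_distinct) (use assms distinct_as_if_distinct_parts in auto)

end

text \<open>
  In these words the positive entries are the parts of a strict partition \<open>lam\<close>, listed in the order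
  of the reordering. A zero is appended to \<open>mu\<close> exactly if \<open>as ! length mu\<close> is positive.
\<close>

locale strip_word = interlaced_word +
  assumes distinct: "distinct as"
begin

abbreviation lam :: "nat list" where "lam \<equiv> decreasing_parts as"

lemma set_lam: "set lam = set parts" and length_lam: "length lam = length parts"
  by (simp_all add: decreasing_parts_def)

lemma lam_desc: "sorted_wrt (>) lam"
  using distinct by (rule decreasing_parts_desc)

lemma strict_partition_lam: "strict_partition lam"
  using lam_desc by (auto simp: strict_partition_def set_lam)

lemma sum_list_lam: "sum_list lam = sum_list as"
proof -
  have "sum_list lam = sum_list (sort parts)"
    by (simp add: decreasing_parts_def)
  also have "\<dots> = sum_list parts"
    by (metis mset_sort sum_mset_sum_list)
  also have "\<dots> = sum_list as"
    by (induction as) auto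
  finally show ?thesis .
qed

lemma pad_lam: "pad mu lam = (if as ! n = 0 then mu else mu @ [0])"
  using even_length_excess_classes [of s S]
  by (simp add: pad_def length_lam length_parts)

lemma parts_pad: "parts = take (length (pad mu lam)) parts @ ext"
  and pad_classes: "map (\<lambda>a. a mod s) (take (length (pad mu lam)) parts) = map (\<lambda>m. m mod s) (pad mu lam)"
  using take_classes zero_mod length_as unfolding parts_split pad_lam by auto

lemma length_residue_as:
  assumes "r < s"
  shows "length (residue_parts s r as) =
    length (residue_parts s r mu) + (if r = 0 \<or> r \<in> set (excess_classes s S) then 1 else 0)"
proof -
  have "length (filter (\<lambda>c. c = r) xs) = (if r \<in> set xs then 1 else 0)" if "distinct xs" for xs :: "nat list"
    using that by (induction xs) auto
  from this [OF distinct_excess_classes [OF odd_s, of S]] show ?thesis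
    unfolding length_residue_parts classes by auto
qed

lemma residue_as_desc:
  assumes "r < s"
  shows "sorted_wrt (>) (residue_parts s r as)"
  using interlaced [OF assms] distinct_residue_parts [OF distinct]
  by (rule interlaced_strict_decreasing) (simp add: length_residue_as [OF assms])

lemma residue_filter: "residue_parts s r parts = filter (\<lambda>a. 0 < a) (residue_parts s r as)"
  by (simp add: residue_parts_def conj_commute)

lemma residue_lam:
  assumes "r < s"
  shows "residue_parts s r lam = residue_parts s r parts"
proof (rule strict_decreasing_unique)
  show "sorted_wrt (>) (residue_parts s r lam)"
    using lam_desc by (rule sorted_wrt_residue_parts)
  show "sorted_wrt (>) (residue_parts s r parts)"
    unfolding residue_filter using residue_as_desc [OF assms] by (rule sorted_wrt_filter)
  show "set (residue_parts s r lam) = set (residue_parts s r parts)"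
    by (auto simp: set_residue_parts set_lam)
qed

text \<open>
  If \<open>as ! length mu\<close> is \<open>0\<close>, it is the last entry of its class, since the excess classes are nonzero.
\<close>

lemma residue_parts_parts:
  "residue_parts s r parts = (if r = 0 \<and> as ! n = 0 then butlast (residue_parts s r as)
    else residue_parts s r as)"
proof -
  have ext0: "residue_parts s 0 ext = []"
  proof -
    have "length (residue_parts s 0 ext) = 0"
      unfolding length_residue_parts ext_classes
      by (auto simp: filter_empty_conv dest: excess_classes_range(1) [OF S])
    then show ?thesis by simp
  qed
  have "residue_parts s r as = residue_parts s r (take n as) @ residue_parts s r (as ! n # ext)"
    by (subst as_split) (simp only: residue_parts_simps(3))
  then show ?thesis
    using ext0 zero_mod unfolding parts_split by (auto simp: butlast_append)
qed

lemma length_residue_pad: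
  assumes "r < s"
  shows "length (residue_parts s r lam) = length (residue_parts s r (pad mu lam)) +
    (if r \<in> set (excess_classes s S) then 1 else 0)"
proof -
  have "0 \<notin> set (excess_classes s S)"
    using distinct_excess_classes [OF odd_s, of S] by simp
  then show ?thesis
    unfolding residue_lam [OF assms] residue_parts_parts
    by (auto simp: length_residue_as [OF assms] length_residue_as [OF s_pos] pad_lam)
qed

lemma interlaced_lam:
  assumes "r < s" and "j < length (residue_parts s r lam)"
  shows "j < length (residue_parts s r (pad mu lam)) \<Longrightarrow>
      residue_parts s r (pad mu lam) ! j \<le> residue_parts s r lam ! j"
    and "0 < j \<Longrightarrow> residue_parts s r lam ! j \<le> residue_parts s r (pad mu lam) ! (j - 1)"
proof -
  have j: "j < length (residue_parts s r as)" "residue_parts s r lam ! j = residue_parts s r as ! j"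
    using assms unfolding residue_lam [OF assms(1)] residue_parts_parts
    by (auto simp: nth_butlast split: if_splits)
  have pad: "residue_parts s r (pad mu lam) ! i = (if i < length (residue_parts s r mu)
      then residue_parts s r mu ! i else 0)" if "i < length (residue_parts s r (pad mu lam))" for i
    using that by (auto simp: pad_lam nth_append split: if_splits)
  show "residue_parts s r (pad mu lam) ! j \<le> residue_parts s r lam ! j"
    if "j < length (residue_parts s r (pad mu lam))"
    using interlaced [OF assms(1)] j pad [OF that] by (auto simp: interlaced_def)
  show "residue_parts s r lam ! j \<le> residue_parts s r (pad mu lam) ! (j - 1)" if "0 < j"
  proof -
    have "j - 1 < length (residue_parts s r mu)"
      using j(1) that by (simp add: length_residue_as [OF assms(1)] split: if_splits)
    then have "residue_parts s r (pad mu lam) ! (j - 1) = residue_parts s r mu ! (j - 1)"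
      by (auto simp: pad_lam nth_append)
    then show ?thesis
      using interlaced [OF assms(1)] j that by (auto simp: interlaced_def)
  qed
qed

lemma part_subset_lam: "part_subset mu lam"
  unfolding part_subset_def
proof
  fix i
  show "part mu i \<le> part lam i"
  proof (cases "i < n")
    case True
    show ?thesis
    proof (rule ccontr)
      assume "\<not> part mu i \<le> part lam i"
      then have less: "part lam i < mu ! i" using True by (simp add: part_def)
      \<comment> \<open>The first \<open>i + 1\<close> entries of the word are parts of \<open>lam\<close> that are at least \<open>mu ! i\<close>.\<close>
      have "(!) as ` {..i} \<subseteq> (!) lam ` {..<i}"
      proof
        fix a assume "a \<in> (!) as ` {..i}"
        then obtain l where l: "l \<le> i" "a = as ! l" by blast
        have "mu ! i \<le> mu ! l"
          using strict_decreasing_nth [OF mu_desc, of l i] l(1) True by (cases "l = i") auto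
        then have a: "mu ! i \<le> a"
          using mu_le_as [of l] l True by simp
        moreover have "a \<in> set as" using l True length_as by simp
        ultimately have "a \<in> set lam"
          using mu_pos [of "mu ! i"] True by (simp add: set_lam)
        then obtain t where t: "t < length lam" "a = lam ! t" by (auto simp: in_set_conv_nth)
        have "t < i"
        proof (rule ccontr)
          assume "\<not> t < i"
          then have "lam ! t \<le> lam ! i"
            using strict_decreasing_nth [OF lam_desc, of i t] t(1) by (cases "t = i") auto
          then show False using less a t \<open>\<not> t < i\<close> by (simp add: part_def split: if_splits)
        qed
        then show "a \<in> (!) lam ` {..<i}" using t by blast
      qed
      then have "card ((!) as ` {..i}) \<le> card ((!) lam ` {..<i})"
        by (intro card_mono) auto
      also have "\<dots> \<le> i"
        using card_image_le [of "{..<i}" "(!) lam"] by simp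
      also have "card ((!) as ` {..i}) = Suc i"
      proof -
        have "inj_on ((!) as) {..i}"
          using distinct True length_as by (auto simp: inj_on_def nth_eq_iff_index_eq)
        then show ?thesis by (simp add: card_image)
      qed
      finally show False by simp
    qed
  qed (simp add: part_def)
qed

lemma sym_hor_strip_lam:
  assumes "sum_list as = sum_list mu + s * k"
  shows "sym_hor_strip s k lam mu"
proof -
  have 1: "length (residue_parts s 0 lam) = length (residue_parts s 0 (pad mu lam))"
    using length_residue_pad [OF s_pos] distinct_excess_classes [OF odd_s, of S] by simp
  have 2: "length (residue_parts s r lam) = length (residue_parts s r (pad mu lam)) +
      (if r \<in> set (excess_classes s S) then 1 else 0)"
    "length (residue_parts s (s - r) lam) = length (residue_parts s (s - r) (pad mu lam)) +
      (if r \<in> set (excess_classes s S) then 1 else 0)" if "0 < r" "r \<le> s - 1" for r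
  proof -
    have "r < s" using that by simp
    then show "length (residue_parts s r lam) = length (residue_parts s r (pad mu lam)) +
      (if r \<in> set (excess_classes s S) then 1 else 0)"
      by (rule length_residue_pad)
    show "length (residue_parts s (s - r) lam) = length (residue_parts s (s - r) (pad mu lam)) +
      (if r \<in> set (excess_classes s S) then 1 else 0)"
      using length_residue_pad [of "s - r"] excess_classes_symmetric [OF S that(1) \<open>r < s\<close>] that s_pos
      by simp
  qed
  have 3: "residue_parts s r lam ! j \<ge> residue_parts s r (pad mu lam) ! j \<and>
      (j + 1 < length (residue_parts s r lam) \<longrightarrow>
        residue_parts s r (pad mu lam) ! j \<ge> residue_parts s r lam ! (j + 1))"
    if "r < s" "j < length (residue_parts s r (pad mu lam))" for r j
    using interlaced_lam [OF that(1), of j] interlaced_lam(2) [OF that(1), of "j + 1"] that(2)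
      length_residue_pad [OF that(1)] by auto
  show ?thesis
    unfolding sym_hor_strip_def Let_def
    using part_subset_lam sum_list_lam assms 1 3 by (simp add: 2)
qed

text \<open>
  Without its possible zero, the word begins with entries of the same residues as the padded \<open>mu\<close>,
  position by position, so that matching within the classes is matching by position.
\<close>

lemma matched_part_pad:
  assumes "i < length (pad mu lam)"
  shows "matched_part s lam mu (pad mu lam ! i) = parts ! i"
proof -
  let ?pm = "pad mu lam" and ?B = "take (length (pad mu lam)) parts"
  let ?r = "?pm ! i mod s"
  have lenB: "length ?B = length ?pm"
    using arg_cong [OF pad_classes, of length] by simp
  have "?r < s" using s_pos by simp
  then have lam: "residue_parts s ?r lam = residue_parts s ?r ?B @ residue_parts s ?r ext"
    using residue_lam parts_pad by (metis residue_parts_simps(3))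
  have len: "length (residue_parts s ?r ?pm) = length (residue_parts s ?r ?B)"
    by (rule length_residue_parts_cong) (rule pad_classes [symmetric])
  have filter_zip: "zip (residue_parts s r xs) (residue_parts s r ys) =
      filter (\<lambda>(x, y). x mod s = r) (zip xs ys)"
    if "map (\<lambda>x. x mod s) xs = map (\<lambda>y. y mod s) ys" for r xs ys
    using that
  proof (induction xs arbitrary: ys)
    case (Cons x xs)
    then show ?case by (cases ys) auto
  qed simp
  have zip: "zip (residue_parts s ?r ?pm) (residue_parts s ?r lam) =
      filter (\<lambda>(x, y). x mod s = ?r) (zip ?pm ?B)"
    unfolding lam filter_zip [OF pad_classes [symmetric], symmetric]
    using len by (simp add: zip_append2)
  have "distinct (map fst (zip ?pm ?B))"
  proof -
    have "distinct mu" using mu_desc by (induction mu) auto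
    then have "distinct ?pm" using mu_pos by (auto simp: pad_lam)
    then show ?thesis using lenB by simp
  qed
  then have "distinct (map fst (filter (\<lambda>(x, y). x mod s = ?r) (zip ?pm ?B)))"
    by (rule distinct_map_filter)
  moreover have "(?pm ! i, ?B ! i) \<in> set (filter (\<lambda>(x, y). x mod s = ?r) (zip ?pm ?B))"
    using assms lenB by (auto simp: in_set_zip)
  ultimately show ?thesis
    using assms by (simp add: matched_part_def zip)
qed

lemma matched_parts_lam: "matched_parts s lam mu = take (length (pad mu lam)) parts"
proof (rule nth_equalityI)
  show "length (matched_parts s lam mu) = length (take (length (pad mu lam)) parts)"
    using arg_cong [OF pad_classes, of length] by (simp add: matched_parts_def)
qed (simp add: matched_parts_def matched_part_pad)

lemma residue_remaining:
  assumes "r < s"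
  shows "residue_parts s r (remaining_parts s lam mu) = residue_parts s r ext"
proof -
  let ?B = "take (length (pad mu lam)) parts"
  have "distinct (?B @ ext)"
    using distinct parts_pad by (metis distinct_filter)
  then have disj: "set ?B \<inter> set ext = {}" by simp
  have "residue_parts s r (remaining_parts s lam mu) = filter (\<lambda>x. x \<notin> set ?B) (residue_parts s r lam)"
    by (simp add: remaining_parts_def matched_parts_lam residue_parts_def conj_commute)
  also have "residue_parts s r lam = residue_parts s r ?B @ residue_parts s r ext"
    using residue_lam [OF assms] parts_pad by (metis residue_parts_simps(3))
  also have "filter (\<lambda>x. x \<notin> set ?B) (residue_parts s r ?B @ residue_parts s r ext) = residue_parts s r ext"
    using disj by (auto simp: filter_empty_conv filter_id_conv set_residue_parts)
  finally show ?thesis .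
qed

lemma reordering_lam: "reordering s lam mu = parts"
proof -
  have "concat (map (\<lambda>j. residue_parts s j (remaining_parts s lam mu) @
      residue_parts s (s - j) (remaining_parts s lam mu)) (odd_classes s)) =
    concat (map (\<lambda>j. residue_parts s j ext @ residue_parts s (s - j) ext) (odd_classes s))"
  proof (intro arg_cong [where f = concat] map_cong refl)
    fix j assume "j \<in> set (odd_classes s)"
    then have "j < s" "s - j < s" using odd_pos [of j] by (auto simp: in_set_odd_classes)
    then show "residue_parts s j (remaining_parts s lam mu) @
        residue_parts s (s - j) (remaining_parts s lam mu) =
      residue_parts s j ext @ residue_parts s (s - j) ext"
      by (simp only: residue_remaining)
  qed
  also have "\<dots> = ext"
    by (rule collect_excess [OF odd_s, where S = S])
      (auto simp: in_set_odd_classes ext_classes [unfolded excess_classes_def])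
  finally show ?thesis
    using parts_pad by (simp add: reordering_def matched_parts_lam odd_classes_def)
qed

text \<open>
  Together with \<open>S_from_as\<close> this makes the passage from words to strips injective: the position of a
  possible zero is fixed, and the parity of \<open>length lam\<close> tells whether it is present.
\<close>

lemma as_from_lam:
  "as = take n (reordering s lam mu) @ (if even (n + length lam) then [0] else []) @
    drop n (reordering s lam mu)"
proof -
  have "even (n + length lam) \<longleftrightarrow> as ! n = 0"
    using even_length_excess_classes [of s S] by (simp add: length_lam length_parts)
  then show ?thesis
    unfolding reordering_lam parts_split using as_split length_as by auto
qed

lemma S_from_as: "S = {j \<in> (\<lambda>a. a mod s) ` set ext. odd j}"
proof -
  have "(\<lambda>a. a mod s) ` set ext = set (excess_classes s S)"
    by (simp only: ext_classes [symmetric] list.set_map)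
  then show ?thesis using excess_classes_determine [OF odd_s S] by simp
qed

text \<open>
  In each class the weight is the product over \<^const>\<open>strip_cell\<close>, a power of two, times \<open>1 / 2\<close> for
  every entry in excess; there are \<open>length lam - length mu\<close> of these. If the class \<open>0\<close> ends with the
  entry \<open>0\<close>, that entry has the weight \<open>1 / 2 * 2\<close>.
\<close>

lemma weight_as:
  "word_weight (strip_weights s mu (0 # excess_classes s S)) as =
    2 ^ normalized_a_number s lam mu * 2 powi (int n - int (length lam))"
proof -
  have cells: "(\<Prod>j<length (residue_parts s r as).
        cell_weight s r (residue_parts s r mu) j (residue_parts s r as ! j)) =
      2 ^ a_number (residue_parts s r lam) (residue_parts s r (pad mu lam)) *
      (1 / 2) ^ (length (residue_parts s r lam) - length (residue_parts s r mu)) \<and>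
      length (residue_parts s r mu) \<le> length (residue_parts s r lam)"
    if r: "r < s" for r
  proof -
    define ms ys zs where "ms = residue_parts s r mu" and "ys = residue_parts s r as"
      and "zs = residue_parts s r lam"
    have ms: "sorted_wrt (>) ms" "\<And>m. m \<in> set ms \<Longrightarrow> m mod s = r" "\<And>m. m \<in> set ms \<Longrightarrow> 0 < m"
      using sorted_wrt_residue_parts [OF mu_desc] mu_pos by (auto simp: ms_def set_residue_parts)
    have ys: "length ys = length ms + (if r = 0 \<or> r \<in> set (excess_classes s S) then 1 else 0)"
      "\<And>y. y \<in> set ys \<Longrightarrow> y mod s = r" "interlaced ms ys"
      using length_residue_as [OF r] interlaced [OF r] by (auto simp: ms_def ys_def set_residue_parts)
    have zs: "zs = (if r = 0 \<and> as ! n = 0 then butlast ys else ys)" "sorted_wrt (>) zs"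
      "\<And>z. z \<in> set zs \<Longrightarrow> 0 < z"
      unfolding ys_def zs_def
      by (rule trans [OF residue_lam [OF r] residue_parts_parts])
        (auto simp: set_residue_parts set_lam intro: sorted_wrt_residue_parts [OF lam_desc])
    have len: "length ms \<le> length zs" "length zs \<le> Suc (length ms)"
      using ys(1) zs(1) by auto
    have prefix: "zs ! j = ys ! j" if "j < length zs" for j
      using that zs(1) by (auto simp: nth_butlast)
    have inter: "interlaced ms zs"
      unfolding interlaced_def
    proof (intro allI impI)
      fix j assume j: "j < length zs"
      then have "j < length ys" using zs(1) by (auto split: if_splits)
      then show "(j < length ms \<longrightarrow> ms ! j \<le> zs ! j) \<and> (0 < j \<longrightarrow> zs ! j \<le> ms ! (j - 1))"
        using ys(3) unfolding interlaced_def prefix [OF j] by blast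
    qed
    let ?h = "\<lambda>j. (if j < length ms then 1 else 1 / 2) :: rat"
    have cell: "cell_weight s r ms j (ys ! j) = ?h j * strip_cell ms j (ys ! j)" if "j < length ys" for j
    proof -
      have "length ys \<le> Suc (length ms)" using ys(1) by simp
      then have "j \<le> length ms" "ys ! j mod s = r"
        using that ys(2) [of "ys ! j"] by auto
      then show ?thesis
        using cell_weight_value [OF s_pos, of "ys ! j" r ms j] ms ys(3) that
        by (auto simp: interlaced_def)
    qed
    have "(\<Prod>j<length ys. cell_weight s r ms j (ys ! j)) = (\<Prod>j<length zs. ?h j * strip_cell ms j (zs ! j))"
    proof (cases "r = 0 \<and> as ! n = 0")
      case True
      then have last: "length ys = Suc (length ms)" "length zs = length ms"
        using ys(1) zs(1) by auto
      have "last ys = 0"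
      proof (rule ccontr)
        assume "last ys \<noteq> 0"
        have "ys \<noteq> []" using last(1) by auto
        have "as ! n \<in> set as" using length_as by simp
        then have "0 \<in> set ys"
          using True by (simp add: ys_def set_residue_parts)
        then have "0 \<in> set (butlast ys @ [last ys])" using \<open>ys \<noteq> []\<close> by simp
        then have "0 \<in> set zs" using \<open>last ys \<noteq> 0\<close> True zs(1) by simp
        then show False using zs(3) by blast
      qed
      then have "ys ! length ms = 0"
        using last(1) by (metis diff_Suc_1 last_conv_nth length_0_conv nat.distinct(1))
      moreover have "ms ! (length ms - 1) \<noteq> 0" if "0 < length ms"
        using ms(3) [of "ms ! (length ms - 1)"] that by simp
      ultimately have "strip_cell ms (length ms) (ys ! length ms) = 2"
        by (cases "ms = []") (simp_all add: strip_cell_def)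
      then show ?thesis
        using cell last prefix by simp
    next
      case False
      then show ?thesis using zs(1) cell by auto
    qed
    also have "\<dots> = (\<Prod>j<length zs. strip_cell ms j (zs ! j)) * (\<Prod>j<length zs. ?h j)"
      by (simp add: prod.distrib mult.commute)
    also have "(\<Prod>j<length zs. ?h j) = (\<Prod>j\<in>{length ms..<length zs}. 1 / 2)"
      by (rule prod.mono_neutral_cong_right) auto
    also have "\<dots> = (1 / 2) ^ (length zs - length ms)" by simp
    also have "(\<Prod>j<length zs. strip_cell ms j (zs ! j)) = 2 ^ a_number zs ms"
      using two_power_a_number [OF ms(1) zs(2) inter len zs(3)] by simp
    also have "a_number zs ms = a_number zs (residue_parts s r (pad mu lam))"
    proof -
      have "part (residue_parts s r (pad mu lam)) = part ms"
        by (auto simp: fun_eq_iff part_def pad_lam ms_def nth_append)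
      then show ?thesis by (simp add: a_number_def has_box_in_column_def)
    qed
    finally show ?thesis using len(1) by (simp add: ms_def ys_def zs_def)
  qed
  have "word_weight (strip_weights s mu (0 # excess_classes s S)) as =
      (\<Prod>r<s. 2 ^ a_number (residue_parts s r lam) (residue_parts s r (pad mu lam)) *
      (1 / 2) ^ (length (residue_parts s r lam) - length (residue_parts s r mu)))"
    unfolding word_weight_by_class [OF s_pos classes distinct_excess_classes [OF odd_s]]
  proof (rule prod.cong [OF refl])
    fix r assume "r \<in> {..<s}"
    then have "r < s" by simp
    from cells [OF this] show "(\<Prod>j<length (residue_parts s r as).
        cell_weight s r (residue_parts s r mu) j (residue_parts s r as ! j)) =
      2 ^ a_number (residue_parts s r lam) (residue_parts s r (pad mu lam)) *
      (1 / 2) ^ (length (residue_parts s r lam) - length (residue_parts s r mu))"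
      by (rule conjunct1)
  qed
  also have "\<dots> = 2 ^ normalized_a_number s lam mu *
      (1 / 2) ^ (\<Sum>r<s. length (residue_parts s r lam) - length (residue_parts s r mu))"
    unfolding prod.distrib normalized_a_number_def power_sum by (rule refl)
  also have "(\<Sum>r<s. length (residue_parts s r lam) - length (residue_parts s r mu)) =
      (\<Sum>r<s. length (residue_parts s r lam)) - (\<Sum>r<s. length (residue_parts s r mu))"
    by (rule sum_subtractf_nat) (simp only: lessThan_iff cells [THEN conjunct2])
  also have "\<dots> = length lam - n"
    by (simp only: sum_length_residue_parts [OF s_pos])
  also have "(1 / 2 :: rat) ^ (length lam - n) = 2 powi (int n - int (length lam))"
  proof -
    have "n \<le> length lam" by (simp add: length_lam length_parts)
    then have eq: "int n - int (length lam) = - int (length lam - n)" by simp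
    show ?thesis
      unfolding eq power_int_minus power_int_of_nat by (simp only: power_one_over inverse_eq_divide)
  qed
  finally show ?thesis .
qed

end


section \<open>From strips to words\<close>

lemma residue_parts_residue_parts:
  "residue_parts s r (residue_parts s j xs) = (if j = r then residue_parts s r xs else [])"
  by (auto simp: residue_parts_def filter_empty_conv)

lemma residue_parts_collect:
  assumes "odd s" and "distinct js" and "\<And>j. j \<in> set js \<Longrightarrow> odd j \<and> j < s" and "r < s"
  shows "residue_parts s r (concat (map (\<lambda>j. residue_parts s j xs @ residue_parts s (s - j) xs) js)) =
    (if r \<in> set js \<or> s - r \<in> set js then residue_parts s r xs else [])"
  using assms(2,3)
proof (induction js)
  case (Cons j js)
  have j: "odd j" "j < s" using Cons.prems(2) by auto
  have "even (s - j)" using j assms(1) by simp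
  then have "s - j \<noteq> j" "s - j \<notin> set js"
    using j(1) Cons.prems(2) by (metis, metis list.set_intros(2))
  moreover have "s - r = j \<longleftrightarrow> s - j = r"
    using j assms(4) by auto
  moreover have "s - r = s - j" if "j = r" using that by simp
  ultimately show ?case
    using Cons assms(4) by (auto simp: residue_parts_residue_parts)
qed simp

lemma concat_map_filter_if:
  "concat (map g (filter P js)) = concat (map (\<lambda>j. if P j then g j else []) js)"
  by (induction js) simp_all

text \<open>
  The word is the reordering of \<open>lam\<close>, with a zero inserted after the parts matched with \<open>mu\<close> if none
  is appended to \<open>mu\<close>. All its properties are read off from its residue classes, which are those
  of \<open>lam\<close>: the matched parts form an initial segment of each class, the remaining parts the rest.
\<close>

lemma strip_to_word:
  assumes s: "odd s" and mu: "strict_partition mu" and lam: "strict_partition lam"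
    and strip: "sym_hor_strip s k lam mu"
  obtains S as where "strip_word s mu S as" and "decreasing_parts as = lam"
    and "sum_list as = sum_list mu + s * k"
proof -
  have s_pos: "0 < s" using s by (rule odd_pos)
  have lam_desc: "sorted_wrt (>) lam" and lam_pos: "0 \<notin> set lam" and mu_desc: "sorted_wrt (>) mu"
    and mu_pos: "0 \<notin> set mu"
    using mu lam by (auto simp: strict_partition_def)
  have desc_distinct: "distinct xs" if "sorted_wrt (>) xs" for xs :: "nat list"
    using that by (induction xs) auto
  define pm where "pm = pad mu lam"
  define B where "B = matched_parts s lam mu"
  define R where "R = remaining_parts s lam mu"
  define S where "S = {j \<in> set (odd_classes s). residue_parts s j R \<noteq> []}"
  define ext where "ext = concat (map (\<lambda>j. residue_parts s j R @ residue_parts s (s - j) R) (odd_classes s))"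
  define as where "as = B @ (if even (length mu + length lam) then [0] else []) @ ext"
  let ?N = "\<lambda>r. length (residue_parts s r lam)" and ?M = "\<lambda>r. length (residue_parts s r pm)"
  have pm_distinct: "distinct pm"
    using desc_distinct [OF mu_desc] mu_pos by (simp add: pm_def pad_def)
  have sum: "sum_list lam = sum_list mu + s * k"
    using strip by (simp add: sym_hor_strip_def)
  note conds = strip [unfolded sym_hor_strip_def Let_def, folded pm_def, THEN conjunct2, THEN conjunct2]
  have N0: "?N 0 = ?M 0"
    using conds by (rule conjunct1)
  have Nr: "?M r \<le> ?N r \<and> ?N r \<le> Suc (?M r) \<and> ?N r - ?M r = ?N (s - r) - ?M (s - r)"
    if "0 < r" "r < s" for r
  proof -
    have "0 < r \<and> r \<le> s - 1" using that by linarith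
    from conds [THEN conjunct2, THEN conjunct1, rule_format, OF this]
    show ?thesis by linarith
  qed
  have Nle: "?M r \<le> ?N r" "?N r \<le> Suc (?M r)" if "r < s" for r
    using Nr [of r] N0 that by (cases "r = 0"; simp)+
  have I: "residue_parts s r pm ! j \<le> residue_parts s r lam ! j"
    "Suc j < ?N r \<Longrightarrow> residue_parts s r lam ! Suc j \<le> residue_parts s r pm ! j" if "r < s" "j < ?M r" for r j
    using conds [THEN conjunct2, THEN conjunct2, rule_format, OF that] by simp_all
  have match: "matched_part s lam mu (residue_parts s r pm ! j) = residue_parts s r lam ! j"
    if "r < s" "j < ?M r" for r j
  proof -
    have r: "residue_parts s r pm ! j mod s = r"
      using nth_mem [OF that(2)] by (simp add: set_residue_parts)
    have "distinct (map fst (zip (residue_parts s r pm) (residue_parts s r lam)))"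
      using distinct_residue_parts [OF pm_distinct] Nle [OF that(1)] by (simp add: map_fst_zip_take)
    moreover have "(residue_parts s r pm ! j, residue_parts s r lam ! j) \<in>
        set (zip (residue_parts s r pm) (residue_parts s r lam))"
      using that Nle [OF that(1)] by (auto simp: in_set_zip)
    ultimately show ?thesis
      by (simp add: matched_part_def r flip: pm_def)
  qed
  have match_mem: "matched_part s lam mu x mod s = x mod s" if "x \<in> set pm" for x
  proof -
    have "x \<in> set (residue_parts s (x mod s) pm)"
      using that by (simp add: set_residue_parts)
    then obtain j where j: "j < ?M (x mod s)" "residue_parts s (x mod s) pm ! j = x"
      by (auto simp: in_set_conv_nth)
    have "x mod s < s" using s_pos by simp
    then have "matched_part s lam mu x = residue_parts s (x mod s) lam ! j"
      using match j by metis
    moreover have "j < ?N (x mod s)"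
      using j(1) Nle(1) [OF \<open>x mod s < s\<close>] by simp
    ultimately show ?thesis
      using nth_mem set_residue_parts by metis
  qed
  have B_classes: "map (\<lambda>a. a mod s) B = map (\<lambda>m. m mod s) pm"
    by (simp add: B_def matched_parts_def match_mem flip: pm_def)
  have resB: "residue_parts s r B = take (?M r) (residue_parts s r lam)" if "r < s" for r
  proof -
    have "residue_parts s r B =
        map (matched_part s lam mu) (filter (\<lambda>x. matched_part s lam mu x mod s = r) pm)"
      by (simp add: B_def matched_parts_def pm_def residue_parts_def filter_map comp_def)
    also have "filter (\<lambda>x. matched_part s lam mu x mod s = r) pm = residue_parts s r pm"
      unfolding residue_parts_def by (rule filter_cong) (simp_all add: match_mem)
    finally have "residue_parts s r B = map (matched_part s lam mu) (residue_parts s r pm)" .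
    also have "\<dots> = take (?M r) (residue_parts s r lam)"
      by (rule nth_equalityI) (use Nle [OF that] match [OF that] in auto)
    finally show ?thesis .
  qed
  have resR: "residue_parts s r R = drop (?M r) (residue_parts s r lam)" if "r < s" for r
  proof -
    have mem: "x \<in> set B \<longleftrightarrow> x \<in> set (take (?M r) (residue_parts s r lam))"
      if "x \<in> set (residue_parts s r lam)" for x
      using that unfolding resB [OF \<open>r < s\<close>, symmetric] by (auto simp: set_residue_parts)
    have "distinct (take (?M r) (residue_parts s r lam) @ drop (?M r) (residue_parts s r lam))"
      using distinct_residue_parts [OF desc_distinct [OF lam_desc]] by simp
    then have disj: "set (take (?M r) (residue_parts s r lam)) \<inter> set (drop (?M r) (residue_parts s r lam)) = {}"
      unfolding distinct_append by blast
    have "residue_parts s r R = filter (\<lambda>x. x \<notin> set B) (residue_parts s r lam)"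
      by (simp add: R_def B_def remaining_parts_def residue_parts_def conj_commute)
    also have "\<dots> = filter (\<lambda>x. x \<notin> set (take (?M r) (residue_parts s r lam))) (residue_parts s r lam)"
      using mem by (intro filter_cong) auto
    also have "\<dots> = filter (\<lambda>x. x \<notin> set (take (?M r) (residue_parts s r lam)))
        (take (?M r) (residue_parts s r lam) @ drop (?M r) (residue_parts s r lam))"
      by simp
    also have "\<dots> = drop (?M r) (residue_parts s r lam)"
      unfolding filter_append using disj by (auto simp: filter_empty_conv filter_id_conv)
    finally show ?thesis .
  qed
  have S: "S \<subseteq> set (odd_classes s)" by (auto simp: S_def)
  have single: "map (\<lambda>x. x mod s) (residue_parts s r R) = (if residue_parts s r R = [] then [] else [r])"
    if "r < s" for r
  proof -
    have "length (residue_parts s r R) \<le> 1"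
      using Nle [OF that] by (simp add: resR [OF that])
    then consider "residue_parts s r R = []" | x where "residue_parts s r R = [x]"
      by (cases "residue_parts s r R") auto
    then show ?thesis
    proof cases
      case 2
      then have "x \<in> set (residue_parts s r R)" by simp
      then have "x mod s = r" unfolding set_residue_parts by (rule conjunct2)
      then show ?thesis using 2 by simp
    qed simp
  qed
  have ext_classes: "map (\<lambda>x. x mod s) ext = excess_classes s S"
  proof -
    have "map (\<lambda>x. x mod s) (residue_parts s j R @ residue_parts s (s - j) R) =
        (if j \<in> S then [j, s - j] else [])" if "j \<in> set (odd_classes s)" for j
    proof -
      have j: "0 < j" "j < s" "s - j < s" using odd_classes_range [OF that] by auto
      have "residue_parts s j R = [] \<longleftrightarrow> residue_parts s (s - j) R = []"
        using Nr [OF j(1,2)] Nle [OF j(3)] by (simp add: resR [OF j(2)] resR [OF j(3)])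
          linarith
      then show ?thesis
        using single [OF j(2)] single [OF j(3)] that by (simp add: S_def)
    qed
    then show ?thesis
      unfolding ext_def excess_classes_def class_pairs_def concat_map_filter_if map_concat map_map
      by (intro arg_cong [where f = concat] map_cong) auto
  qed
  have resE: "residue_parts s r ext = residue_parts s r R" if "r < s" for r
  proof -
    have "residue_parts s r ext =
        (if r \<in> set (odd_classes s) \<or> s - r \<in> set (odd_classes s) then residue_parts s r R else [])"
      unfolding ext_def
      by (rule residue_parts_collect [OF s distinct_odd_classes _ that]) (auto simp: in_set_odd_classes)
    moreover have "residue_parts s 0 R = []"
      using N0 by (simp add: resR [OF s_pos])
    ultimately show ?thesis
      using odd_classes_cover [OF s _ that] by (cases "r = 0") auto
  qed
  have res: "residue_parts s r (B @ ext) = residue_parts s r lam" if "r < s" for r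
    by (simp add: resB [OF that] resE [OF that] resR [OF that])
  have mset: "mset (B @ ext) = mset lam"
    by (rule mset_eq_if_residue_parts_eq [OF s_pos res])
  have set: "set (B @ ext) = set lam" and dist: "distinct (B @ ext)"
    using mset_eq_setD [OF mset] mset_eq_imp_distinct_iff [OF mset] desc_distinct [OF lam_desc] by auto
  have filter_as: "filter (\<lambda>a. 0 < a) as = B @ ext"
  proof -
    have "\<forall>a\<in>set (B @ ext). 0 < a" using lam_pos set by (metis gr0I)
    then have "filter (\<lambda>a. 0 < a) B = B" "filter (\<lambda>a. 0 < a) ext = ext"
      by (simp_all add: filter_id_conv)
    then show ?thesis by (simp add: as_def)
  qed
  have distinct_as: "distinct as"
    using dist set lam_pos by (auto simp: as_def)
  have "strip_word s mu S as"
  proof unfold_locales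
    show "map (\<lambda>a. a mod s) as = map (\<lambda>m. m mod s) mu @ 0 # excess_classes s S"
      by (auto simp: as_def B_classes ext_classes pm_def pad_def)
    fix r assume r: "r < s"
    let ?ms = "residue_parts s r mu" and ?ys = "residue_parts s r as"
    show "interlaced ?ms ?ys"
      unfolding interlaced_def
    proof (intro allI impI)
      fix j assume j: "j < length ?ys"
      have pm: "residue_parts s r pm = ?ms @ (if r = 0 \<and> odd (length mu + length lam) then [0] else [])"
        using s_pos by (auto simp: pm_def pad_def)
      have E0: "residue_parts s 0 ext = []"
        using N0 by (simp add: resE [OF s_pos] resR [OF s_pos])
      have ys: "?ys = residue_parts s r lam @ (if r = 0 \<and> even (length mu + length lam) then [0] else [])"
        using E0 res [OF r] by (auto simp: as_def)
      have len: "length ?ys \<le> Suc (length ?ms)"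
      proof -
        have "?M r = length ?ms + (if r = 0 \<and> odd (length mu + length lam) then 1 else 0)"
          unfolding pm by simp
        moreover have "?N r = ?M r" if "r = 0" using N0 that by simp
        ultimately show ?thesis
          using Nle [OF r] unfolding ys by (cases "r = 0") (simp_all split: if_splits)
      qed
      have "?ms ! j \<le> ?ys ! j" if "j < length ?ms"
      proof -
        have jm: "j < ?M r" using that pm by simp
        then have "j < ?N r" using Nle(1) [OF r] by simp
        then have "?ys ! j = residue_parts s r lam ! j" unfolding ys by (simp add: nth_append)
        moreover have "residue_parts s r pm ! j = ?ms ! j"
          using that unfolding pm by (simp add: nth_append)
        ultimately show ?thesis using I(1) [OF r jm] by simp
      qed
      moreover have "?ys ! j \<le> ?ms ! (j - 1)" if "0 < j"
      proof (cases "j < ?N r")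
        case True
        have "j - 1 < length ?ms" using j len that by linarith
        then have "j - 1 < ?M r" using pm by simp
        then have "residue_parts s r lam ! j \<le> residue_parts s r pm ! (j - 1)"
          using I(2) [OF r, of "j - 1"] True that by simp
        then show ?thesis
          using True \<open>j - 1 < length ?ms\<close> unfolding ys pm by (simp add: nth_append)
      next
        case False
        then have "?ys ! j = 0" using j unfolding ys by (auto simp: nth_append split: if_splits)
        then show ?thesis by simp
      qed
      ultimately show "(j < length ?ms \<longrightarrow> ?ms ! j \<le> ?ys ! j) \<and> (0 < j \<longrightarrow> ?ys ! j \<le> ?ms ! (j - 1))"
        by blast
    qed
  qed (use s mu S distinct_as in auto)
  moreover have "decreasing_parts as = lam"
  proof (rule strict_decreasing_unique)
    show "set (decreasing_parts as) = set lam"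
      using set by (simp add: decreasing_parts_def filter_as)
  qed (use decreasing_parts_desc [OF distinct_as] lam_desc in auto)
  moreover have "sum_list as = sum_list mu + s * k"
  proof -
    have "sum_list as = sum_list (B @ ext)" by (simp add: as_def)
    also have "\<dots> = sum_list lam" using mset by (metis sum_mset_sum_list)
    finally show ?thesis using sum by simp
  qed
  ultimately show ?thesis by (rule that)
qed


section \<open>The Pieri rule\<close>

lemma reordering_perm_schur_Q:
  assumes "distinct lam" and "mset (reordering s lam mu) = mset lam"
    and "\<And>a. a \<in> set lam \<Longrightarrow> 0 < a"
  shows "const (of_int (sign (reordering_perm s lam mu))) * schur_Q lam = schur_Q (reordering s lam mu)"
proof -
  obtain \<sigma> where \<sigma>: "\<sigma> permutes {..<length lam}" "permute_list \<sigma> lam = reordering s lam mu"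
    using mset_eq_permutation [OF assms(2)] by blast
  have nth: "reordering s lam mu ! i = lam ! \<sigma> i" if "i < length lam" for i
    using permute_list_nth [OF \<sigma>(1) that] \<sigma>(2) by simp
  have "reordering_perm s lam mu = \<sigma>"
    unfolding reordering_perm_def
  proof (rule the_equality)
    fix \<tau> assume \<tau>: "\<tau> permutes {..<length lam} \<and>
      (\<forall>i < length lam. reordering s lam mu ! i = lam ! \<tau> i)"
    show "\<tau> = \<sigma>"
    proof
      fix i
      show "\<tau> i = \<sigma> i"
      proof (cases "i < length lam")
        case True
        then have "\<tau> i < length lam" "\<sigma> i < length lam"
          using permutes_in_image [of \<tau> "{..<length lam}" i] permutes_in_image [OF \<sigma>(1), of i] \<tau>
          by simp_all
        then show ?thesis
          using nth [OF True] \<tau> True assms(1) by (simp add: nth_eq_iff_index_eq)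
      next
        case False
        then show ?thesis
          using permutes_not_in [OF conjunct1 [OF \<tau>]] permutes_not_in [OF \<sigma>(1)] by simp
      qed
    qed
  qed (use \<sigma>(1) nth in simp)
  then show ?thesis
    using schur_Q_permute_list [OF \<sigma>(1) assms(3)] \<sigma>(2) by simp
qed

lemma interlaced_word_if_weight_nonzero:
  assumes "odd s" and "strict_partition mu" and "S \<subseteq> set (odd_classes s)"
    and "length as = length (strip_weights s mu (0 # excess_classes s S))"
    and "word_weight (strip_weights s mu (0 # excess_classes s S)) as \<noteq> 0"
  shows "interlaced_word s mu S as"
proof -
  let ?W = "strip_weights s mu (0 # excess_classes s S)"
  have s_pos: "0 < s" using assms(1) by (rule odd_pos)
  have len: "length ?W = length mu + length (0 # excess_classes s S)"
    by (simp add: strip_weights_def)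
  have classes: "map (\<lambda>a. a mod s) as = map (\<lambda>m. m mod s) mu @ 0 # excess_classes s S"
  proof (rule nth_equalityI)
    show "length (map (\<lambda>a. a mod s) as) = length (map (\<lambda>m. m mod s) mu @ 0 # excess_classes s S)"
      using assms(4) len by simp
    fix i assume "i < length (map (\<lambda>a. a mod s) as)"
    then have i: "i < length as" by simp
    then have "(?W ! i) (as ! i) \<noteq> 0"
      using assms(5) unfolding word_weight_prod [OF assms(4) [symmetric]] by simp
    then have "as ! i mod s = (map (\<lambda>m. m mod s) mu @ 0 # excess_classes s S) ! i"
      using i assms(4) len by (intro strip_weights_nth_support) auto
    then show "map (\<lambda>a. a mod s) as ! i = (map (\<lambda>m. m mod s) mu @ 0 # excess_classes s S) ! i"
      using i by simp
  qed
  have "interlaced (residue_parts s r mu) (residue_parts s r as)" if r: "r < s" for r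
    unfolding interlaced_def
  proof (intro allI impI)
    fix j assume j: "j < length (residue_parts s r as)"
    let ?ms = "residue_parts s r mu" and ?a = "residue_parts s r as ! j"
    have "cell_weight s r ?ms j ?a \<noteq> 0"
      using assms(5) r j
      unfolding word_weight_by_class [OF s_pos classes distinct_excess_classes [OF assms(1)]] by simp
    moreover have "?a mod s = r"
      using nth_mem [OF j] by (simp add: set_residue_parts)
    moreover have "j \<le> length ?ms"
    proof -
      have "length (filter (\<lambda>c. c = r) xs) \<le> 1" if "distinct xs" for xs :: "nat list"
        using that by (induction xs) (auto simp: filter_empty_conv)
      from this [OF distinct_excess_classes [OF assms(1), of S]]
      show ?thesis using j unfolding length_residue_parts classes by simp
    qed
    moreover have "sorted_wrt (>) ?ms"
      using assms(2) by (auto simp: strict_partition_def intro: sorted_wrt_residue_parts)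
    ultimately show "(j < length ?ms \<longrightarrow> ?ms ! j \<le> ?a) \<and> (0 < j \<longrightarrow> ?a \<le> ?ms ! (j - 1))"
      using cell_weight_value [OF s_pos, of ?a r ?ms j]
      by (auto simp: set_residue_parts split: if_splits)
  qed
  then show ?thesis
    by unfold_locales (use assms(1-3) classes in auto)
qed

theorem corollary3p20:
  fixes s k :: nat and mu :: "nat list"
  assumes "odd s" and "0 < k" and "strict_partition mu"
  shows "plethysm_p s (q k) * schur_Q mu =
    (\<Sum>lam \<in> {lam. strict_partition lam \<and> sym_hor_strip s k lam mu}.
       const (of_int (sign (reordering_perm s lam mu)) *
              2 ^ normalized_a_number s lam mu *
              2 powi (int (length mu) - int (length lam))) *
       schur_Q lam)"
proof -
  let ?W = "\<lambda>S. strip_weights s mu (0 # excess_classes s S)"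
  let ?L = "\<lambda>S. {as. length as = length (?W S) \<and> sum_list as = sum_list mu + s * k}"
  let ?f = "\<lambda>(S, as). const (word_weight (?W S) as) * schur_Q as"
  let ?g = "\<lambda>lam. const (of_int (sign (reordering_perm s lam mu)) *
              2 ^ normalized_a_number s lam mu *
              2 powi (int (length mu) - int (length lam))) * schur_Q lam"
  \<comment> \<open>Outside \<open>V\<close> the weight is zero or the word has a repeated entry.\<close>
  define V where "V = {(S, as). strip_word s mu S as \<and> sum_list as = sum_list mu + s * k}"
  have "plethysm_p s (q k) * schur_Q mu = (\<Sum>S\<in>Pow (set (odd_classes s)). \<Sum>as\<in>?L S. ?f (S, as))"
    unfolding prod.case
    by (rule plethysm_mult_schur_Q_expansion) (use assms in \<open>auto simp: strict_partition_def\<close>)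
  also have "\<dots> = sum ?f (SIGMA S:Pow (set (odd_classes s)). ?L S)"
    by (subst sum.Sigma) (auto intro: finite_lists_sum simp del: Pow_iff)
  also have "\<dots> = sum ?f V"
  proof (rule sum.mono_neutral_right)
    show "finite (SIGMA S:Pow (set (odd_classes s)). ?L S)"
      by (intro finite_SigmaI finite_lists_sum) simp
    show "V \<subseteq> (SIGMA S:Pow (set (odd_classes s)). ?L S)"
    proof
      fix x assume "x \<in> V"
      then obtain S as where x: "x = (S, as)" "strip_word s mu S as" "sum_list as = sum_list mu + s * k"
        by (auto simp: V_def)
      interpret strip_word s mu S as by (rule x(2))
      show "x \<in> (SIGMA S:Pow (set (odd_classes s)). ?L S)"
        using x S length_as by (simp add: strip_weights_def)
    qed
    show "\<forall>x\<in>(SIGMA S:Pow (set (odd_classes s)). ?L S) - V. ?f x = 0"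
    proof
      fix x assume x: "x \<in> (SIGMA S:Pow (set (odd_classes s)). ?L S) - V"
      then obtain S as where Sas: "x = (S, as)" "S \<subseteq> set (odd_classes s)" "as \<in> ?L S"
        "\<not> strip_word s mu S as"
        by (auto simp: V_def)
      show "?f x = 0"
      proof (cases "word_weight (?W S) as = 0")
        case False
        then have word: "interlaced_word s mu S as"
          using interlaced_word_if_weight_nonzero [OF assms(1,3)] Sas(2,3) by auto
        then have "\<not> distinct as"
          using Sas(4) by (auto simp: strip_word_def strip_word_axioms_def)
        then show ?thesis
          using interlaced_word.schur_Q_as_not_distinct [OF word] Sas(1) by simp
      qed (simp add: Sas(1))
    qed
  qed
  also have "\<dots> = (\<Sum>x\<in>V. ?g (decreasing_parts (snd x)))"
  proof (rule sum.cong [OF refl])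
    fix x assume "x \<in> V"
    then obtain S as where x: "x = (S, as)" "strip_word s mu S as"
      by (auto simp: V_def)
    interpret strip_word s mu S as by (rule x(2))
    have "mset (reordering s lam mu) = mset lam"
      unfolding reordering_lam by (simp add: decreasing_parts_def)
    moreover have "distinct lam"
      using distinct by (simp add: decreasing_parts_def)
    ultimately have "const (of_int (sign (reordering_perm s lam mu))) * schur_Q lam = schur_Q as"
      unfolding schur_Q_parts reordering_lam [symmetric]
      by (intro reordering_perm_schur_Q) (auto simp: set_lam)
    then show "?f x = ?g (decreasing_parts (snd x))"
      by (simp add: x(1) weight_as const_mult mult_ac flip: \<open>_ = schur_Q as\<close>)
  qed
  also have "\<dots> = (\<Sum>lam \<in> {lam. strict_partition lam \<and> sym_hor_strip s k lam mu}. ?g lam)"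
  proof (rule sum.reindex_bij_betw)
    show "bij_betw (\<lambda>x. decreasing_parts (snd x)) V {lam. strict_partition lam \<and> sym_hor_strip s k lam mu}"
    proof (rule bij_betw_imageI)
      show "inj_on (\<lambda>x. decreasing_parts (snd x)) V"
      proof (rule inj_onI)
        fix x y assume "x \<in> V" "y \<in> V" and eq: "decreasing_parts (snd x) = decreasing_parts (snd y)"
        then obtain S as T bs where xy: "x = (S, as)" "strip_word s mu S as" "y = (T, bs)" "strip_word s mu T bs"
          by (auto simp: V_def)
        have "as = bs"
          using strip_word.as_from_lam [OF xy(2)] strip_word.as_from_lam [OF xy(4)] eq xy by simp
        moreover have "S = T"
          using strip_word.S_from_as [OF xy(2)] strip_word.S_from_as [OF xy(4)] calculation by simp
        ultimately show "x = y" using xy by simp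
      qed
      show "(\<lambda>x. decreasing_parts (snd x)) ` V = {lam. strict_partition lam \<and> sym_hor_strip s k lam mu}"
      proof (intro equalityI subsetI)
        fix lam assume "lam \<in> (\<lambda>x. decreasing_parts (snd x)) ` V"
        then obtain S as where "strip_word s mu S as" "sum_list as = sum_list mu + s * k"
          "lam = decreasing_parts as"
          by (auto simp: V_def)
        then show "lam \<in> {lam. strict_partition lam \<and> sym_hor_strip s k lam mu}"
          using strip_word.strict_partition_lam strip_word.sym_hor_strip_lam by blast
      next
        fix lam assume "lam \<in> {lam. strict_partition lam \<and> sym_hor_strip s k lam mu}"
        then obtain S as where "strip_word s mu S as" "decreasing_parts as = lam"
          "sum_list as = sum_list mu + s * k"
          using strip_to_word [OF assms(1,3)] by blast
        then show "lam \<in> (\<lambda>x. decreasing_parts (snd x)) ` V"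
          by (force simp: V_def)
      qed
    qed
  qed
  finally show ?thesis .
qed

end
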